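(* Let $\Omega\subset\mathbb{RP}^n$ be properly convex and let $\Gamma\subset\mathrm{PGL}(\Omega)$ be finitely generated, discrete and torsion free, containing no non-trivial normal abelian subgroup. Suppose either that $M=\Omega/\Gamma$ is closed, or that there is a subgroup $G\subset\Gamma$ with $G\cong\mathbb{Z}^{n-1}$ and $|\Gamma:G|=\infty$. Then $\Gamma$ does not preserve any proper projective subspace of $\mathbb{RP}^n$.
   Context: $\Omega\subset\mathbb{RP}^n$ is properly convex if its closure is a compact convex subset of some affine chart. $\mathrm{PGL}(\Omega)\subset\mathrm{PGL}(n+1,\mathbb{R})$ is the subgroup preserving $\Omega$.
   Formalization: Ω is additionally assumed to be a nonempty, open, convex set, with n ≥ 1; without interior the claim fails (Ω a single point fixed by a discrete free group), and sets with nonempty interior reduce to the interior of their closure. *)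

theory Defs
  imports "HOL-Analysis.Analysis" "HOL-Algebra.Generated_Groups" "HOL-Algebra.Coset"
begin

section \<open>Real projective space RP^n, n = CARD('m) - 1\<close>

definition proj_pt :: "real^'m \<Rightarrow> (real^'m) set" where
  "proj_pt v = {c *\<^sub>R v | c. c \<noteq> 0}"

definition RP :: "(real^'m) set set" where
  "RP = {proj_pt v | v. v \<noteq> 0}"

text \<open>Quotient topology on RP^n: a set of points is open iff the union of its lines (the cone) is open;
closure in RP^n is the image of the closure of the cone (the projection is an open map).\<close>

definition proj_open :: "(real^'m) set set \<Rightarrow> bool" where
  "proj_open U \<longleftrightarrow> U \<subseteq> RP \<and> open (\<Union>U)"

definition proj_closure :: "(real^'m) set set \<Rightarrow> (real^'m) set set" where
  "proj_closure \<Omega> = {proj_pt v | v. v \<noteq> 0 \<and> v \<in> closure (\<Union>\<Omega>)}"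

definition affine_chart :: "real^'m \<Rightarrow> (real^'m) set set" where
  "affine_chart \<phi> = {p \<in> RP. \<forall>v\<in>p. \<phi> \<bullet> v \<noteq> 0}"

definition chart_slice :: "real^'m \<Rightarrow> (real^'m) set set \<Rightarrow> (real^'m) set" where
  "chart_slice \<phi> X = {v. \<phi> \<bullet> v = 1 \<and> proj_pt v \<in> X}"

definition properly_convex :: "(real^'m) set set \<Rightarrow> bool" where
  "properly_convex \<Omega> \<longleftrightarrow> \<Omega> \<subseteq> RP \<and>
     (\<exists>\<phi>. \<phi> \<noteq> 0 \<and> proj_closure \<Omega> \<subseteq> affine_chart \<phi>
        \<and> convex (chart_slice \<phi> \<Omega>)
        \<and> convex (chart_slice \<phi> (proj_closure \<Omega>))
        \<and> compact (chart_slice \<phi> (proj_closure \<Omega>)))"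

definition pgl_class :: "real^'m^'m \<Rightarrow> (real^'m^'m) set" where
  "pgl_class A = {c *\<^sub>R A | c. c \<noteq> 0}"

definition PGL :: "(real^'m^'m) set monoid" where
  "PGL = \<lparr> carrier = {pgl_class A | A. invertible A},
           monoid.mult = (\<lambda>g h. {A ** B | A B. A \<in> g \<and> B \<in> h}),
           one = pgl_class (mat 1) \<rparr>"

definition pgl_act :: "(real^'m^'m) set \<Rightarrow> (real^'m) set \<Rightarrow> (real^'m) set" where
  "pgl_act g p = \<Union>{(\<lambda>v. A *v v) ` p | A. A \<in> g}"

definition PGL_of :: "(real^'m) set set \<Rightarrow> (real^'m^'m) set set" where
  "PGL_of \<Omega> = {g \<in> carrier PGL. pgl_act g ` \<Omega> = \<Omega>}"

text \<open>Quotient topology on PGL from GL (open subset of matrix space); discreteness of a subset.\<close>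

definition pgl_open :: "(real^'m^'m) set set \<Rightarrow> bool" where
  "pgl_open U \<longleftrightarrow> U \<subseteq> carrier PGL \<and> open {A. invertible A \<and> pgl_class A \<in> U}"

definition pgl_discrete :: "(real^'m^'m) set set \<Rightarrow> bool" where
  "pgl_discrete \<Gamma> \<longleftrightarrow> (\<forall>\<gamma>\<in>\<Gamma>. \<exists>U. pgl_open U \<and> U \<inter> \<Gamma> = {\<gamma>})"

definition finitely_generated_sub :: "('a, 'b) monoid_scheme \<Rightarrow> 'a set \<Rightarrow> bool" where
  "finitely_generated_sub G H \<longleftrightarrow> (\<exists>S. finite S \<and> S \<subseteq> H \<and> generate G S = H)"

definition torsion_free_sub :: "('a, 'b) monoid_scheme \<Rightarrow> 'a set \<Rightarrow> bool" where
  "torsion_free_sub G H \<longleftrightarrow>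
     (\<forall>g\<in>H. g \<noteq> \<one>\<^bsub>G\<^esub> \<longrightarrow> (\<forall>k::nat. k > 0 \<longrightarrow> g [^]\<^bsub>G\<^esub> k \<noteq> \<one>\<^bsub>G\<^esub>))"

definition Zpow_group :: "nat \<Rightarrow> (nat \<Rightarrow> int) monoid" where
  "Zpow_group k = \<lparr> carrier = {v. \<forall>i\<ge>k. v i = 0},
                    monoid.mult = (\<lambda>v w i. v i + w i),
                    one = (\<lambda>i. 0) \<rparr>"

text \<open>Quotient Omega/Gamma is compact: every cover of Omega by Gamma-invariant open sets
(= open sets of the quotient topology) has a finite subcover.\<close>

definition compact_quotient :: "(real^'m) set set \<Rightarrow> (real^'m^'m) set set \<Rightarrow> bool" where
  "compact_quotient \<Omega> \<Gamma> \<longleftrightarrow>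
     (\<forall>\<U>. (\<forall>U\<in>\<U>. U \<subseteq> \<Omega> \<and> proj_open U \<and> (\<forall>g\<in>\<Gamma>. pgl_act g ` U = U)) \<and> \<Omega> \<subseteq> \<Union>\<U>
        \<longrightarrow> (\<exists>\<V>. finite \<V> \<and> \<V> \<subseteq> \<U> \<and> \<Omega> \<subseteq> \<Union>\<V>))"

definition proj_subspace :: "(real^'m) set \<Rightarrow> (real^'m) set set" where
  "proj_subspace V = {proj_pt v | v. v \<in> V \<and> v \<noteq> 0}"

end

(*
A lift H of Gamma to matrices of determinant +-1 preserves a sharp open cone C over Omega.  From an
invariant subspace V one builds a product K of two cones, in complementary blocks of R^N, on which H
acts properly modulo independent scalings of the two factors: if V meets C, or meets the closure of C
only in 0, one factor is a line with trivial action; if V only touches the boundary, one moves a point of C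
towards V, renormalizes as in Benzecri's theorem and passes to a limit.  A Zassenhaus argument shows
that the limit is still discrete and faithful: elements that become small generate nilpotent groups, and
these would produce a normal abelian subgroup.

So H acts properly on a cone of the right dimension with one scaling parameter to spare.  If Omega/Gamma
is compact, there are equivariant maps C -> K and K -> C; the composition is onto up to scaling by
Brouwer, but the second map can be made invariant under both scalings, so the cone over its image is null.
If Gamma contains Z^(N-2), adding the two scalings gives a proper action of Z^N on an N-dimensional
cone.  It must be cocompact, as otherwise an equivariant map from R^N to the cone could be pushed off a
finite regular fibre of an equivariant map back to R^N, although the composition is onto.  Hence Z^(N-2)
has finite index.
*)
theory Submission imports Defs begin

section \<open>Matrix norms and Sard\<close>

text \<open>With N = n + 1, both alternatives are dimension counts. Divided by its two scalings,
  \<open>K\<close> is a contractible manifold of dimension N - 2, so a torsion-free group acting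
  properly on it has cohomological dimension at most N - 2. A closed aspherical quotient of the (N -
  1)-dimensional Omega would force N - 1, and a subgroup Z^(N-2) attaining the bound has finite
  index. Brouwer and Sard stand in for homology. The obstacle is the production of \<open>K\<close>.
  In a block triangular group the off-diagonal entries can carry the discreteness, as in a group of
  translations, so the diagonal blocks alone need not be discrete. The escape to the boundary
  compares the blocks with a limit of conjugates of the group: the two blocks control the
  displacement of the moving point, hence boundedness in the blocks gives boundedness in the limit.
  Finite generation makes the limit exist, the absence of normal abelian subgroups makes it
  discrete, and torsion freeness removes the finite kernel of the blocks.\<close>

lemma norm_matrix_vector_mult_le: "norm (A *v x) \<le> norm A * norm x" for A :: "real^'n^'m"
proof -
  have "norm (A *v x) = L2_set (\<lambda>i. norm ((A *v x) $ i)) UNIV"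
    by (simp add: norm_vec_def)
  also have "\<dots> \<le> L2_set (\<lambda>i. norm (A $ i) * norm x) UNIV"
    by (rule L2_set_mono) (auto simp: matrix_vector_mul_component intro: Cauchy_Schwarz_ineq2)
  also have "\<dots> = norm A * norm x"
    by (simp add: norm_vec_def[of A] L2_set_left_distrib)
  finally show ?thesis .
qed

lemma norm_transpose: "norm (transpose A) = norm A" for A :: "real^'n^'m"
  by (simp add: norm_eq_sqrt_inner inner_vec_def transpose_def) (subst sum.swap, rule refl)

lemma norm_matrix_mult_le: "norm (A ** B) \<le> norm A * norm B" for A :: "real^'n^'m" and B :: "real^'p^'n"
proof -
  have row: "(A ** B) $ i = transpose B *v (A $ i)" for i
    by (simp add: vec_eq_iff matrix_matrix_mult_def matrix_vector_mult_def transpose_def mult.commute)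
  have "norm (A ** B) = L2_set (\<lambda>i. norm ((A ** B) $ i)) UNIV"
    by (simp add: norm_vec_def)
  also have "\<dots> \<le> L2_set (\<lambda>i. norm (A $ i) * norm B) UNIV"
    by (rule L2_set_mono) (metis row norm_matrix_vector_mult_le norm_transpose mult.commute, simp)
  also have "\<dots> = norm A * norm B"
    by (simp add: norm_vec_def[of A] L2_set_left_distrib)
  finally show ?thesis .
qed

lemma bounded_bilinear_matrix_mult: "bounded_bilinear ((**) :: real^'n^'m \<Rightarrow> real^'p^'n \<Rightarrow> real^'p^'m)"
proof
  show "\<exists>K. \<forall>(a::real^'n^'m) (b::real^'p^'n). norm (a ** b) \<le> norm a * norm b * K"
    by (rule exI[of _ 1]) (simp add: norm_matrix_mult_le)
qed (auto simp: vec_eq_iff matrix_matrix_mult_def sum_distrib_left sum.distrib algebra_simps)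

lemma bounded_bilinear_matrix_vector_mult: "bounded_bilinear ((*v) :: real^'n^'m \<Rightarrow> real^'n \<Rightarrow> real^'m)"
proof
  show "\<exists>K. \<forall>(a::real^'n^'m) b. norm (a *v b) \<le> norm a * norm b * K"
    by (rule exI[of _ 1]) (simp add: norm_matrix_vector_mult_le)
qed (auto simp: algebra_simps vec_eq_iff matrix_vector_mult_def sum_distrib_left sum.distrib)

lemmas tendsto_matrix_mult [tendsto_intros] = bounded_bilinear.tendsto[OF bounded_bilinear_matrix_mult]
lemmas tendsto_matrix_vector_mult [tendsto_intros] =
  bounded_bilinear.tendsto[OF bounded_bilinear_matrix_vector_mult]
lemmas matrix_diff_ldistrib = bounded_bilinear.diff_right[OF bounded_bilinear_matrix_mult]
lemmas matrix_diff_rdistrib = bounded_bilinear.diff_left[OF bounded_bilinear_matrix_mult]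
lemmas matrix_scaleR_left = bounded_bilinear.scaleR_left[OF bounded_bilinear_matrix_mult]
lemmas matrix_scaleR_right = bounded_bilinear.scaleR_right[OF bounded_bilinear_matrix_mult]
lemmas matrix_vector_scaleR_left = bounded_bilinear.scaleR_left[OF bounded_bilinear_matrix_vector_mult]

lemma norm_matrix_le_sum_columns:
  "norm A \<le> (\<Sum>j\<in>UNIV. norm (A *v axis j 1))" for A :: "real^'n^'m"
proof -
  have "norm A = norm (transpose A)" by (simp add: norm_transpose)
  also have "\<dots> \<le> (\<Sum>j\<in>UNIV. norm (transpose A $ j))"
    unfolding norm_vec_def[of "transpose A"] by (rule L2_set_le_sum) simp
  also have "\<dots> = (\<Sum>j\<in>UNIV. norm (A *v axis j 1))"
    by (intro sum.cong refl arg_cong[where f=norm])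
      (simp add: vec_eq_iff transpose_def matrix_vector_mult_basis column_def)
  finally show ?thesis .
qed

text \<open>The ball contains d times each basis vector, which bounds the columns by c / d; the
  factor CARD('n) comes from adding the columns to reach the Frobenius norm carried by the matrix
  type.\<close>

lemma norm_matrix_le_of_ball:
  fixes A :: "real^'n^'m"
  assumes "d > 0" and b: "\<And>u. norm u \<le> d \<Longrightarrow> norm (A *v u) \<le> c"
  shows "norm A \<le> CARD('n) * (c / d)"
proof -
  have "norm (A *v axis j 1) \<le> c / d" for j
  proof -
    have "norm (A *v (d *\<^sub>R axis j 1)) \<le> c" using assms by (intro b) simp
    then have "d * norm (A *v axis j 1) \<le> c" using \<open>d > 0\<close>
      by (simp add: matrix_vector_mult_scaleR)
    then show ?thesis using \<open>d > 0\<close> by (simp add: field_simps)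
  qed
  then have "(\<Sum>j\<in>UNIV. norm (A *v axis j 1)) \<le> (\<Sum>j\<in>(UNIV::'n set). c / d)" by (intro sum_mono)
  then show ?thesis using norm_matrix_le_sum_columns[of A] by simp
qed

text \<open>A copy of a finite index type that inherits the order of the naturals, so that
  coordinates indexed by any finite type can be relabelled by a well-ordered one of the same
  size.\<close>

typedef ('a::finite) idx = "{..<CARD('a)}" morphisms idx_nat Abs_idx
  by (rule exI[of _ 0]) simp

instantiation idx :: (finite) linorder
begin
definition less_eq_idx where "x \<le> y \<longleftrightarrow> idx_nat x \<le> idx_nat y"
definition less_idx where "x < y \<longleftrightarrow> idx_nat x < idx_nat y"
instance by standard (auto simp: less_eq_idx_def less_idx_def idx_nat_inject)
end

instance idx :: (finite) finite
proof
  show "finite (UNIV :: 'a idx set)"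
    unfolding type_definition.univ[OF type_definition_idx] by simp
qed

instance idx :: (finite) wellorder
proof
  fix P :: "'a idx \<Rightarrow> bool" and a
  assume *: "\<And>x. (\<And>y. y < x \<Longrightarrow> P y) \<Longrightarrow> P x"
  show "P a"
    by (induction a rule: measure_induct_rule[of idx_nat]) (auto intro: * simp: less_idx_def)
qed

lemma card_idx: "CARD('a::finite idx) = CARD('a)"
  unfolding type_definition.card[OF type_definition_idx] by simp

text \<open>The library version of Sard's theorem wants a well-ordered index type; relabelling of
  the coordinates removes that restriction.\<close>

lemma Sard_negligible:
  fixes f :: "real^'m \<Rightarrow> real^'m"
  assumes der: "\<And>x. x \<in> S \<Longrightarrow> (f has_derivative f' x) (at x)"
    and sing: "\<And>x. x \<in> S \<Longrightarrow> \<not> inj (f' x)"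
  shows "negligible (f ` S)"
proof -
  have "\<exists>p :: 'm idx \<Rightarrow> 'm. bij p"
    by (rule finite_same_card_bij[of UNIV UNIV]) (auto simp: card_idx)
  then obtain p :: "'m idx \<Rightarrow> 'm" where p: "bij p" by blast
  define P :: "real^'m \<Rightarrow> real^'m idx" where "P x = (\<chi> i. x $ p i)" for x
  define Q :: "real^'m idx \<Rightarrow> real^'m" where "Q x = (\<chi> i. x $ inv_into UNIV p i)" for x
  have PQ: "P (Q x) = x" and QP: "Q (P y) = y" for x y
    using p by (auto simp: P_def Q_def vec_eq_iff bij_def surj_f_inv_f inv_f_f)
  have lP: "linear P" and lQ: "linear Q"
    by (auto simp: P_def Q_def vec_eq_iff intro!: linearI)
  have "negligible ((P \<circ> f \<circ> Q) ` (P ` S))"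
  proof (rule baby_Sard)
    fix x assume "x \<in> P ` S"
    then have x: "Q x \<in> S" by (auto simp: QP)
    have "(P \<circ> (f \<circ> Q) has_derivative P \<circ> (f' (Q x) \<circ> Q)) (at x)"
      by (intro diff_chain_at der[OF x] linear_imp_has_derivative lP lQ)
    then show "(P \<circ> f \<circ> Q has_derivative P \<circ> f' (Q x) \<circ> Q) (at x within P ` S)"
      by (simp add: o_assoc has_derivative_at_withinI)
    have lf: "linear (f' (Q x))" using der[OF x] has_derivative_linear by blast
    have "\<not> inj (P \<circ> f' (Q x) \<circ> Q)"
    proof
      assume i: "inj (P \<circ> f' (Q x) \<circ> Q)"
      have "f' (Q x) = Q \<circ> (P \<circ> f' (Q x) \<circ> Q) \<circ> P" by (auto simp: PQ QP)
      moreover have "inj Q" "inj P" by (metis PQ injI, metis QP injI)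
      ultimately have "inj (f' (Q x))" using i by (metis inj_compose)
      with sing[OF x] show False by blast
    qed
    moreover have "linear (P \<circ> f' (Q x) \<circ> Q)" using lf lP lQ by (intro linear_compose)
    ultimately show "rank (matrix (P \<circ> f' (Q x) \<circ> Q)) < CARD('m idx)"
      by (simp add: less_rank_noninjective)
  qed simp
  moreover have "(P \<circ> f \<circ> Q) ` (P ` S) = P ` (f ` S)" by (auto simp: QP image_iff)
  ultimately have "negligible (P ` (f ` S))" by simp
  then have "negligible (Q ` (P ` (f ` S)))"
    by (rule negligible_differentiable_image_negligible[rotated])
      (auto simp: card_idx linear_imp_differentiable_on lQ)
  then show ?thesis by (simp add: image_image QP)
qed

section \<open>Equivariant smoothing and lattices\<close>

text \<open>The index set is cut down to the nonzero terms, so an average over an infinite group is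
  an ordinary finite sum wherever only finitely many terms survive; elsewhere the value is the
  default 0.\<close>

definition esum :: "'g set \<Rightarrow> ('g \<Rightarrow> 'x \<Rightarrow> 'v::comm_monoid_add) \<Rightarrow> 'x \<Rightarrow> 'v" where
  "esum H f x = (\<Sum>h\<in>{h\<in>H. f h x \<noteq> 0}. f h x)"

text \<open>The ball is one of the ambient space, not relative to \<open>X\<close>: near each point
  the average agrees with one fixed finite sum on an open set, which is what a derivative at that
  point needs.\<close>

definition loc_fin :: "'g set \<Rightarrow> ('g \<Rightarrow> 'x::metric_space \<Rightarrow> 'v::zero) \<Rightarrow> 'x set \<Rightarrow> bool" where
  "loc_fin H f X \<longleftrightarrow> (\<forall>x\<in>X. \<exists>e>0. finite {h\<in>H. \<exists>y\<in>ball x e. f h y \<noteq> 0})"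

lemma esum_eq_sum:
  assumes "finite F" "F \<subseteq> H" "\<And>h. h \<in> H \<Longrightarrow> f h x \<noteq> 0 \<Longrightarrow> h \<in> F"
  shows "esum H f x = (\<Sum>h\<in>F. f h x)"
  unfolding esum_def by (rule sum.mono_neutral_left) (use assms in auto)

lemma loc_fin_finite: "loc_fin H f X \<Longrightarrow> x \<in> X \<Longrightarrow> finite {h\<in>H. f h x \<noteq> 0}"
  unfolding loc_fin_def by (metis (mono_tags, lifting) centre_in_ball finite_subset mem_Collect_eq subsetI)

lemma loc_fin_local:
  assumes "loc_fin H f X" "x \<in> X"
  obtains e F where "e > 0" "finite F" "F \<subseteq> H" "\<And>y. y \<in> ball x e \<Longrightarrow> esum H f y = (\<Sum>h\<in>F. f h y)"
proof -
  from assms obtain e where e: "e > 0" "finite {h\<in>H. \<exists>y\<in>ball x e. f h y \<noteq> 0}"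
    unfolding loc_fin_def by blast
  show thesis
    by (rule that[OF e]) (auto intro!: esum_eq_sum[OF e(2)])
qed

lemma continuous_on_esum:
  fixes f :: "'g \<Rightarrow> 'x::metric_space \<Rightarrow> 'v::real_normed_vector"
  assumes lf: "loc_fin H f X" and c: "\<And>h. h \<in> H \<Longrightarrow> continuous_on X (f h)"
  shows "continuous_on X (esum H f)"
  unfolding continuous_on_eq_continuous_within
proof
  fix x assume x: "x \<in> X"
  obtain e F where eF: "e > 0" "finite F" "F \<subseteq> H"
    and eq: "\<And>y. y \<in> ball x e \<Longrightarrow> esum H f y = (\<Sum>h\<in>F. f h y)"
    using loc_fin_local[OF lf x] by metis
  have "continuous (at x within X) (\<lambda>y. \<Sum>h\<in>F. f h y)"
    using c eF x by (intro continuous_intros) (auto simp: continuous_on_eq_continuous_within)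
  then show "continuous (at x within X) (esum H f)"
    by (rule continuous_transform_within[OF _ eF(1) x]) (simp add: eq dist_commute)
qed

lemma differentiable_esum:
  fixes f :: "'g \<Rightarrow> 'x::real_normed_vector \<Rightarrow> 'v::real_normed_vector"
  assumes lf: "loc_fin H f X" and x: "x \<in> X" and d: "\<And>h. h \<in> H \<Longrightarrow> f h differentiable (at x)"
  shows "esum H f differentiable (at x)"
proof -
  obtain e F where eF: "e > 0" "finite F" "F \<subseteq> H"
    and eq: "\<And>y. y \<in> ball x e \<Longrightarrow> esum H f y = (\<Sum>h\<in>F. f h y)"
    using loc_fin_local[OF lf x] by metis
  have "(\<lambda>y. \<Sum>h\<in>F. f h y) differentiable (at x)"
    using d eF by (intro differentiable_sum) auto
  then obtain D where "((\<lambda>y. \<Sum>h\<in>F. f h y) has_derivative D) (at x)"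
    unfolding differentiable_def by blast
  then have "(esum H f has_derivative D) (at x)"
    by (rule has_derivative_transform_within_open[of _ _ _ _ "ball x e"]) (use eF eq in auto)
  then show ?thesis unfolding differentiable_def by blast
qed

text \<open>Reindexing by \<open>m\<close>, a translation of the group, carries the terms at
  \<open>x\<close> to the terms at \<open>T x\<close>. A linear \<open>L\<close> on the target
  suffices: affine equivariance becomes linear after adding a coordinate.\<close>

lemma esum_equivariant:
  assumes bij: "bij_betw m H H" and fin: "finite {h\<in>H. f h x \<noteq> 0}"
    and eq: "\<And>h. h \<in> H \<Longrightarrow> f' (m h) (T x) = L (f h x)" and L: "linear L"
  shows "esum H f' (T x) = L (esum H f x)"
proof -
  let ?S = "{h\<in>H. f h x \<noteq> 0}"
  have "esum H f' (T x) = (\<Sum>h\<in>m ` ?S. f' h (T x))"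
  proof (rule esum_eq_sum)
    show "finite (m ` ?S)" using fin by blast
    show "m ` ?S \<subseteq> H" using bij by (auto simp: bij_betw_def)
    fix h assume h: "h \<in> H" "f' h (T x) \<noteq> 0"
    then obtain h0 where "h0 \<in> H" "h = m h0" using bij by (auto simp: bij_betw_def)
    moreover have "f h0 x \<noteq> 0" using h(2) eq[of h0] calculation linear_0[OF L] by auto
    ultimately show "h \<in> m ` ?S" by blast
  qed
  also have "\<dots> = (\<Sum>h\<in>?S. f' (m h) (T x))"
    by (rule sum.reindex_cong[OF _ refl refl]) (use bij in \<open>auto simp: bij_betw_def inj_on_def\<close>)
  also have "\<dots> = (\<Sum>h\<in>?S. L (f h x))" by (rule sum.cong) (auto simp: eq)
  also have "\<dots> = L (esum H f x)" by (simp add: esum_def linear_sum[OF L])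
  finally show ?thesis .
qed

lemma sum_in_cone:
  assumes "finite F" "F \<noteq> {}" "\<And>x y. x \<in> K \<Longrightarrow> y \<in> K \<Longrightarrow> x + y \<in> K" "\<And>h. h \<in> F \<Longrightarrow> f h \<in> K"
  shows "sum f F \<in> (K :: 'a::comm_monoid_add set)"
  using assms(1,2,4)
proof (induction F rule: finite_ne_induct)
  case (insert x F) then show ?case using assms(3) by simp
qed simp

text \<open>Squaring removes the corner of the positive part: at 0 the difference quotient is
  bounded by the size of the increment. One derivative is enough for the bump functions here, since
  \<open>Sard_negligible\<close> asks only for differentiability between equal dimensions.\<close>

lemma differentiable_positive_part_square:
  fixes f :: "'a::real_normed_vector \<Rightarrow> real"
  assumes "f differentiable (at x)"
  shows "(\<lambda>y. (max 0 (f y))\<^sup>2) differentiable (at x)"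
proof -
  have "((\<lambda>s::real. (max 0 s)\<^sup>2) has_real_derivative 2 * max 0 s) (at s)" for s
  proof -
    consider "s < 0" | "s > 0" | "s = 0" by linarith
    then show ?thesis
    proof cases
      case 1
      have "((\<lambda>s::real. 0) has_real_derivative 2 * max 0 s) (at s)" using 1 by simp
      then show ?thesis
        by (rule has_field_derivative_transform_within_open[of _ _ _ "{..<0}"]) (use 1 in auto)
    next
      case 2
      have "((\<lambda>s::real. s\<^sup>2) has_real_derivative 2 * max 0 s) (at s)"
        using 2 by (auto intro!: derivative_eq_intros)
      then show ?thesis
        by (rule has_field_derivative_transform_within_open[of _ _ _ "{0<..}"]) (use 2 in auto)
    next
      case 3
      have "((\<lambda>h::real. (max 0 h)\<^sup>2 / h) \<longlongrightarrow> 0) (at 0)"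
      proof (rule Lim_null_comparison)
        show "\<forall>\<^sub>F h in at 0. norm ((max 0 h)\<^sup>2 / h) \<le> \<bar>h::real\<bar>"
          by (rule always_eventually) (simp add: max_def power2_eq_square)
        show "((\<lambda>h::real. \<bar>h\<bar>) \<longlongrightarrow> 0) (at 0)" by (auto intro!: tendsto_eq_intros)
      qed
      then show ?thesis using 3 by (simp add: DERIV_def)
    qed
  qed
  then have "(\<lambda>s::real. (max 0 s)\<^sup>2) differentiable (at (f x))"
    unfolding differentiable_def has_field_derivative_def by blast
  then show ?thesis using differentiable_chain_at[OF assms, of "\<lambda>s. (max 0 s)\<^sup>2"]
    by (simp add: o_def)
qed

text \<open>Each summand is positive exactly on an open ball whose closed ball lies in
  \<open>K\<close>; finitely many such balls cover \<open>Q\<close>, and the union of the closed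
  balls is the compact set outside which the sum vanishes.\<close>

lemma bump_exists:
  fixes K :: "'a::euclidean_space set"
  assumes "compact Q" "open K" "Q \<subseteq> K"
  obtains \<beta> :: "'a \<Rightarrow> real" and Q' where "\<And>x. \<beta> differentiable (at x)" "\<And>x. 0 \<le> \<beta> x"
    "\<And>x. x \<in> Q \<Longrightarrow> 0 < \<beta> x" "compact Q'" "Q' \<subseteq> K" "\<And>x. \<beta> x \<noteq> 0 \<Longrightarrow> x \<in> Q'"
proof -
  have "\<forall>x\<in>Q. \<exists>e>0. cball x e \<subseteq> K" using assms open_contains_cball by blast
  then obtain e where e: "\<And>x. x \<in> Q \<Longrightarrow> e x > 0 \<and> cball x (e x) \<subseteq> K" by metis
  obtain C where C: "C \<subseteq> Q" "finite C" "Q \<subseteq> (\<Union>c\<in>C. ball c (e c))"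
    by (rule compactE_image[OF assms(1), of Q "\<lambda>c. ball c (e c)"]) (use e in force)+
  define b :: "'a \<Rightarrow> 'a \<Rightarrow> real" where "b c x = (max 0 ((e c)\<^sup>2 - (x - c) \<bullet> (x - c)))\<^sup>2" for c x
  have pos: "b c x \<noteq> 0 \<longleftrightarrow> x \<in> ball c (e c)" if "c \<in> C" for c x
  proof -
    have "e c > 0" using e C that by blast
    have "b c x \<noteq> 0 \<longleftrightarrow> (norm (x - c))\<^sup>2 < (e c)\<^sup>2"
      by (auto simp: b_def max_def power2_norm_eq_inner)
    also have "\<dots> \<longleftrightarrow> norm (x - c) < e c"
      using \<open>e c > 0\<close> abs_le_square_iff[of "e c" "norm (x - c)"] by (simp add: not_le[symmetric])
    finally show ?thesis by (simp add: dist_norm norm_minus_commute)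
  qed
  show thesis
  proof
    show "(\<lambda>x. \<Sum>c\<in>C. b c x) differentiable (at x)" for x
      unfolding b_def using C(2)
      by (intro differentiable_sum ballI differentiable_positive_part_square derivative_intros) auto
    show "0 \<le> (\<Sum>c\<in>C. b c x)" for x by (auto simp: b_def intro: sum_nonneg)
    show "0 < (\<Sum>c\<in>C. b c x)" if x: "x \<in> Q" for x
    proof -
      obtain c where "c \<in> C" "x \<in> ball c (e c)" using x C by blast
      then have "b c x \<noteq> 0" using pos by blast
      moreover have "\<And>c. b c x \<ge> 0" by (simp add: b_def)
      ultimately show ?thesis using C(2) \<open>c \<in> C\<close> by (metis order_le_less sum_pos2)
    qed
    show "compact (\<Union>c\<in>C. cball c (e c))" using C by auto
    show "(\<Union>c\<in>C. cball c (e c)) \<subseteq> K" using C e by blast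
    show "x \<in> (\<Union>c\<in>C. cball c (e c))" if nz: "(\<Sum>c\<in>C. b c x) \<noteq> 0" for x
    proof -
      obtain c where "c \<in> C" "b c x \<noteq> 0" using sum.not_neutral_contains_not_neutral[OF nz] by blast
      then show ?thesis using pos by force
    qed
  qed
qed

section \<open>The integer lattice and maps commuting with it\<close>

definition lattice :: "(real^'m) set" where "lattice = {t. \<forall>i. t $ i \<in> \<int>}"

lemma lattice_closed [simp]:
  "0 \<in> lattice" "g \<in> lattice \<Longrightarrow> h \<in> lattice \<Longrightarrow> g + h \<in> lattice" "g \<in> lattice \<Longrightarrow> - g \<in> lattice"
  "g \<in> lattice \<Longrightarrow> h \<in> lattice \<Longrightarrow> g - h \<in> lattice"
  by (auto simp: lattice_def)

lemma finite_lattice_bounded: "finite {g \<in> lattice. norm (g :: real^'m) \<le> R}"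
proof -
  define k where "k = \<lceil>R\<rceil>"
  have "{g \<in> lattice. norm (g :: real^'m) \<le> R} \<subseteq>
      (\<lambda>f. \<chi> i. of_int (f i)) ` (PiE UNIV (\<lambda>_. {-k..k}))"
  proof
    fix g :: "real^'m" assume g: "g \<in> {g \<in> lattice. norm g \<le> R}"
    then have "\<forall>i. \<exists>z. g $ i = of_int z" by (auto simp: lattice_def Ints_def)
    then obtain f where f: "\<And>i. g $ i = of_int (f i)" by metis
    have "f i \<in> {-k..k}" for i
    proof -
      have "\<bar>g $ i\<bar> \<le> R" using g component_le_norm_cart[of g i] by simp
      then show ?thesis unfolding f k_def by (auto simp: abs_le_iff) linarith+
    qed
    then show "g \<in> (\<lambda>f. \<chi> i. of_int (f i)) ` (PiE UNIV (\<lambda>_. {-k..k}))"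
      by (intro image_eqI[of _ _ f]) (auto simp: f vec_eq_iff)
  qed
  moreover have "finite (PiE (UNIV::'m set) (\<lambda>_. {-k..k}))" by (intro finite_PiE) auto
  ultimately show ?thesis using finite_surj by blast
qed

lemma lattice_floor:
  fixes t :: "real^'m"
  obtains h u where "h \<in> lattice" "u \<in> cbox 0 (\<chi> i. 1)" "t = u + h"
proof
  show "(\<chi> i. of_int \<lfloor>t $ i\<rfloor>) \<in> lattice" by (simp add: lattice_def)
  show "t - (\<chi> i. of_int \<lfloor>t $ i\<rfloor>) \<in> cbox 0 (\<chi> i. 1)"
    by (auto simp: mem_box_cart) linarith
qed simp

lemma countable_lattice: "countable (lattice :: (real^'m) set)"
proof -
  have "lattice = (\<Union>n::nat. {g \<in> lattice. norm (g :: real^'m) \<le> real n})"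
    using real_arch_simple by auto
  moreover have "countable (\<Union>n::nat. {g \<in> lattice. norm (g :: real^'m) \<le> real n})"
    by (intro countable_UN countable_finite finite_lattice_bounded countableI_type)
  ultimately show ?thesis by simp
qed

text \<open>Equivariance makes \<open>G t - t\<close> periodic, hence bounded by some
  \<open>R\<close> everywhere because the closed unit cube is compact. A solution of
  \<open>G t = s\<close> is a fixed point of \<open>t + s - G t\<close>, which stays within
  \<open>R\<close> of \<open>s\<close>, so Brouwer applies on that ball.\<close>

lemma surj_if_lattice_equivariant:
  fixes G :: "real^'m \<Rightarrow> real^'m"
  assumes c: "continuous_on UNIV G" and eq: "\<And>t h. h \<in> lattice \<Longrightarrow> G (t + h) = G t + h"
  shows "\<exists>t. G t = s"
proof -
  let ?Q = "cbox 0 (\<chi> i. 1) :: (real^'m) set"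
  have "compact ((\<lambda>t. G t - t) ` ?Q)"
    by (intro compact_continuous_image continuous_intros continuous_on_subset[OF c]) auto
  then obtain R where R: "\<And>u. u \<in> ?Q \<Longrightarrow> norm (G u - u) \<le> R"
    using compact_imp_bounded bounded_iff by (metis (no_types, lifting) imageI)
  have R': "norm (G t - t) \<le> R" for t
  proof -
    obtain h u where "h \<in> lattice" "u \<in> ?Q" "t = u + h" by (rule lattice_floor)
    then show ?thesis using R[of u] by (simp add: eq)
  qed
  have "R \<ge> 0" using R'[of 0] norm_ge_zero order_trans by blast
  obtain x where "x \<in> cball s R" "x + s - G x = x"
  proof (rule brouwer[of "cball s R" "\<lambda>t. t + s - G t"])
    show "(\<lambda>t. t + s - G t) \<in> cball s R \<rightarrow> cball s R"
      using R' by (auto simp: dist_norm algebra_simps)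
    show "continuous_on (cball s R) (\<lambda>t. t + s - G t)"
      by (intro continuous_intros continuous_on_subset[OF c]) auto
  qed (use \<open>R \<ge> 0\<close> in auto)
  then show ?thesis by (intro exI[of _ x]) (simp add: algebra_simps)
qed

section \<open>Proper actions of a lattice of full rank are cocompact\<close>

text \<open>Z^m acts on an open convex cone of the same dimension m, the case in which properness
  forces a compact quotient. \<open>\<tau>\<close> is total on R^m to avoid a separate group type;
  only its values at lattice points are constrained. The cone may contain lines.\<close>

locale lattice_action =
  fixes K :: "(real^'m) set" and \<tau> :: "real^'m \<Rightarrow> real^'m^'m"
  assumes openK: "open K" and convexK: "convex K" and K_ne: "K \<noteq> {}"
    and K_add: "\<And>x y. x \<in> K \<Longrightarrow> y \<in> K \<Longrightarrow> x + y \<in> K"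
    and K_scale: "\<And>a x. a > 0 \<Longrightarrow> x \<in> K \<Longrightarrow> a *\<^sub>R x \<in> K"
    and \<tau>_0: "\<tau> 0 = mat 1"
    and \<tau>_add: "\<And>g h. g \<in> lattice \<Longrightarrow> h \<in> lattice \<Longrightarrow> \<tau> (g + h) = \<tau> g ** \<tau> h"
    and \<tau>_in: "\<And>g x. g \<in> lattice \<Longrightarrow> x \<in> K \<Longrightarrow> \<tau> g *v x \<in> K"
    and proper: "\<And>Q. compact Q \<Longrightarrow> Q \<subseteq> K \<Longrightarrow> finite {g \<in> lattice. \<exists>q\<in>Q. \<tau> g *v q \<in> Q}"
begin

section \<open>Orbits, freeness and separation for a proper lattice action\<close>

abbreviation act :: "real^'m \<Rightarrow> real^'m \<Rightarrow> real^'m" where "act g x \<equiv> \<tau> g *v x"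

definition orb :: "(real^'m) set \<Rightarrow> (real^'m) set" where "orb P = (\<Union>g\<in>lattice. act g ` P)"

definition equiv :: "(real^'m) set \<Rightarrow> (real^'m \<Rightarrow> real^'m) \<Rightarrow> bool" where
  "equiv W F \<longleftrightarrow> continuous_on UNIV F \<and> range F \<subseteq> W \<and> (\<forall>t. \<forall>h\<in>lattice. F (t + h) = act h (F t))"

lemma act_0 [simp]: "act 0 x = x"
  by (simp add: \<tau>_0)

lemma act_act: "g \<in> lattice \<Longrightarrow> h \<in> lattice \<Longrightarrow> act g (act h x) = act (g + h) x"
  by (simp add: \<tau>_add matrix_vector_mul_assoc)

lemma act_minus [simp]: "g \<in> lattice \<Longrightarrow> act (- g) (act g x) = x" "g \<in> lattice \<Longrightarrow> act g (act (- g) x) = x"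
  by (simp_all add: act_act)

lemma continuous_act [continuous_intros]: "continuous_on X f \<Longrightarrow> continuous_on X (\<lambda>x. act g (f x))"
  by (rule bounded_linear.continuous_on[OF matrix_vector_mul_bounded_linear])

lemma compact_act: "compact Q \<Longrightarrow> compact (act g ` Q)"
  by (rule compact_continuous_image[OF continuous_act[OF continuous_on_id]])

lemma differentiable_act: "(\<lambda>x. act g x) differentiable (at x)"
  by (intro linear_imp_differentiable matrix_vector_mul_linear)

lemma orb_invariant: "g \<in> lattice \<Longrightarrow> act g x \<in> orb P \<longleftrightarrow> x \<in> orb P"
proof -
  have *: "x \<in> orb P \<Longrightarrow> g \<in> lattice \<Longrightarrow> act g x \<in> orb P" for x g
    unfolding orb_def by (auto simp: act_act) (metis imageI lattice_closed(2))
  show "g \<in> lattice \<Longrightarrow> ?thesis" using *[of x g] *[of "act g x" "- g"] by auto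
qed

lemma orb_superset: "P \<subseteq> orb P"
  unfolding orb_def
proof
  fix x assume "x \<in> P"
  then show "x \<in> (\<Union>g\<in>lattice. act g ` P)" by (intro UN_I[of 0] image_eqI[of _ _ x]) simp_all
qed

lemma orb_subset_K: "P \<subseteq> K \<Longrightarrow> orb P \<subseteq> K"
  unfolding orb_def using \<tau>_in by blast

lemma orb_Un: "orb (P \<union> P') = orb P \<union> orb P'"
  unfolding orb_def by blast

lemma local_finite:
  assumes x: "x \<in> K" and Q: "compact Q" "Q \<subseteq> K"
  obtains e where "e > 0" "ball x e \<subseteq> K" "finite {g \<in> lattice. \<exists>y\<in>ball x e. act (- g) y \<in> Q}"
proof -
  obtain e where e: "e > 0" "cball x e \<subseteq> K" using openK x open_contains_cball by blast
  have "finite {g \<in> lattice. \<exists>q\<in>Q \<union> cball x e. act g q \<in> Q \<union> cball x e}"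
    by (rule proper) (use Q e in auto)
  then have "finite (uminus ` {g \<in> lattice. \<exists>q\<in>Q \<union> cball x e. act g q \<in> Q \<union> cball x e})" by blast
  moreover have "{g \<in> lattice. \<exists>y\<in>ball x e. act (- g) y \<in> Q} \<subseteq>
      uminus ` {g \<in> lattice. \<exists>q\<in>Q \<union> cball x e. act g q \<in> Q \<union> cball x e}"
  proof
    fix g assume "g \<in> {g \<in> lattice. \<exists>y\<in>ball x e. act (- g) y \<in> Q}"
    then show "g \<in> uminus ` {g \<in> lattice. \<exists>q\<in>Q \<union> cball x e. act g q \<in> Q \<union> cball x e}"
      by (intro image_eqI[of _ _ "- g"]) force+
  qed
  ultimately show thesis using e by (intro that[of e]) (auto intro: finite_subset)
qed

text \<open>The stabilizer of \<open>x\<close> would contain all multiples of \<open>g\<close>, yet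
  properness for the single point \<open>x\<close> makes it finite; the lattice has no
  torsion.\<close>

lemma free:
  assumes g: "g \<in> lattice" and x: "x \<in> K" and fx: "act g x = x"
  shows "g = 0"
proof (rule ccontr)
  assume "g \<noteq> 0"
  have l: "real n *\<^sub>R g \<in> lattice" for n using g by (auto simp: lattice_def)
  have "act (real n *\<^sub>R g) x = x" for n
  proof (induction n)
    case (Suc n)
    have "real (Suc n) *\<^sub>R g = real n *\<^sub>R g + g" by (simp add: algebra_simps)
    then show ?case using Suc fx by (simp add: act_act[symmetric] l g)
  qed simp
  then have sub: "range (\<lambda>n. real n *\<^sub>R g) \<subseteq> {g \<in> lattice. \<exists>q\<in>{x}. act g q \<in> {x}}" using l by auto
  have "finite {g \<in> lattice. \<exists>q\<in>{x}. act g q \<in> {x}}" by (rule proper) (use x in auto)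
  then have "finite (range (\<lambda>n. real n *\<^sub>R g))" by (rule finite_subset[OF sub])
  moreover have "inj (\<lambda>n. real n *\<^sub>R g)" by (rule injI) (use \<open>g \<noteq> 0\<close> in auto)
  then have "infinite (range (\<lambda>n. real n *\<^sub>R g))" by (rule range_inj_infinite)
  ultimately show False by simp
qed

text \<open>Orbits of compact sets are closed in \<open>K\<close>: near \<open>x\<close> only
  finitely many translates of \<open>Q\<close> appear, and their union is compact.\<close>

lemma orb_compact_avoid:
  assumes x: "x \<in> K" and Q: "compact Q" "Q \<subseteq> K" and nx: "x \<notin> orb Q"
  obtains e where "e > 0" "ball x e \<subseteq> K - orb Q"
proof -
  obtain e where e: "e > 0" "ball x e \<subseteq> K" "finite {g \<in> lattice. \<exists>y\<in>ball x e. act (- g) y \<in> Q}" (is "finite ?S")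
    by (rule local_finite[OF x Q])
  have "compact (\<Union>g\<in>?S. act g ` Q)"
    by (rule compact_UN[OF e(3)]) (rule compact_act[OF Q(1)])
  then have "open (ball x e - (\<Union>g\<in>?S. act g ` Q))" by (intro open_Diff open_ball compact_imp_closed)
  moreover have "x \<in> ball x e - (\<Union>g\<in>?S. act g ` Q)" using nx e(1) by (auto simp: orb_def)
  ultimately obtain d where d: "d > 0" "ball x d \<subseteq> ball x e - (\<Union>g\<in>?S. act g ` Q)"
    using open_contains_ball[of "ball x e - (\<Union>g\<in>?S. act g ` Q)"] by blast
  have "ball x d \<inter> orb Q = {}"
  proof (rule ccontr)
    assume "ball x d \<inter> orb Q \<noteq> {}"
    then obtain g q where gq: "g \<in> lattice" "q \<in> Q" "act g q \<in> ball x d" by (auto simp: orb_def)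
    then have "g \<in> ?S" using d(2) by (auto intro!: bexI[of _ "act g q"])
    then show False using gq d(2) by blast
  qed
  then show thesis using d e(2) by (intro that[of d]) auto
qed

lemma separate:
  assumes x: "x \<in> W" and W: "open W" "W \<subseteq> K"
  obtains r where "r > 0" "cball x r \<subseteq> W"
    "\<And>g y. g \<in> lattice \<Longrightarrow> y \<in> cball x r \<Longrightarrow> act g y \<in> cball x r \<Longrightarrow> g = 0"
proof -
  obtain e where e: "e > 0" "cball x e \<subseteq> W" using W x open_contains_cball by blast
  define S where "S = {g \<in> lattice. \<exists>q\<in>cball x e. act g q \<in> cball x e} - {0}"
  have "finite S" unfolding S_def using e W by (intro finite_Diff proper) auto
  \<comment> \<open>If \<open>y\<close> and \<open>act g y\<close> both lie within r of
    \<open>x\<close>, then \<open>g\<close> moves \<open>x\<close> by at most (1 + norm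
    (\<open>\<tau> g\<close>)) r. Half of the actual displacement is divided by that factor, so that
    r below \<open>\<rho> g\<close> is contradictory.\<close>
  define \<rho> where "\<rho> g = dist (act g x) x / (2 * (1 + norm (\<tau> g)))" for g
  have pos: "\<rho> g > 0" if "g \<in> S" for g
  proof -
    have "act g x \<noteq> x" using that free x W by (auto simp: S_def)
    moreover have "1 + norm (\<tau> g) > 0" by (simp add: add_pos_nonneg)
    ultimately show ?thesis unfolding \<rho>_def by simp
  qed
  define r where "r = Min (insert e (\<rho> ` S)) / 2"
  have r: "r > 0" "r < e" "\<And>g. g \<in> S \<Longrightarrow> r < \<rho> g"
  proof -
    have "Min (insert e (\<rho> ` S)) > 0" using \<open>finite S\<close> pos e by simp
    moreover have "Min (insert e (\<rho> ` S)) \<le> e" "\<And>g. g \<in> S \<Longrightarrow> Min (insert e (\<rho> ` S)) \<le> \<rho> g"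
      using \<open>finite S\<close> by auto
    ultimately show "r > 0" "r < e" "\<And>g. g \<in> S \<Longrightarrow> r < \<rho> g"
      unfolding r_def by (auto simp: field_simps intro: less_le_trans) (smt (verit))+
  qed
  show thesis
  proof (rule that[of r])
    show "cball x r \<subseteq> W" using e r by force
    fix g y assume g: "g \<in> lattice" and y: "y \<in> cball x r" "act g y \<in> cball x r"
    show "g = 0"
    proof (rule ccontr)
      assume "g \<noteq> 0"
      then have gS: "g \<in> S" using g y r by (auto simp: S_def intro!: bexI[of _ y])
      have "dist (act g x) (act g y) \<le> norm (\<tau> g) * dist x y"
        using norm_matrix_vector_mult_le[of "\<tau> g" "x - y"] by (simp add: dist_norm algebra_simps)
      also have "\<dots> \<le> norm (\<tau> g) * r" using y by (intro mult_left_mono) auto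
      finally have "dist (act g x) x \<le> norm (\<tau> g) * r + r"
        using y dist_triangle[of "act g x" x "act g y"] by (auto simp: dist_commute)
      also have "\<dots> = (1 + norm (\<tau> g)) * r" by (simp add: algebra_simps)
      also have "\<dots> < (1 + norm (\<tau> g)) * \<rho> g"
        using r(3)[OF gS] norm_ge_zero[of "\<tau> g"] by (intro mult_strict_left_mono) linarith+
      also have "\<dots> = dist (act g x) x / 2"
      proof -
        have *: "p * (d / (2 * p)) = d / 2" if "p > 0" for p d :: real using that by simp
        show ?thesis unfolding \<rho>_def by (rule *) (simp add: add_pos_nonneg)
      qed
      finally show False using zero_le_dist[of "act g x" x] by linarith
    qed
  qed (rule r(1))
qed

lemma equiv_range: "equiv W F \<Longrightarrow> range F = orb (F ` cbox 0 (\<chi> i. 1))"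
proof
  assume F: "equiv W F"
  show "range F \<subseteq> orb (F ` cbox 0 (\<chi> i. 1))"
  proof clarify
    fix t :: "real^'m"
    obtain h u where "h \<in> lattice" "u \<in> cbox 0 (\<chi> i. 1)" "t = u + h" by (rule lattice_floor)
    then show "F t \<in> orb (F ` cbox 0 (\<chi> i. 1))"
      using F by (auto simp: equiv_def orb_def)
  qed
  show "orb (F ` cbox 0 (\<chi> i. 1)) \<subseteq> range F"
    using F by (auto simp: equiv_def orb_def) (metis rangeI)
qed

lemma equiv_compact: "equiv W F \<Longrightarrow> compact (F ` cbox 0 (\<chi> i. 1))"
  by (intro compact_continuous_image) (auto simp: equiv_def intro: continuous_on_subset)

text \<open>The orbit map of a point \<open>k\<close>, given on lattice points, is interpolated over
  R^m with weights depending on \<open>t - g\<close>. The weights need no normalization, because the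
  cone is closed under positive combinations.\<close>

lemma equiv_exists: obtains F where "equiv K F"
proof -
  obtain k where k: "k \<in> K" using K_ne by blast
  let ?N = "real CARD('m)"
  \<comment> \<open>A point of the closed unit cube has norm at most CARD('m), so for every
    \<open>t\<close> the weight of its integer part is at least 1; the bounded support makes the sum
    locally finite.\<close>
  define \<phi> :: "real^'m \<Rightarrow> real" where "\<phi> u = max 0 (?N + 1 - norm u)" for u
  define f where "f g t = \<phi> (t - g) *\<^sub>R act g k" for g t
  define F where "F = esum lattice f"
  have lf: "loc_fin lattice f UNIV"
    unfolding loc_fin_def
  proof
    fix t :: "real^'m"
    have "{h \<in> lattice. \<exists>y\<in>ball t 1. f h y \<noteq> 0} \<subseteq> {g \<in> lattice. norm g \<le> norm t + ?N + 2}"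
    proof clarify
      fix h y assume hy: "h \<in> lattice" "y \<in> ball t 1" "f h y \<noteq> 0"
      then have "norm (y - h) < ?N + 1" by (auto simp: f_def \<phi>_def max_def split: if_splits)
      moreover have "norm (t - y) < 1" using hy by (simp add: dist_norm)
      ultimately show "norm h \<le> norm t + ?N + 2"
        using norm_triangle_ineq4[of t "(t - y) + (y - h)"] norm_triangle_ineq[of "t - y" "y - h"] by simp
    qed
    then show "\<exists>e>0. finite {h \<in> lattice. \<exists>y\<in>ball t e. f h y \<noteq> 0}"
      using finite_lattice_bounded finite_subset zero_less_one by blast
  qed
  have "continuous_on UNIV F"
    unfolding F_def by (intro continuous_on_esum[OF lf]) (auto simp: f_def \<phi>_def intro!: continuous_intros)
  moreover have "F t \<in> K" for t
  proof -
    let ?S = "{h \<in> lattice. f h t \<noteq> 0}"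
    have pos: "f h t \<in> K" if "h \<in> ?S" for h
    proof -
      have "\<phi> (t - h) > 0" using that by (auto simp: f_def \<phi>_def max_def split: if_splits)
      then show ?thesis using that k unfolding f_def by (intro K_scale \<tau>_in) auto
    qed
    obtain h u where hu: "h \<in> lattice" "u \<in> cbox 0 (\<chi> i. 1)" "t = u + h" by (rule lattice_floor)
    have "norm u \<le> (\<Sum>i\<in>UNIV. \<bar>u $ i\<bar>)" by (rule norm_le_l1_cart)
    also have "\<dots> \<le> (\<Sum>i\<in>(UNIV::'m set). 1)" using hu by (intro sum_mono) (auto simp: mem_box_cart)
    finally have "norm u \<le> ?N" by simp
    then have c: "\<phi> (t - h) > 0" using hu by (simp add: \<phi>_def)
    show ?thesis
    \<comment> \<open>The term of index \<open>h\<close> could vanish despite its positive weight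
      only if \<open>k\<close> is 0; then all terms are 0 and the sum is the point \<open>k\<close>
      of \<open>K\<close>.\<close>
    proof (cases "act h k = 0")
      case False
      then have "?S \<noteq> {}" using c hu(1) by (auto simp: f_def)
      then show ?thesis unfolding F_def esum_def
        by (intro sum_in_cone loc_fin_finite[OF lf] pos) (auto intro: K_add)
    next
      case True
      then have "k = 0" using act_minus(1)[OF hu(1), of k] by simp
      then show ?thesis using k by (simp add: F_def esum_def f_def)
    qed
  qed
  moreover have "F (t + h) = act h (F t)" if h: "h \<in> lattice" for t h
    unfolding F_def
  proof (rule esum_equivariant[where m="\<lambda>g. g + h" and T="\<lambda>t. t + h"])
    show "bij_betw (\<lambda>g. g + h) lattice lattice"
      by (rule bij_betw_byWitness[where f'="\<lambda>g. g - h"]) (use h in auto)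
    show "finite {g \<in> lattice. f g t \<noteq> 0}" by (rule loc_fin_finite[OF lf]) simp
    show "f (g + h) (t + h) = act h (f g t)" if "g \<in> lattice" for g
      using that h by (simp add: f_def act_act matrix_vector_mult_scaleR add.commute)
  qed simp
  ultimately show thesis by (intro that[of F]) (auto simp: equiv_def)
qed

text \<open>Radially pushing the ball away from a missed point \<open>x\<close>, equivariantly, frees the whole ball.\<close>

lemma push_local:
  assumes W: "open W" "W \<subseteq> K" "\<And>g y. g \<in> lattice \<Longrightarrow> y \<in> W \<Longrightarrow> act g y \<in> W"
    and r: "r > 0" "cball x0 r \<subseteq> W"
    and sep: "\<And>g y. g \<in> lattice \<Longrightarrow> y \<in> cball x0 r \<Longrightarrow> act g y \<in> cball x0 r \<Longrightarrow> g = 0"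
    and F: "equiv W F" and x: "x \<in> ball x0 r" "x \<notin> range F"
  obtains F' where "equiv W F'" "range F' \<inter> ball x0 r = {}"
proof -
  \<comment> \<open>The missed point \<open>x\<close> need not be the centre, so the retraction onto
    the sphere is one of the complement of \<open>x\<close>.\<close>
  have "frontier (cball x0 r) retract_of (- {x})"
    by (rule frontier_retract_of_punctured_universe) (use x in auto)
  then obtain ret where "retraction (- {x}) (sphere x0 r) ret"
    using r by (auto simp: retract_of_def frontier_cball)
  then have ret: "continuous_on (- {x}) ret" "\<And>z. z \<noteq> x \<Longrightarrow> ret z \<in> sphere x0 r"
    "\<And>z. z \<in> sphere x0 r \<Longrightarrow> ret z = z"
    by (auto simp: retraction_def)
  \<comment> \<open>Displacement of the push, extended by 0 outside the ball; the two formulas agree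
    on the sphere because the retraction fixes it. Displacements, unlike maps, can be added over all
    translates.\<close>
  define \<delta> where "\<delta> z = (if z \<in> cball x0 r then ret z - z else 0)" for z
  have \<delta>_out: "\<delta> z = 0" if "z \<notin> ball x0 r" for z
    using that ret(3)[of z] by (auto simp: \<delta>_def)
  have c\<delta>: "continuous_on (- {x}) \<delta>"
  proof -
    have "continuous_on ((cball x0 r - {x}) \<union> (- ball x0 r)) (\<lambda>z. if z \<in> cball x0 r then ret z - z else 0)"
    proof (rule continuous_on_cases_local)
      show "closedin (top_of_set (cball x0 r - {x} \<union> - ball x0 r)) (cball x0 r - {x})"
        using closedin_closed_Int[of "cball x0 r" "cball x0 r - {x} \<union> - ball x0 r"] x
        by (auto simp: Int_def intro: back_subst[of "closedin _"])
      show "closedin (top_of_set (cball x0 r - {x} \<union> - ball x0 r)) (- ball x0 r)"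
        by (rule closed_subset) auto
      show "continuous_on (cball x0 r - {x}) (\<lambda>z. ret z - z)"
        by (intro continuous_intros continuous_on_subset[OF ret(1)]) auto
    qed (use ret(3) in auto)
    moreover have "- {x} \<subseteq> (cball x0 r - {x}) \<union> (- ball x0 r)" by auto
    ultimately show ?thesis unfolding \<delta>_def[abs_def] using continuous_on_subset by blast
  qed
  define f where "f g y = act g (\<delta> (act (- g) y))" for g y
  define \<Phi> where "\<Phi> y = y + esum lattice f y" for y
  define X where "X = W - orb {x}"
  have lfW: "loc_fin lattice f W"
    unfolding loc_fin_def
  proof
    fix y assume "y \<in> W"
    then have yK: "y \<in> K" using W by blast
    have cK: "cball x0 r \<subseteq> K" using r W by blast
    obtain e where e: "e > 0" "ball y e \<subseteq> K" "finite {g \<in> lattice. \<exists>z\<in>ball y e. act (- g) z \<in> cball x0 r}"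
      by (rule local_finite[OF yK compact_cball cK])
    have "{h \<in> lattice. \<exists>z\<in>ball y e. f h z \<noteq> 0} \<subseteq> {g \<in> lattice. \<exists>z\<in>ball y e. act (- g) z \<in> cball x0 r}"
      unfolding f_def \<delta>_def by (auto split: if_splits)
    then show "\<exists>e>0. finite {h \<in> lattice. \<exists>z\<in>ball y e. f h z \<noteq> 0}"
      using e finite_subset by blast
  qed
  have c\<Phi>: "continuous_on X \<Phi>"
    unfolding \<Phi>_def
  proof (intro continuous_intros continuous_on_esum)
    show "loc_fin lattice f X" using lfW by (auto simp: loc_fin_def X_def)
    fix h :: "real^'m" assume h: "h \<in> lattice"
    have "act (- h) y \<noteq> x" if "y \<in> X" for y
    proof
      assume "act (- h) y = x"
      then have "y = act h x" using h by auto
      then show False using that h by (auto simp: X_def orb_def)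
    qed
    then show "continuous_on X (f h)"
      unfolding f_def
      by (intro continuous_act continuous_on_compose2[OF c\<delta>] continuous_on_id) auto
  qed
  \<comment> \<open>By \<open>sep\<close> the translates of the closed ball are disjoint, so only
    one term of the sum is active and each translate is moved by a conjugate of the
    retraction.\<close>
  have \<Phi>_in: "\<Phi> (act g z) = act g (ret z)" if g: "g \<in> lattice" and z: "z \<in> cball x0 r" for g z
  proof -
    have "esum lattice f (act g z) = (\<Sum>h\<in>{g}. f h (act g z))"
    proof (rule esum_eq_sum)
      fix h assume h: "h \<in> lattice" "f h (act g z) \<noteq> 0"
      then have "act (g - h) z \<in> cball x0 r"
        using g by (auto simp: f_def \<delta>_def act_act split: if_splits)
      then show "h \<in> {g}" using sep[of "g - h" z] g h z by auto
    qed (use g in auto)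
    then show ?thesis using g z
      by (simp add: \<Phi>_def f_def \<delta>_def act_act matrix_vector_mult_diff_distrib)
  qed
  have \<Phi>_out: "\<Phi> y = y" if "y \<notin> orb (cball x0 r)" for y
  proof -
    have "f h y = 0" if "h \<in> lattice" for h
    proof -
      have "act (- h) y \<notin> cball x0 r"
        using \<open>y \<notin> orb (cball x0 r)\<close> that orb_invariant[of "- h" y "cball x0 r"] orb_superset[of "cball x0 r"] by auto
      then show ?thesis by (simp add: f_def \<delta>_def)
    qed
    then show ?thesis by (simp add: \<Phi>_def esum_def)
  qed
  have \<Phi>_W: "\<Phi> y \<in> W" and \<Phi>_ball: "\<Phi> y \<notin> ball x0 r" if "y \<in> X" for y
  proof -
    have "\<Phi> y \<in> W \<and> \<Phi> y \<notin> ball x0 r"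
    proof (cases "y \<in> orb (cball x0 r)")
      case True
      then obtain g z where gz: "g \<in> lattice" "z \<in> cball x0 r" "y = act g z" by (auto simp: orb_def)
      then have "z \<noteq> x" using that by (auto simp: X_def orb_def)
      then have rz: "ret z \<in> sphere x0 r" by (rule ret(2))
      then have "act g (ret z) \<in> W" using r W(3)[OF gz(1), of "ret z"] by auto
      moreover have "act g (ret z) \<notin> ball x0 r"
      proof
        assume a: "act g (ret z) \<in> ball x0 r"
        have "g = 0" by (rule sep[OF gz(1), of "ret z"]) (use a rz in auto)
        then show False using a rz by simp
      qed
      ultimately show ?thesis using \<Phi>_in gz by simp
    next
      case False
      then have "y \<notin> ball x0 r" using orb_superset[of "cball x0 r"] ball_subset_cball by blast
      then show ?thesis using \<Phi>_out[OF False] that by (simp add: X_def)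
    qed
    then show "\<Phi> y \<in> W" "\<Phi> y \<notin> ball x0 r" by auto
  qed
  have FX: "F t \<in> X" for t
  proof -
    have "F t \<notin> orb {x}"
    proof
      assume "F t \<in> orb {x}"
      then obtain g where g: "g \<in> lattice" "F t = act g x" by (auto simp: orb_def)
      then have "F (t + (- g)) = x" using F g(1) by (simp add: equiv_def del: add_uminus_conv_diff)
      then show False using x by blast
    qed
    then show ?thesis using F by (auto simp: X_def equiv_def)
  qed
  have "equiv W (\<Phi> \<circ> F)"
    unfolding equiv_def
  proof (intro conjI allI ballI)
    show "continuous_on UNIV (\<Phi> \<circ> F)"
      by (rule continuous_on_compose) (use F FX c\<Phi> in \<open>auto simp: equiv_def intro: continuous_on_subset\<close>)
    show "range (\<Phi> \<circ> F) \<subseteq> W" using FX \<Phi>_W by auto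
    fix t h :: "real^'m" assume h: "h \<in> lattice"
    have "esum lattice f (act h (F t)) = act h (esum lattice f (F t))"
    proof (rule esum_equivariant[where m="\<lambda>g. g + h" and T="act h"])
      show "bij_betw (\<lambda>g. g + h) lattice lattice"
        by (rule bij_betw_byWitness[where f'="\<lambda>g. g - h"]) (use h in auto)
      show "finite {g \<in> lattice. f g (F t) \<noteq> 0}"
        by (rule loc_fin_finite[OF lfW]) (use FX[of t] in \<open>simp add: X_def\<close>)
      show "f (g + h) (act h (F t)) = act h (f g (F t))" if g: "g \<in> lattice" for g
        using that h by (simp add: f_def act_act add.commute)
    qed simp
    then show "(\<Phi> \<circ> F) (t + h) = act h ((\<Phi> \<circ> F) t)"
      using F h by (simp add: \<Phi>_def equiv_def matrix_vector_right_distrib)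
  qed
  moreover have "range (\<Phi> \<circ> F) \<inter> ball x0 r = {}" using FX \<Phi>_ball by auto
  ultimately show thesis by (rule that)
qed

lemma open_diff_orb:
  assumes "open W" "W \<subseteq> K" "compact Q" "Q \<subseteq> K"
  shows "open (W - orb Q)"
  unfolding open_contains_ball
proof
  fix y assume y: "y \<in> W - orb Q"
  then obtain e where e: "e > 0" "ball y e \<subseteq> K - orb Q" using assms orb_compact_avoid[of y Q] by blast
  obtain d where "d > 0" "ball y d \<subseteq> W" using y assms(1) open_contains_ball by blast
  then show "\<exists>e>0. ball y e \<subseteq> W - orb Q" using e by (intro exI[of _ "min d e"]) auto
qed

text \<open>Induction on the points. With the earlier orbits removed, the set \<open>D\<close> of
  points that some equivariant map misses is open and closed in \<open>W'\<close> by
  \<open>push_local\<close>, and \<open>W'\<close> is connected because a countable set does not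
  separate a connected open set in dimension at least 2. \<open>D\<close> is nonempty: a map onto
  \<open>W'\<close> would make \<open>W'\<close> the orbit of a compact set, hence closed in
  \<open>K\<close>, hence all of \<open>K\<close>, against \<open>noncocompact\<close>.\<close>

lemma push_off:
  assumes noncocompact: "\<And>Q. compact Q \<Longrightarrow> Q \<subseteq> K \<Longrightarrow> orb Q \<noteq> K"
    and dim2: "2 \<le> CARD('m)"
    and W: "open W" "connected W" "W \<subseteq> K" "\<And>g y. g \<in> lattice \<Longrightarrow> y \<in> W \<Longrightarrow> act g y \<in> W"
    and F0: "equiv W F0"
    and P: "finite P" "P \<subseteq> K"
  shows "\<exists>F. equiv (W - orb P) F"
  using P
proof (induction P rule: finite_induct)
  case empty
  then show ?case using F0 by (auto simp: orb_def)
next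
  case (insert p P)
  define W' where "W' = W - orb P"
  obtain F where F: "equiv W' F" using insert by (auto simp: W'_def)
  have oW': "open W'" unfolding W'_def using insert W by (intro open_diff_orb finite_imp_compact) auto
  have "countable (orb P)"
    unfolding orb_def by (rule countable_UN[OF countable_lattice countable_image[OF countable_finite[OF insert(1)]]])
  then have cW': "connected W'"
    unfolding W'_def using W dim2 by (intro connected_open_diff_countable) auto
  have W'K: "W' \<subseteq> K" using W by (auto simp: W'_def)
  have inv: "act g y \<in> W'" if "g \<in> lattice" "y \<in> W'" for g y
    using that W orb_invariant by (auto simp: W'_def)
  have goal: "\<exists>F. equiv (W - orb (insert p P)) F" if F: "equiv W' F" and "p \<notin> range F" for F
  proof -
    have "F t \<notin> orb {p}" for t
    proof
      assume "F t \<in> orb {p}"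
      then obtain g where g: "g \<in> lattice" "F t = act g p" by (auto simp: orb_def)
      then have "F (t + (- g)) = p" using F g(1) by (simp add: equiv_def del: add_uminus_conv_diff)
      then show False using \<open>p \<notin> range F\<close> by blast
    qed
    moreover have "orb (insert p P) = orb {p} \<union> orb P" using orb_Un[of "{p}" P] by simp
    ultimately show ?thesis using F by (intro exI[of _ F]) (auto simp: equiv_def W'_def)
  qed
  show ?case
  proof (cases "p \<in> W'")
    case False
    then show ?thesis using goal[OF F] F by (auto simp: equiv_def)
  next
    case True
    define D where "D = {x \<in> W'. \<exists>F. equiv W' F \<and> x \<notin> range F}"
    have loc: "\<exists>r>0. ball x0 r \<subseteq> W' \<and> (\<forall>x\<in>ball x0 r. x \<in> D \<longrightarrow> ball x0 r \<subseteq> D)" if x0: "x0 \<in> W'" for x0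
    proof -
      obtain r where r: "r > 0" "cball x0 r \<subseteq> W'"
        "\<And>g y. g \<in> lattice \<Longrightarrow> y \<in> cball x0 r \<Longrightarrow> act g y \<in> cball x0 r \<Longrightarrow> g = 0"
        using separate[OF x0 oW' W'K] by metis
      have "ball x0 r \<subseteq> D" if x: "x \<in> ball x0 r" "x \<in> D" for x
      proof -
        obtain F1 where F1: "equiv W' F1" "x \<notin> range F1" using x by (auto simp: D_def)
        obtain F2 where "equiv W' F2" "range F2 \<inter> ball x0 r = {}"
          by (rule push_local[OF oW' W'K _ r(1,2) _ F1(1) x(1) F1(2)]) (use inv r(3) in blast)+
        then show ?thesis using r(2) by (auto simp: D_def)
      qed
      then show ?thesis using r by (intro exI[of _ r]) auto
    qed
    have oD: "open D" unfolding open_contains_ball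
    proof
      fix x assume x: "x \<in> D"
      then have "x \<in> W'" by (simp add: D_def)
      then obtain r where "r > 0" "\<forall>y\<in>ball x r. y \<in> D \<longrightarrow> ball x r \<subseteq> D" using loc by blast
      then show "\<exists>e>0. ball x e \<subseteq> D" using x by (intro exI[of _ r]) auto
    qed
    have oD': "open (W' - D)" unfolding open_contains_ball
    proof
      fix x assume x: "x \<in> W' - D"
      then obtain r where r: "r > 0" "ball x r \<subseteq> W'" "\<forall>y\<in>ball x r. y \<in> D \<longrightarrow> ball x r \<subseteq> D" using loc by blast
      have "x \<in> ball x r" using r(1) by simp
      then have "ball x r \<subseteq> W' - D" using x r(2,3) by blast
      then show "\<exists>e>0. ball x e \<subseteq> W' - D" using r(1) by blast
    qed
    have "D \<noteq> {}"
    proof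
      assume "D = {}"
      then have "W' \<subseteq> range F" using F by (auto simp only: D_def)
      moreover have "range F \<subseteq> W'" using F by (simp add: equiv_def)
      ultimately have "range F = W'" by (rule subset_antisym[rotated])
      define Q where "Q = F ` cbox 0 (\<chi> i. 1)"
      have Q: "compact Q" "Q \<subseteq> K" "orb Q = W'"
        using equiv_compact[OF F] equiv_range[OF F] F W'K \<open>range F = W'\<close> by (auto simp: Q_def equiv_def)
      have "open (K - W')" using open_diff_orb[OF openK _ Q(1,2)] Q(3) by simp
      then have "W' = {} \<or> K - W' = {}"
        using oW' convex_connected[OF convexK] W'K connectedD[of K W' "K - W'"] by blast
      then show False using noncocompact[OF Q(1,2)] Q(3) W'K True by auto
    qed
    then have "W' - D = {}"
      using connectedD[OF cW' oD oD'] by (auto simp: D_def)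
    then have "p \<in> D" using True by blast
    then show ?thesis using goal by (auto simp: D_def)
  qed
qed

text \<open>The map \<open>\<theta>\<close> back to R^m is used only on the orbit of one compact set
  \<open>Q\<close> around the image of \<open>F0\<close>. There its denominator is positive, and a
  fibre meets only finitely many translates of \<open>Q\<close>, so a regular fibre is finite even
  though the quotient of \<open>K\<close> is assumed noncompact.\<close>

theorem cocompact:
  assumes dim2: "2 \<le> CARD('m)"
  obtains Q where "compact Q" "Q \<subseteq> K" "K = orb Q"
proof (rule ccontr)
  assume "\<not> thesis"
  then have nc: "\<And>Q. compact Q \<Longrightarrow> Q \<subseteq> K \<Longrightarrow> orb Q \<noteq> K" using that by blast
  obtain F0 where F0: "equiv K F0" by (rule equiv_exists)
  define Q0 where "Q0 = F0 ` cbox 0 (\<chi> i. 1)"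
  have Q0: "compact Q0" "Q0 \<subseteq> K" using equiv_compact[OF F0] F0 by (auto simp: Q0_def equiv_def)
  have "\<forall>x\<in>Q0. \<exists>e>0. cball x e \<subseteq> K" using Q0 openK open_contains_cball by blast
  then obtain e where e: "\<And>x. x \<in> Q0 \<Longrightarrow> e x > 0 \<and> cball x (e x) \<subseteq> K" by metis
  obtain C where C: "C \<subseteq> Q0" "finite C" "Q0 \<subseteq> (\<Union>c\<in>C. ball c (e c))"
    by (rule compactE_image[OF Q0(1), of Q0 "\<lambda>c. ball c (e c)"]) (use e in force)+
  \<comment> \<open>The convex hull makes the interior \<open>U\<close> convex and its translates
    connected. Each translate meets the connected range of \<open>F0\<close>, so their union
    \<open>W\<close> is connected, as \<open>push_off\<close> requires.\<close>
  define Q where "Q = convex hull (\<Union>c\<in>C. cball c (e c))"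
  have "(\<Union>c\<in>C. cball c (e c)) \<subseteq> K" using C(1) e by blast
  then have Q: "compact Q" "Q \<subseteq> K" "convex Q"
    unfolding Q_def using C(2) convexK by (auto intro!: compact_convex_hull simp: subset_hull)
  define U where "U = interior Q"
  have "(\<Union>c\<in>C. ball c (e c)) \<subseteq> U"
    unfolding U_def
  proof (rule interior_maximal)
    have "(\<Union>c\<in>C. ball c (e c)) \<subseteq> (\<Union>c\<in>C. cball c (e c))" by force
    then show "(\<Union>c\<in>C. ball c (e c)) \<subseteq> Q" unfolding Q_def using hull_subset by (rule order_trans)
  qed auto
  then have U: "Q0 \<subseteq> U" "open U" "convex U" "U \<subseteq> Q"
    using C Q by (auto simp: U_def interior_subset)
  define W where "W = orb U"
  have WK: "W \<subseteq> K" unfolding W_def using U Q by (intro orb_subset_K) auto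
  have Winv: "\<And>g y. g \<in> lattice \<Longrightarrow> y \<in> W \<Longrightarrow> act g y \<in> W" by (simp add: W_def orb_invariant)
  have open_act: "open (act g ` A)" if "open A" "g \<in> lattice" for g A
  proof -
    have "act g ` A = act (- g) -` A"
    proof (intro Set.set_eqI iffI)
      fix y assume "y \<in> act (- g) -` A"
      then show "y \<in> act g ` A" using that(2) by (intro image_eqI[of _ _ "act (- g) y"]) auto
    qed (use that(2) in auto)
    then show ?thesis using open_vimage[OF that(1) continuous_act[OF continuous_on_id]] by simp
  qed
  have oW: "open W" unfolding W_def orb_def using U open_act by (intro open_UN) auto
  have FW: "equiv W F0"
  proof -
    have "range F0 \<subseteq> W" using equiv_range[OF F0] U(1) unfolding W_def Q0_def orb_def by blast
    then show ?thesis using F0 by (simp add: equiv_def)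
  qed
  have cW: "connected W"
  proof -
    have "W = (\<Union>g\<in>lattice. act g ` U \<union> range F0)"
      using FW lattice_closed(1) by (auto simp: W_def orb_def equiv_def)
    moreover have "connected (\<Union>g\<in>lattice. act g ` U \<union> range F0)"
    proof (rule connected_Union, clarify)
      fix g :: "real^'m" assume g: "g \<in> lattice"
      have "connected (act g ` U)" 
        by (rule connected_continuous_image[OF continuous_act[OF continuous_on_id] convex_connected[OF U(3)]])
      moreover have "connected (range F0)"
        by (rule connected_continuous_image) (use F0 in \<open>auto simp: equiv_def\<close>)
      moreover have "F0 (0 + g) \<in> act g ` U"
      proof -
        have "F0 0 \<in> U" using U(1) by (auto simp: Q0_def mem_box_cart)
        moreover have "F0 (0 + g) = act g (F0 0)" using F0 g unfolding equiv_def by blast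
        ultimately show ?thesis by simp
      qed
      ultimately show "connected (act g ` U \<union> range F0)" by (intro connected_Un) auto
    next
      show "\<Inter> ((\<lambda>g. act g ` U \<union> range F0) ` lattice) \<noteq> {}" by (auto intro!: exI[of _ "F0 0"])
    qed
    ultimately show ?thesis by simp
  qed
  obtain \<beta> :: "real^'m \<Rightarrow> real" and Q' where \<beta>: "\<And>x. \<beta> differentiable (at x)" "\<And>x. 0 \<le> \<beta> x"
    "\<And>x. x \<in> Q \<Longrightarrow> 0 < \<beta> x" "compact Q'" "Q' \<subseteq> K" "\<And>x. \<beta> x \<noteq> 0 \<Longrightarrow> x \<in> Q'"
    using bump_exists[OF Q(1) openK Q(2)] by metis
  define f where "f g y = \<beta> (act (- g) y)" for g y
  define num where "num = esum lattice (\<lambda>g y. f g y *\<^sub>R g)"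
  define den where "den = esum lattice f"
  \<comment> \<open>Weighted barycentre of the lattice elements \<open>g\<close> for which
    \<open>act (- g) y\<close> lies in the support of the bump: moving \<open>y\<close> by
    \<open>h\<close> shifts every such \<open>g\<close> by \<open>h\<close>, and the barycentre with
    it.\<close>
  define \<theta> where "\<theta> y = num y /\<^sub>R den y" for y
  have lf: "loc_fin lattice f K" "loc_fin lattice (\<lambda>g y. f g y *\<^sub>R g) K"
    unfolding loc_fin_def
  proof -
    have "\<exists>e>0. finite {h \<in> lattice. \<exists>z\<in>ball y e. f h z \<noteq> 0}" if yK: "y \<in> K" for y
    proof -
      obtain e where e: "e > 0" "ball y e \<subseteq> K" "finite {g \<in> lattice. \<exists>z\<in>ball y e. act (- g) z \<in> Q'}"
        by (rule local_finite[OF yK \<beta>(4,5)])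
      have "{h \<in> lattice. \<exists>z\<in>ball y e. f h z \<noteq> 0} \<subseteq> {g \<in> lattice. \<exists>z\<in>ball y e. act (- g) z \<in> Q'}"
        using \<beta>(6) unfolding f_def by blast
      then show ?thesis using e finite_subset by blast
    qed
    note * = this
    show "\<forall>x\<in>K. \<exists>e>0. finite {h \<in> lattice. \<exists>y\<in>ball x e. f h y \<noteq> 0}" using * by blast
    show "\<forall>x\<in>K. \<exists>e>0. finite {h \<in> lattice. \<exists>y\<in>ball x e. f h y *\<^sub>R h \<noteq> 0}"
    proof
      fix x assume "x \<in> K"
      then obtain e where e: "e > 0" "finite {h \<in> lattice. \<exists>y\<in>ball x e. f h y \<noteq> 0}" using * by blast
      have "{h \<in> lattice. \<exists>y\<in>ball x e. f h y *\<^sub>R h \<noteq> 0} \<subseteq> {h \<in> lattice. \<exists>y\<in>ball x e. f h y \<noteq> 0}" by auto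
      then show "\<exists>e>0. finite {h \<in> lattice. \<exists>y\<in>ball x e. f h y *\<^sub>R h \<noteq> 0}" using e finite_subset by blast
    qed
  qed
  have df: "f g differentiable (at y)" for g y
    unfolding f_def using differentiable_chain_at[OF differentiable_act \<beta>(1), of "- g" y] by (simp add: o_def)
  have dnum: "num differentiable (at y)" and dden: "den differentiable (at y)" if "y \<in> K" for y
    unfolding num_def den_def using that df
    by (intro differentiable_esum[OF lf(2)] differentiable_esum[OF lf(1)] derivative_intros; simp)+
  have bij: "bij_betw (\<lambda>g. g + h) lattice lattice" if "h \<in> lattice" for h :: "real^'m"
    by (rule bij_betw_byWitness[where f'="\<lambda>g. g - h"]) (use that in auto)
  have feq: "f (g + h) (act h y) = f g y" if "g \<in> lattice" "h \<in> lattice" for g h y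
    using that by (simp add: f_def act_act)
  have den_eq: "den (act h y) = den y" if "h \<in> lattice" "y \<in> K" for h y
    unfolding den_def
    by (intro esum_equivariant[where m="\<lambda>g. g + h" and T="act h" and L="\<lambda>x. x"] bij loc_fin_finite[OF lf(1)])
      (use that feq in \<open>auto intro: linearI\<close>)
  have num_eq: "num (act h y) = num y + den y *\<^sub>R h" if h: "h \<in> lattice" and y: "y \<in> K" for h y
  proof -
    \<comment> \<open>The translation law of \<open>num\<close> involves \<open>den\<close> and is
      affine; on the pair it is the linear shear \<open>L\<close>.\<close>
    define f2 where "f2 g y = (f g y *\<^sub>R g, f g y)" for g y
    have lf2: "loc_fin lattice f2 K"
      using lf(1) by (auto simp: loc_fin_def f2_def prod_eq_iff cong: rev_conj_cong)
    have e2: "esum lattice f2 z = (num z, den z)" if "z \<in> K" for z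
    proof -
      let ?S = "{h \<in> lattice. f h z \<noteq> 0}"
      have S: "finite ?S" by (rule loc_fin_finite[OF lf(1) that])
      have "num z = (\<Sum>h\<in>?S. f h z *\<^sub>R h)" unfolding num_def by (rule esum_eq_sum[OF S]) auto
      moreover have "den z = (\<Sum>h\<in>?S. f h z)" unfolding den_def by (rule esum_eq_sum[OF S]) auto
      moreover have "esum lattice f2 z = (\<Sum>h\<in>?S. f2 h z)"
        by (rule esum_eq_sum[OF S]) (auto simp: f2_def zero_prod_def)
      ultimately show ?thesis by (simp add: f2_def prod_eq_iff fst_sum snd_sum)
    qed
    define L where "L p = (fst p + snd p *\<^sub>R h, snd p)" for p :: "(real^'m) \<times> real"
    have "linear L" unfolding L_def by (rule linearI) (auto simp: algebra_simps)
    then have "esum lattice f2 (act h y) = L (esum lattice f2 y)"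
      by (intro esum_equivariant[where m="\<lambda>g. g + h" and T="act h" and L=L] bij[OF h] loc_fin_finite[OF lf2 y])
        (use h feq in \<open>auto simp: f2_def L_def algebra_simps\<close>)
    then show ?thesis using e2[OF y] e2[OF \<tau>_in[OF h y]] by (simp add: L_def)
  qed
  have den_pos: "den y > 0" if yQ: "y \<in> orb Q" for y
  proof -
    obtain g q where gq: "g \<in> lattice" "q \<in> Q" "y = act g q" using yQ by (auto simp: orb_def)
    have y: "y \<in> K" using gq Q \<tau>_in by blast
    have "f g y > 0" using gq \<beta>(3) by (simp add: f_def act_act)
    moreover have "\<And>g. f g y \<ge> 0" using \<beta>(2) by (simp add: f_def)
    ultimately show ?thesis
      unfolding den_def esum_def using gq(1) loc_fin_finite[OF lf(1) y]
      by (intro sum_pos2[of _ g]) auto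
  qed
  have \<theta>_eq: "\<theta> (act h y) = \<theta> y + h" if "h \<in> lattice" "y \<in> orb Q" for h y
    using that den_pos[OF that(2)] num_eq[OF that(1), of y] den_eq[OF that(1), of y] orb_subset_K[OF Q(2)]
    by (auto simp: \<theta>_def scaleR_add_right)
  have d\<theta>: "\<theta> differentiable (at y)" if "y \<in> orb Q" for y
  proof -
    have y: "y \<in> K" using that orb_subset_K[OF Q(2)] by blast
    show ?thesis unfolding \<theta>_def
      using dnum[OF y] dden[OF y] den_pos[OF that] by (intro differentiable_scaleR differentiable_inverse) auto
  qed
  define \<theta>' where "\<theta>' y = frechet_derivative \<theta> (at y)" for y
  have \<theta>': "(\<theta> has_derivative \<theta>' y) (at y)" if "y \<in> orb Q" for y
    unfolding \<theta>'_def using d\<theta>[OF that] by (simp only: frechet_derivative_works)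
  have "negligible (\<theta> ` {y \<in> orb Q. \<not> inj (\<theta>' y)})"
    by (rule Sard_negligible[where f'=\<theta>']) (use \<theta>' in auto)
  then have "\<theta> ` {y \<in> orb Q. \<not> inj (\<theta>' y)} \<noteq> UNIV" using non_negligible_UNIV by auto
  then obtain s where s: "s \<notin> \<theta> ` {y \<in> orb Q. \<not> inj (\<theta>' y)}" by blast
  have c\<theta>: "continuous_on (orb Q) \<theta>"
    by (intro continuous_at_imp_continuous_on ballI differentiable_imp_continuous_within d\<theta>)
  define T where "T = {y \<in> orb Q. \<theta> y = s}"
  obtain R where R: "\<And>q. q \<in> Q \<Longrightarrow> norm (\<theta> q) \<le> R"
  proof -
    have "compact (\<theta> ` Q)" by (intro compact_continuous_image continuous_on_subset[OF c\<theta>] orb_superset Q)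
    then show thesis using that compact_imp_bounded bounded_iff by (metis (no_types, lifting) imageI)
  qed
  define S :: "(real^'m) set" where "S = {g \<in> lattice. norm g \<le> norm s + R}"
  define Q3 where "Q3 = (\<Union>g\<in>S. act g ` Q)"
  have Q3: "compact Q3" unfolding Q3_def S_def by (rule compact_UN[OF finite_lattice_bounded]) (rule compact_act[OF Q(1)])
  have Q3o: "Q3 \<subseteq> orb Q" by (auto simp: Q3_def S_def orb_def)
  \<comment> \<open>At \<open>act g q\<close> the value is \<open>\<theta> q + g\<close> with
    \<open>\<theta> q\<close> bounded, so \<open>g\<close> is bounded for points of the
    fibre.\<close>
  have TQ3: "T \<subseteq> Q3"
  proof
    fix y assume y: "y \<in> T"
    then obtain g q where gq: "g \<in> lattice" "q \<in> Q" "y = act g q" by (auto simp: T_def orb_def)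
    then have "\<theta> y = \<theta> q + g" using \<theta>_eq orb_superset by blast
    then have "g = s - \<theta> q" using y by (auto simp: T_def eq_diff_eq add.commute)
    then have "norm g \<le> norm s + norm (\<theta> q)" using norm_triangle_ineq4[of s "\<theta> q"] by simp
    then have "norm g \<le> norm s + R" using R[OF gq(2)] by linarith
    then show "y \<in> Q3" using gq by (auto simp: Q3_def S_def)
  qed
  have "finite T"
  proof (rule ccontr)
    assume "infinite T"
    have "compact {y \<in> Q3. \<theta> y = s}"
    proof -
      have "closedin (top_of_set Q3) {y \<in> Q3. \<theta> y = s}"
        by (intro continuous_closedin_preimage_constant continuous_on_subset[OF c\<theta> Q3o])
      then show ?thesis using Q3 closedin_compact by blast
    qed
    moreover have "{y \<in> Q3. \<theta> y = s} = T" using TQ3 Q3o by (auto simp: T_def)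
    ultimately have "compact T" by simp
    then obtain y where y: "y \<in> T" "y islimpt T"
      using \<open>infinite T\<close> compact_eq_Bolzano_Weierstrass by blast
    have yo: "y \<in> orb Q" "\<theta> y = s" using y by (auto simp: T_def)
    then have inj: "inj (\<theta>' y)" using s by blast
    have lin: "linear (\<theta>' y)" using \<theta>'[OF yo(1)] has_derivative_linear by blast
    \<comment> \<open>An injective derivative is bounded below by \<open>B\<close>, so close to
      \<open>y\<close> no other point has the value \<open>\<theta> y\<close>; the fibre cannot
      accumulate at \<open>y\<close>.\<close>
    obtain B where B: "B > 0" "\<And>x. B * norm x \<le> norm (\<theta>' y x)"
      using linear_inj_bounded_below_pos[OF lin inj] by blast
    obtain d where d: "d > 0" "\<And>z. norm (z - y) < d \<Longrightarrow> norm (\<theta> z - \<theta> y - \<theta>' y (z - y)) \<le> B / 2 * norm (z - y)"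
      using \<theta>'[OF yo(1)] B(1) unfolding has_derivative_at_alt by (metis half_gt_zero)
    obtain z where z: "z \<in> T" "z \<noteq> y" "dist z y < d" using y(2) d(1) by (auto simp: islimpt_approachable)
    have "norm (\<theta>' y (z - y)) \<le> B / 2 * norm (z - y)"
      using d(2)[of z] z yo by (auto simp: dist_norm T_def)
    then have "B * norm (z - y) \<le> B / 2 * norm (z - y)" using B(2)[of "z - y"] by linarith
    moreover have "B * norm (z - y) > 0" using B(1) z(2) by simp
    ultimately show False by simp
  qed
  moreover have "T \<subseteq> K" using orb_subset_K[OF Q(2)] by (auto simp: T_def)
  ultimately obtain F where F: "equiv (W - orb T) F"
    using push_off[OF nc dim2 oW cW WK Winv FW] by blast
  have Wo: "W \<subseteq> orb Q" using U by (auto simp: W_def orb_def)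
  have "\<exists>t. (\<theta> \<circ> F) t = s"
  proof (rule surj_if_lattice_equivariant)
    show "continuous_on UNIV (\<theta> \<circ> F)"
      using F Wo by (intro continuous_on_compose continuous_on_subset[OF c\<theta>]) (auto simp: equiv_def)
    show "(\<theta> \<circ> F) (t + h) = (\<theta> \<circ> F) t + h" if "h \<in> lattice" for t h
      using F that Wo \<theta>_eq[OF that, of "F t"] by (auto simp: equiv_def)
  qed
  then obtain t where "\<theta> (F t) = s" by auto
  moreover have "F t \<in> W - orb T" using F by (auto simp: equiv_def)
  ultimately show False using Wo orb_superset[of T] by (auto simp: T_def)
qed

end

section \<open>Normal cones\<close>

text \<open>Normality (the last conjunct) is sharpness of the closure in a form that needs no compactness.\<close>

definition ncone :: "'a::real_normed_vector set \<Rightarrow> bool" where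
  "ncone K \<longleftrightarrow> (\<forall>u\<in>K. \<forall>w\<in>K. u + w \<in> K) \<and> (\<forall>a>0. \<forall>u\<in>K. a *\<^sub>R u \<in> K) \<and> 0 \<notin> K \<and>
     (\<exists>c. \<forall>u\<in>K. \<forall>w\<in>K. norm u \<le> c * norm (u + w))"

lemma ncone_add: "ncone K \<Longrightarrow> u \<in> K \<Longrightarrow> w \<in> K \<Longrightarrow> u + w \<in> K"
  and ncone_scale: "ncone K \<Longrightarrow> a > 0 \<Longrightarrow> u \<in> K \<Longrightarrow> a *\<^sub>R u \<in> K"
  and ncone_nz: "ncone K \<Longrightarrow> u \<in> K \<Longrightarrow> u \<noteq> 0"
  by (auto simp: ncone_def)

lemma ncone_normal:
  assumes "ncone K" obtains c where "c > 0" "\<And>u w. u \<in> K \<Longrightarrow> w \<in> K \<Longrightarrow> norm u \<le> c * norm (u + w)"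
proof -
  from assms obtain c where c: "\<And>u w. u \<in> K \<Longrightarrow> w \<in> K \<Longrightarrow> norm u \<le> c * norm (u + w)"
    unfolding ncone_def by blast
  have "norm u \<le> (max c 1) * norm (u + w)" if "u \<in> K" "w \<in> K" for u w
    using c[OF that] mult_right_mono[of c "max c 1" "norm (u + w)"] by simp
  then show thesis by (intro that[of "max c 1"]) auto
qed

lemma convex_if_cone:
  assumes "\<And>u w. u \<in> K \<Longrightarrow> w \<in> K \<Longrightarrow> u + w \<in> K" "\<And>a u. a > 0 \<Longrightarrow> u \<in> K \<Longrightarrow> a *\<^sub>R u \<in> K"
  shows "convex K"
proof (rule convexI)
  fix x y u v assume "x \<in> K" "y \<in> K" "0 \<le> u" "0 \<le> v" "u + v = (1::real)"
  then show "u *\<^sub>R x + v *\<^sub>R y \<in> K"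
    using assms by (cases "u = 0"; cases "v = 0") auto
qed

lemma ncone_convex: "ncone K \<Longrightarrow> convex K"
  by (rule convex_if_cone) (auto simp: ncone_def)

lemma closure_cone:
  assumes K: "ncone K"
  shows "K \<noteq> {} \<Longrightarrow> 0 \<in> closure K"
    and "u \<in> closure K \<Longrightarrow> w \<in> closure K \<Longrightarrow> u + w \<in> closure K"
    and "a \<ge> 0 \<Longrightarrow> u \<in> closure K \<Longrightarrow> a *\<^sub>R u \<in> closure K"
proof -
  show zero: "0 \<in> closure K" if ne: "K \<noteq> {}"
  proof -
    obtain k where "k \<in> K" using ne by blast
    then have "\<forall>n. (1 / real (Suc n)) *\<^sub>R k \<in> K" using K by (auto intro: ncone_scale)
    moreover have "(\<lambda>n. (1 / real (Suc n)) *\<^sub>R k) \<longlonglongrightarrow> 0 *\<^sub>R k"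
      by (intro tendsto_intros LIMSEQ_Suc lim_1_over_n)
    ultimately show ?thesis unfolding closure_sequential by auto
  qed
  show "u + w \<in> closure K" if uw: "u \<in> closure K" "w \<in> closure K"
  proof -
    obtain f g where "\<forall>n::nat. f n \<in> K" "f \<longlonglongrightarrow> u" "\<forall>n::nat. g n \<in> K" "g \<longlonglongrightarrow> w"
      using uw unfolding closure_sequential by blast
    then show ?thesis unfolding closure_sequential
      using K by (intro exI[of _ "\<lambda>n. f n + g n"]) (auto intro: ncone_add tendsto_add)
  qed
  show "a *\<^sub>R u \<in> closure K" if au: "a \<ge> 0" "u \<in> closure K"
  proof (cases "a = 0")
    case True
    then show ?thesis using zero au by (cases "K = {}") auto
  next
    case False
    obtain f where "\<forall>n::nat. f n \<in> K" "f \<longlonglongrightarrow> u"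
      using au unfolding closure_sequential by blast
    then show ?thesis unfolding closure_sequential
      using K False au
      by (intro exI[of _ "\<lambda>n. a *\<^sub>R f n"]) (auto intro: ncone_scale tendsto_scaleR)
  qed
qed

lemma closure_normal:
  assumes K: "ncone K"
  obtains c where "c > 0" "\<And>u w. u \<in> closure K \<Longrightarrow> w \<in> closure K \<Longrightarrow> norm u \<le> c * norm (u + w)"
proof -
  obtain c where c: "c > 0" "\<And>u w. u \<in> K \<Longrightarrow> w \<in> K \<Longrightarrow> norm u \<le> c * norm (u + w)"
    using ncone_normal[OF K] by metis
  have "norm u \<le> c * norm (u + w)" if uw: "u \<in> closure K" "w \<in> closure K" for u w
  proof -
    obtain f g where fg: "\<forall>n::nat. f n \<in> K" "f \<longlonglongrightarrow> u" "\<forall>n::nat. g n \<in> K" "g \<longlonglongrightarrow> w"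
      using uw unfolding closure_sequential by blast
    show ?thesis
    proof (rule LIMSEQ_le)
      show "(\<lambda>n. norm (f n)) \<longlonglongrightarrow> norm u" using fg by (intro tendsto_intros)
      show "(\<lambda>n. c * norm (f n + g n)) \<longlonglongrightarrow> c * norm (u + w)" using fg by (intro tendsto_intros)
    qed (use fg c in auto)
  qed
  then show thesis using c(1) that by blast
qed

lemma add_closure_in_cone:
  fixes K :: "'a::real_normed_vector set"
  assumes K: "ncone K" "open K" and u: "u \<in> K" and w: "w \<in> closure K"
  shows "u + w \<in> K"
proof -
  obtain e where e: "e > 0" "ball u e \<subseteq> K" using K u open_contains_ball by blast
  obtain w' where w': "w' \<in> K" "dist w' w < e" using w e closure_approachable by blast
  then have "u + (w - w') \<in> ball u e" by (simp add: dist_norm norm_minus_commute)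
  then have "u + (w - w') + w' \<in> K" using K(1) w' e by (blast intro: ncone_add)
  then show ?thesis by simp
qed

text \<open>Brouwer's theorem on an order interval.\<close>

lemma cone_map_surj:
  fixes f :: "'a::euclidean_space \<Rightarrow> 'a"
  assumes C: "ncone C" "open C" and cont: "continuous_on C f" and ab: "\<alpha> > 0" "\<beta> > 0"
    and lo: "\<And>y. y \<in> C \<Longrightarrow> f y - \<alpha> *\<^sub>R y \<in> C" and hi: "\<And>y. y \<in> C \<Longrightarrow> \<beta> *\<^sub>R y - f y \<in> C"
    and s: "s \<in> C"
  shows "\<exists>y\<in>C. f y = s"
proof -
  \<comment> \<open>Brouwer is applied to y + \<eta> (s - f y) on the order interval from \<epsilon>
    s to M s. The bounds \<alpha> y and \<beta> y on f y in the cone order make the interval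
    invariant once \<beta> \<epsilon> is at most 1, \<alpha> M at least 1, and \<eta> \<alpha> and
    \<eta> \<beta> at most 1.\<close>
  define \<epsilon> M \<eta> where "\<epsilon> = min 1 (1 / \<beta>)" and "M = max 1 (1 / \<alpha>)" and "\<eta> = 1 / (\<alpha> + \<beta>)"
  have pos: "\<epsilon> > 0" "\<epsilon> \<le> 1" "M \<ge> 1" "\<eta> > 0" "\<beta> * \<epsilon> \<le> 1" "\<alpha> * M \<ge> 1" "\<eta> * \<alpha> \<le> 1" "\<eta> * \<beta> \<le> 1"
    using ab by (auto simp: \<epsilon>_def M_def \<eta>_def min_def max_def field_simps)
  note cl = closure_cone[OF C(1)]
  have C_cl: "C \<subseteq> closure C" by (rule closure_subset)
  define D where "D = {y. y - \<epsilon> *\<^sub>R s \<in> closure C} \<inter> {y. M *\<^sub>R s - y \<in> closure C}"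
  have DC: "D \<subseteq> C"
  proof
    fix y assume "y \<in> D"
    then have "\<epsilon> *\<^sub>R s + (y - \<epsilon> *\<^sub>R s) \<in> C"
      by (intro add_closure_in_cone[OF C] ncone_scale[OF C(1)]) (use pos s in \<open>auto simp: D_def\<close>)
    then show "y \<in> C" by simp
  qed
  have "s \<in> D"
  proof -
    have "(1 - \<epsilon>) *\<^sub>R s \<in> closure C" "(M - 1) *\<^sub>R s \<in> closure C" using pos s C_cl by (auto intro: cl(3))
    then show ?thesis by (simp add: D_def algebra_simps)
  qed
  have "closed D"
    unfolding D_def
    by (intro closed_Int closed_vimage[of "closure C", unfolded vimage_def] closed_closure continuous_intros)
  have "bounded D"
  proof -
    obtain c where c: "c > 0" "\<And>u w. u \<in> closure C \<Longrightarrow> w \<in> closure C \<Longrightarrow> norm u \<le> c * norm (u + w)"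
      using closure_normal[OF C(1)] by metis
    have "norm y \<le> norm (\<epsilon> *\<^sub>R s) + c * norm ((M - \<epsilon>) *\<^sub>R s)" if "y \<in> D" for y
    proof -
      have "norm (y - \<epsilon> *\<^sub>R s) \<le> c * norm ((y - \<epsilon> *\<^sub>R s) + (M *\<^sub>R s - y))"
        using that by (intro c(2)) (auto simp: D_def)
      also have "(y - \<epsilon> *\<^sub>R s) + (M *\<^sub>R s - y) = (M - \<epsilon>) *\<^sub>R s" by (simp add: algebra_simps)
      finally show ?thesis using norm_triangle_ineq2[of y "\<epsilon> *\<^sub>R s"] by linarith
    qed
    then show ?thesis unfolding bounded_iff by blast
  qed
  have "convex D"
    unfolding D_def
  proof (rule convex_Int)
    have "{y. y - \<epsilon> *\<^sub>R s \<in> closure C} = (+) (\<epsilon> *\<^sub>R s) ` closure C"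
      by (auto simp: image_iff intro!: bexI[of _ "_ - \<epsilon> *\<^sub>R s"])
    then show "convex {y. y - \<epsilon> *\<^sub>R s \<in> closure C}"
      using convex_closure[OF ncone_convex[OF C(1)]] by (simp add: convex_translation_eq)
    have "{y. M *\<^sub>R s - y \<in> closure C} = (\<lambda>x. M *\<^sub>R s + (- 1) *\<^sub>R x) ` closure C"
      by (auto simp: image_iff intro!: bexI[of _ "M *\<^sub>R s - _"])
    then show "convex {y. M *\<^sub>R s - y \<in> closure C}"
      using convex_affinity[OF convex_closure[OF ncone_convex[OF C(1)]], of "M *\<^sub>R s" "- 1"] by simp
  qed
  define g where "g y = y + \<eta> *\<^sub>R (s - f y)" for y
  have "g \<in> D \<rightarrow> D"
  proof
    fix y assume y: "y \<in> D"
    then have yC: "y \<in> C" using DC by blast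
    have lo': "f y - \<alpha> *\<^sub>R y \<in> closure C" and hi': "\<beta> *\<^sub>R y - f y \<in> closure C" and s': "s \<in> closure C"
      using lo[OF yC] hi[OF yC] s C_cl by auto
    have "(1 - \<eta> * \<beta>) *\<^sub>R (y - \<epsilon> *\<^sub>R s) + \<eta> *\<^sub>R (\<beta> *\<^sub>R y - f y) + (\<eta> * (1 - \<beta> * \<epsilon>)) *\<^sub>R s \<in> closure C"
      using y pos by (intro cl(2,3) hi' s') (auto simp: D_def)
    moreover have "(1 - \<eta> * \<beta>) *\<^sub>R (y - \<epsilon> *\<^sub>R s) + \<eta> *\<^sub>R (\<beta> *\<^sub>R y - f y) + (\<eta> * (1 - \<beta> * \<epsilon>)) *\<^sub>R s
        = g y - \<epsilon> *\<^sub>R s" by (simp add: g_def algebra_simps)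
    moreover have "(1 - \<eta> * \<alpha>) *\<^sub>R (M *\<^sub>R s - y) + \<eta> *\<^sub>R (f y - \<alpha> *\<^sub>R y) + (\<eta> * (\<alpha> * M - 1)) *\<^sub>R s \<in> closure C"
      using y pos by (intro cl(2,3) lo' s') (auto simp: D_def)
    moreover have "(1 - \<eta> * \<alpha>) *\<^sub>R (M *\<^sub>R s - y) + \<eta> *\<^sub>R (f y - \<alpha> *\<^sub>R y) + (\<eta> * (\<alpha> * M - 1)) *\<^sub>R s
        = M *\<^sub>R s - g y" by (simp add: g_def algebra_simps)
    ultimately show "g y \<in> D" by (simp add: D_def)
  qed
  moreover have "continuous_on D g" unfolding g_def
    by (intro continuous_intros continuous_on_subset[OF cont DC])
  ultimately obtain y where "y \<in> D" "g y = y"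
    using brouwer[of D g] \<open>closed D\<close> \<open>bounded D\<close> \<open>convex D\<close> \<open>s \<in> D\<close> compact_eq_bounded_closed by blast
  then have "f y = s" "y \<in> C" using pos DC by (auto simp: g_def)
  then show ?thesis by blast
qed

text \<open>Compactness gives \<open>Q\<close> a uniform margin \<open>d\<close> inside
  \<open>C\<close>; \<open>e\<close> shrinks \<open>Q'\<close> to half of it.\<close>

lemma compact_cone_dominates:
  fixes C :: "'a::real_normed_vector set"
  assumes "open C" "compact Q" "Q \<subseteq> C" "compact Q'"
  obtains e where "e > 0" "\<And>q q'. q \<in> Q \<Longrightarrow> q' \<in> Q' \<Longrightarrow> q - e *\<^sub>R q' \<in> C"
proof -
  obtain d where d: "d > 0" "(\<Union>x\<in>Q. ball x d) \<subseteq> C"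
    using compact_subset_open_imp_ball_epsilon_subset[OF assms(2,1,3)] by blast
  obtain B where B: "B > 0" "\<And>q'. q' \<in> Q' \<Longrightarrow> norm q' \<le> B"
    using compact_imp_bounded[OF assms(4)] bounded_pos by metis
  define e where "e = d / (2 * B)"
  have "q - e *\<^sub>R q' \<in> C" if "q \<in> Q" "q' \<in> Q'" for q q'
  proof -
    have "e * norm q' \<le> e * B" using B d that by (intro mult_left_mono) (auto simp: e_def)
    also have "\<dots> < d" using B d by (simp add: e_def)
    finally have "q - e *\<^sub>R q' \<in> ball q d" using B d by (simp add: dist_norm e_def)
    then show ?thesis using d that by blast
  qed
  moreover have "e > 0" using B d by (simp add: e_def)
  ultimately show thesis by (intro that)
qed

section \<open>Blocks of a linear group\<close>

locale matgrp =
  fixes H :: "(real^'m^'m) set"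
  assumes one_in: "mat 1 \<in> H"
    and mult_in: "A \<in> H \<Longrightarrow> B \<in> H \<Longrightarrow> A ** B \<in> H"
    and inv_in: "A \<in> H \<Longrightarrow> matrix_inv A \<in> H"
    and inv_right: "A \<in> H \<Longrightarrow> A ** matrix_inv A = mat 1"
    and inv_left: "A \<in> H \<Longrightarrow> matrix_inv A ** A = mat 1"
begin

lemma inv_unique: "A \<in> H \<Longrightarrow> A ** B = mat 1 \<Longrightarrow> matrix_inv A = B"
  by (metis inv_left matrix_mul_assoc matrix_mul_lid matrix_mul_rid)

lemma inv_mult: "A \<in> H \<Longrightarrow> B \<in> H \<Longrightarrow> matrix_inv (A ** B) = matrix_inv B ** matrix_inv A"
  by (rule inv_unique) (auto intro: mult_in,
      metis inv_right matrix_mul_assoc matrix_mul_rid)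

lemma inv_inv: "A \<in> H \<Longrightarrow> matrix_inv (matrix_inv A) = A"
  by (rule inv_unique) (auto intro: inv_in inv_left)

lemma inv_act: "A \<in> H \<Longrightarrow> A *v (matrix_inv A *v x) = x" "A \<in> H \<Longrightarrow> matrix_inv A *v (A *v x) = x"
  by (simp_all add: matrix_vector_mul_assoc inv_left inv_right)

lemma bij_left_mult: "g \<in> H \<Longrightarrow> bij_betw (\<lambda>h. g ** h) H H"
  by (rule bij_betw_byWitness[where f'="\<lambda>h. matrix_inv g ** h"])
    (auto simp: matrix_mul_assoc inv_left inv_right intro: mult_in inv_in)

end

text \<open>\<open>s\<close> is a representation on the range of the projection \<open>P\<close>, extended by \<open>0\<close> to the kernel, and the
  sharp cone \<open>K\<close> is open relative to that range. Quotient representations are encoded the same way.\<close>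

definition block :: "(real^'m^'m) set \<Rightarrow> real^'m^'m \<Rightarrow> (real^'m^'m \<Rightarrow> real^'m^'m) \<Rightarrow> (real^'m) set \<Rightarrow> bool" where
  "block H P s K \<longleftrightarrow> P ** P = P \<and> s (mat 1) = P \<and> (\<forall>g\<in>H. \<forall>h\<in>H. s (g ** h) = s g ** s h) \<and>
     (\<forall>h\<in>H. P ** s h = s h \<and> s h ** P = s h) \<and> open {y. P *v y \<in> K} \<and> K \<noteq> {} \<and>
     (\<forall>k\<in>K. P *v k = k) \<and> ncone K \<and> (\<forall>h\<in>H. \<forall>k\<in>K. s h *v k \<in> K)"

lemma blockD:
  assumes "block H P s K"
  shows "P ** P = P" "s (mat 1) = P" "\<And>g h. g \<in> H \<Longrightarrow> h \<in> H \<Longrightarrow> s (g ** h) = s g ** s h"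
    "\<And>h. h \<in> H \<Longrightarrow> P ** s h = s h" "\<And>h. h \<in> H \<Longrightarrow> s h ** P = s h" "open {y. P *v y \<in> K}" "K \<noteq> {}"
    "\<And>k. k \<in> K \<Longrightarrow> P *v k = k" "ncone K" "\<And>h k. h \<in> H \<Longrightarrow> k \<in> K \<Longrightarrow> s h *v k \<in> K"
  using assms unfolding block_def by auto

text \<open>Order unit argument, with g the rescaled matrix: for small u the cone contains the
  projections of q + u and q - u, hence also g q + g u and g q - g u. Their sum 2 g q is bounded, so
  normality bounds each of them. The effect on one interior point thus controls the whole
  block.\<close>

lemma block_bound:
  assumes b: "block H P s K" and Q: "compact Q" "Q \<subseteq> K"
  obtains R where "\<And>h a q. h \<in> H \<Longrightarrow> a > 0 \<Longrightarrow> q \<in> Q \<Longrightarrow> a *\<^sub>R (s h *v q) \<in> Q \<Longrightarrow> norm (a *\<^sub>R s h) \<le> R"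
proof -
  note b = blockD[OF b]
  have "Q \<subseteq> {y. P *v y \<in> K}" using Q b(8) by fastforce
  then obtain d where d: "d > 0" "(\<Union>x\<in>Q. ball x d) \<subseteq> {y. P *v y \<in> K}"
    using compact_subset_open_imp_ball_epsilon_subset[OF Q(1) b(6)] by blast
  obtain B where B: "B > 0" "\<And>q'. q' \<in> Q \<Longrightarrow> norm q' \<le> B"
    using compact_imp_bounded[OF Q(1)] bounded_pos by metis
  obtain c where c: "c > 0" "\<And>u w. u \<in> K \<Longrightarrow> w \<in> K \<Longrightarrow> norm u \<le> c * norm (u + w)"
    using ncone_normal[OF b(9)] by metis
  show thesis
  proof (rule that)
    fix h a q assume h: "h \<in> H" and a: "a > 0" and q: "q \<in> Q" "a *\<^sub>R (s h *v q) \<in> Q"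
    define g where "g = a *\<^sub>R s h"
    have gq: "g *v q \<in> Q" using q by (simp add: g_def matrix_vector_scaleR_left)
    have gK: "g *v k \<in> K" if "k \<in> K" for k
      using that a h b(9,10) by (simp add: g_def matrix_vector_scaleR_left ncone_scale)
    have gP: "g *v (P *v u) = g *v u" for u
      unfolding g_def matrix_vector_scaleR_left by (simp add: matrix_vector_mul_assoc b(5)[OF h])
    have "norm (g *v u) \<le> 2 * c * B + B" if u: "norm u \<le> d / 2" for u
    proof -
      have *: "g *v q + g *v v \<in> K" if "norm v \<le> d / 2" for v
      proof -
        have "q + v \<in> ball q d" using that d by (simp add: dist_norm)
        then have "P *v (q + v) \<in> K" using d q by blast
        then show ?thesis using gK gP by (metis matrix_vector_right_distrib)
      qed
      have "norm (g *v q + g *v u) \<le> c * norm ((g *v q + g *v u) + (g *v q + g *v (- u)))"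
        by (rule c(2)) (rule *, use u in simp)+
      also have "(g *v q + g *v u) + (g *v q + g *v (- u)) = 2 *\<^sub>R (g *v q)"
        by (simp add: scaleR_2 linear_neg[OF matrix_vector_mul_linear])
      also have "c * norm (2 *\<^sub>R (g *v q)) \<le> c * (2 * B)" using B(2)[OF gq] c by simp
      finally have "norm (g *v q + g *v u) \<le> 2 * c * B" by simp
      then show ?thesis using norm_triangle_ineq4[of "g *v q + g *v u" "g *v q"] B(2)[OF gq] by simp
    qed
    then show "norm (a *\<^sub>R s h) \<le> CARD('a) * ((2 * c * B + B) / (d / 2))"
      using norm_matrix_le_of_ball[of "d / 2" g "2 * c * B + B"] d by (simp add: g_def)
  qed
qed

text \<open>The norms on both sets lie in one interval bounded away from 0, so the factor is bounded
  above and below. Base 2 matches the discrete scalings of \<open>lattice_cofinite\<close>.\<close>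

lemma powr_scale_bound:
  fixes Q Q' :: "'a::euclidean_space set"
  assumes "compact Q" "compact Q'" "0 \<notin> Q" "0 \<notin> Q'"
  obtains N where "\<And>x q. q \<in> Q \<Longrightarrow> (2 powr x) *\<^sub>R q \<in> Q' \<Longrightarrow> \<bar>x\<bar> \<le> N"
proof -
  let ?A = "Q \<union> Q'"
  have A: "compact ?A" "0 \<notin> ?A" using assms by auto
  obtain M where M: "M > 0" "\<And>q. q \<in> ?A \<Longrightarrow> norm q \<le> M"
    using compact_imp_bounded[OF A(1)] bounded_pos by metis
  obtain m where m: "m > 0" "\<And>q. q \<in> ?A \<Longrightarrow> m \<le> norm q"
    using separate_point_closed[OF compact_imp_closed[OF A(1)] A(2)] by (auto simp: dist_norm)
  show thesis
  proof (rule that)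
    fix x q assume q: "q \<in> Q" "(2 powr x) *\<^sub>R q \<in> Q'"
    define p where "p = 2 powr x"
    have p: "p > 0" by (simp add: p_def)
    have n: "norm (p *\<^sub>R q) \<le> M" "m \<le> norm (p *\<^sub>R q)" "norm q \<le> M" "m \<le> norm q"
    proof -
      have "p *\<^sub>R q \<in> ?A" "q \<in> ?A" using q by (auto simp: p_def)
      then show "norm (p *\<^sub>R q) \<le> M" "m \<le> norm (p *\<^sub>R q)" "norm q \<le> M" "m \<le> norm q" using M m by blast+
    qed
    then have "p * norm q \<le> M" "m \<le> p * norm q" using p by auto
    then have "p * m \<le> M" "m \<le> p * M"
      using n p mult_left_mono[of m "norm q" p] mult_left_mono[of "norm q" M p] by linarith+
    then have "p \<le> M / m" "1 / p \<le> M / m" using m(1) M(1) p by (auto simp: field_simps)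
    then have "log 2 p \<le> log 2 (M / m)" "log 2 (1 / p) \<le> log 2 (M / m)"
      using p m(1) M(1) by (auto intro!: log_mono)
    then show "\<bar>x\<bar> \<le> log 2 (M / m)" using p by (auto simp: p_def log_divide abs_le_iff)
  qed
qed

section \<open>Products of two blocks\<close>

locale premodel = matgrp H for H :: "(real^'m^'m) set" +
  fixes P1 P2 :: "real^'m^'m" and s1 s2 :: "real^'m^'m \<Rightarrow> real^'m^'m" and K1 K2 :: "(real^'m) set"
  assumes b1: "block H P1 s1 K1" and b2: "block H P2 s2 K2"
    and P12: "P1 ** P2 = 0" and P21: "P2 ** P1 = 0"
begin

text \<open>\<open>P1\<close> and \<open>P2\<close> annihilate each other but need not add up to the
  identity. The rest of the space is kept as a factor on which the group and the scalings act
  trivially, so \<open>K\<close> is an open cone in all of R^m and the dimension of the original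
  space is retained.\<close>

definition "\<sigma> h = s1 h + s2 h + (mat 1 - P1 - P2)"
definition "S a b = a *\<^sub>R P1 + b *\<^sub>R P2 + (mat 1 - P1 - P2)"
definition "K = {y. P1 *v y \<in> K1 \<and> P2 *v y \<in> K2}"

lemma PP [simp]: "P1 *v (P1 *v x) = P1 *v x" "P2 *v (P2 *v x) = P2 *v x"
    "P1 *v (P2 *v x) = 0" "P2 *v (P1 *v x) = 0"
  using blockD(1)[OF b1] blockD(1)[OF b2] P12 P21 by (simp_all add: matrix_vector_mul_assoc)

lemma Ps [simp]: assumes "h \<in> H"
  shows "P1 *v (s1 h *v x) = s1 h *v x" "P2 *v (s2 h *v x) = s2 h *v x"
    "s1 h *v (P1 *v x) = s1 h *v x" "s2 h *v (P2 *v x) = s2 h *v x"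
  using blockD(4,5)[OF b1 assms] blockD(4,5)[OF b2 assms] by (simp_all add: matrix_vector_mul_assoc)

lemma Ps' [simp]: assumes "h \<in> H"
  shows "P1 *v (s2 h *v x) = 0" "P2 *v (s1 h *v x) = 0" "s1 h *v (P2 *v x) = 0" "s2 h *v (P1 *v x) = 0"
  using assms by (metis Ps(2) PP(3), metis Ps(1) PP(4), metis Ps(3) PP(3) matrix_vector_mult_0_right,
      metis Ps(4) PP(4) matrix_vector_mult_0_right)

lemma ss [simp]: assumes "g \<in> H" "h \<in> H"
  shows "s1 g *v (s2 h *v x) = 0" "s2 g *v (s1 h *v x) = 0"
    "s1 g *v (s1 h *v x) = s1 (g ** h) *v x" "s2 g *v (s2 h *v x) = s2 (g ** h) *v x"
  using assms by (metis Ps(3) Ps'(1) matrix_vector_mult_0_right, metis Ps(4) Ps'(2) matrix_vector_mult_0_right,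
      simp_all add: matrix_vector_mul_assoc blockD(3)[OF b1] blockD(3)[OF b2])

lemma \<sigma>_vec: "\<sigma> h *v y = s1 h *v y + s2 h *v y + (y - P1 *v y - P2 *v y)"
  by (simp add: \<sigma>_def matrix_vector_mult_add_rdistrib matrix_vector_mult_diff_rdistrib)

lemma S_vec: "S a b *v y = a *\<^sub>R (P1 *v y) + b *\<^sub>R (P2 *v y) + (y - P1 *v y - P2 *v y)"
  by (simp add: S_def matrix_vector_mult_add_rdistrib matrix_vector_mult_diff_rdistrib matrix_vector_scaleR_left)

lemmas vec_distribs = matrix_vector_right_distrib matrix_vector_mult_diff_distrib matrix_vector_mult_scaleR

lemma P_\<sigma> [simp]: "h \<in> H \<Longrightarrow> P1 *v (\<sigma> h *v y) = s1 h *v y" "h \<in> H \<Longrightarrow> P2 *v (\<sigma> h *v y) = s2 h *v y"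
  by (simp_all add: \<sigma>_vec vec_distribs)

lemma P_S [simp]: "P1 *v (S a b *v y) = a *\<^sub>R (P1 *v y)" "P2 *v (S a b *v y) = b *\<^sub>R (P2 *v y)"
  by (simp_all add: S_vec vec_distribs)

lemma \<sigma>_one [simp]: "\<sigma> (mat 1) = mat 1"
  using blockD(2)[OF b1] blockD(2)[OF b2] by (simp add: \<sigma>_def)

lemma \<sigma>_\<sigma>: "g \<in> H \<Longrightarrow> h \<in> H \<Longrightarrow> \<sigma> g *v (\<sigma> h *v y) = \<sigma> (g ** h) *v y"
  by (subst \<sigma>_vec) (simp add: \<sigma>_vec[of h] \<sigma>_vec[of "g ** h"] vec_distribs)

lemma \<sigma>_mult: "g \<in> H \<Longrightarrow> h \<in> H \<Longrightarrow> \<sigma> (g ** h) = \<sigma> g ** \<sigma> h"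
  by (simp add: matrix_eq \<sigma>_\<sigma> flip: matrix_vector_mul_assoc)

lemma S_S: "S a b *v (S c d *v y) = S (a * c) (b * d) *v y"
  by (subst S_vec) (simp add: S_vec[of c d] S_vec[of "a * c"] vec_distribs)

lemma S_one [simp]: "S 1 1 = mat 1"
  by (simp add: S_def)

lemma S_\<sigma>: "h \<in> H \<Longrightarrow> S a b *v (\<sigma> h *v y) = \<sigma> h *v (S a b *v y)"
  by (simp add: S_vec[of a b "\<sigma> h *v y"] \<sigma>_vec[of h "S a b *v y"] vec_distribs)
    (simp add: \<sigma>_vec S_vec vec_distribs)

lemma \<sigma>_inv [simp]: "h \<in> H \<Longrightarrow> \<sigma> h *v (\<sigma> (matrix_inv h) *v y) = y"
  "h \<in> H \<Longrightarrow> \<sigma> (matrix_inv h) *v (\<sigma> h *v y) = y"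
  by (simp_all add: \<sigma>_\<sigma> inv_in inv_left inv_right)

lemma K_add: "x \<in> K \<Longrightarrow> y \<in> K \<Longrightarrow> x + y \<in> K"
  using blockD(9)[OF b1] blockD(9)[OF b2] by (auto simp: K_def vec_distribs ncone_add)

lemma S_in_K: "a > 0 \<Longrightarrow> b > 0 \<Longrightarrow> y \<in> K \<Longrightarrow> S a b *v y \<in> K"
  using blockD(9)[OF b1] blockD(9)[OF b2] by (auto simp: K_def ncone_scale)

lemma K_scale: "a > 0 \<Longrightarrow> y \<in> K \<Longrightarrow> a *\<^sub>R y \<in> K"
  using blockD(9)[OF b1] blockD(9)[OF b2] by (auto simp: K_def ncone_scale vec_distribs)

lemma \<sigma>_in_K: "h \<in> H \<Longrightarrow> y \<in> K \<Longrightarrow> \<sigma> h *v y \<in> K"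
  using blockD(10)[OF b1, of h "P1 *v y"] blockD(10)[OF b2, of h "P2 *v y"] by (auto simp: K_def)

lemma K_nz: "y \<in> K \<Longrightarrow> P1 *v y \<noteq> 0" "y \<in> K \<Longrightarrow> P2 *v y \<noteq> 0"
  using ncone_nz[OF blockD(9)[OF b1]] ncone_nz[OF blockD(9)[OF b2]] by (auto simp: K_def)

lemma openK: "open K"
  using open_Int[OF blockD(6)[OF b1] blockD(6)[OF b2]] by (simp add: K_def Collect_conj_eq)

lemma K_ne: "K \<noteq> {}"
proof -
  obtain k1 k2 where k: "k1 \<in> K1" "k2 \<in> K2" using blockD(7)[OF b1] blockD(7)[OF b2] by blast
  then have e: "k1 = P1 *v k1" "k2 = P2 *v k2" using blockD(8)[OF b1] blockD(8)[OF b2] by auto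
  have "P1 *v (k1 + k2) = k1" "P2 *v (k1 + k2) = k2"
    by (subst e, simp add: vec_distribs e[symmetric] del: PP(1,2), metis PP e)+
  then have "k1 + k2 \<in> K" using k by (simp add: K_def)
  then show ?thesis by blast
qed

lemma S_\<sigma>_eq: "h \<in> H \<Longrightarrow> S a b ** \<sigma> h = a *\<^sub>R s1 h + b *\<^sub>R s2 h + (mat 1 - P1 - P2)"
  by (simp add: matrix_eq S_vec \<sigma>_vec vec_distribs matrix_vector_mult_add_rdistrib matrix_vector_mult_diff_rdistrib
      matrix_vector_scaleR_left flip: matrix_vector_mul_assoc)

end

text \<open>Discreteness of \<open>\<sigma>\<close> modulo the scalings \<open>S a b\<close>, stated blockwise.\<close>

locale model = premodel H P1 P2 s1 s2 K1 K2
  for H :: "(real^'m^'m) set" and P1 P2 :: "real^'m^'m" and s1 s2 :: "real^'m^'m \<Rightarrow> real^'m^'m"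
    and K1 K2 :: "(real^'m) set" +
  assumes discrete: "\<And>R. finite {h \<in> H. \<exists>a>0. \<exists>b>0. norm (a *\<^sub>R s1 h) \<le> R \<and> norm (b *\<^sub>R s2 h) \<le> R \<and>
       norm ((1 / a) *\<^sub>R s1 (matrix_inv h)) \<le> R \<and> norm ((1 / b) *\<^sub>R s2 (matrix_inv h)) \<le> R}"
begin

text \<open>\<open>block_bound\<close> in each factor bounds the rescaled blocks of
  \<open>h\<close>. The inverse element with the inverse scalings also moves \<open>Q\<close> to
  meet itself, so its blocks obey the same bounds and \<open>discrete\<close> applies.\<close>

lemma proper:
  assumes Q: "compact Q" "Q \<subseteq> K"
  shows "finite {h \<in> H. \<exists>a>0. \<exists>b>0. \<exists>q\<in>Q. S a b *v (\<sigma> h *v q) \<in> Q}" (is "finite ?A")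
proof -
  have c: "compact ((\<lambda>y. P *v y) ` Q)" for P :: "real^'m^'m"
    by (intro compact_continuous_image linear_continuous_on matrix_vector_mul_bounded_linear Q(1))
  obtain R1 where R1: "\<And>h a q. h \<in> H \<Longrightarrow> a > 0 \<Longrightarrow> q \<in> (\<lambda>y. P1 *v y) ` Q \<Longrightarrow>
      a *\<^sub>R (s1 h *v q) \<in> (\<lambda>y. P1 *v y) ` Q \<Longrightarrow> norm (a *\<^sub>R s1 h) \<le> R1"
  proof (rule block_bound[OF b1 c])
    show "(\<lambda>y. P1 *v y) ` Q \<subseteq> K1" using Q(2) by (auto simp: K_def)
  qed (rule that)
  obtain R2 where R2: "\<And>h a q. h \<in> H \<Longrightarrow> a > 0 \<Longrightarrow> q \<in> (\<lambda>y. P2 *v y) ` Q \<Longrightarrow>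
      a *\<^sub>R (s2 h *v q) \<in> (\<lambda>y. P2 *v y) ` Q \<Longrightarrow> norm (a *\<^sub>R s2 h) \<le> R2"
  proof (rule block_bound[OF b2 c])
    show "(\<lambda>y. P2 *v y) ` Q \<subseteq> K2" using Q(2) by (auto simp: K_def)
  qed (rule that)
  have key: "norm (a *\<^sub>R s1 h) \<le> max R1 R2 \<and> norm (b *\<^sub>R s2 h) \<le> max R1 R2"
    if h: "h \<in> H" and ab: "a > 0" "b > 0" and q: "q \<in> Q" "S a b *v (\<sigma> h *v q) \<in> Q" for h a b q
  proof -
    have "P1 *v (S a b *v (\<sigma> h *v q)) = a *\<^sub>R (s1 h *v (P1 *v q))" using h by simp
    then have "norm (a *\<^sub>R s1 h) \<le> R1" using R1[OF h ab(1), of "P1 *v q"] q by (metis imageI)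
    moreover have "P2 *v (S a b *v (\<sigma> h *v q)) = b *\<^sub>R (s2 h *v (P2 *v q))" using h by simp
    then have "norm (b *\<^sub>R s2 h) \<le> R2" using R2[OF h ab(2), of "P2 *v q"] q by (metis imageI)
    ultimately show ?thesis by (simp add: le_max_iff_disj del: norm_scaleR)
  qed
  have "?A \<subseteq> {h \<in> H. \<exists>a>0. \<exists>b>0. norm (a *\<^sub>R s1 h) \<le> max R1 R2 \<and> norm (b *\<^sub>R s2 h) \<le> max R1 R2 \<and>
       norm ((1 / a) *\<^sub>R s1 (matrix_inv h)) \<le> max R1 R2 \<and> norm ((1 / b) *\<^sub>R s2 (matrix_inv h)) \<le> max R1 R2}"
  proof clarify
    fix h a b q assume h: "h \<in> H" and ab: "0 < a" "0 < b" and q: "q \<in> Q" "S a b *v (\<sigma> h *v q) \<in> Q"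
    have "S (1 / a) (1 / b) *v (\<sigma> (matrix_inv h) *v (S a b *v (\<sigma> h *v q))) = q"
      using h ab by (simp add: S_\<sigma>[symmetric] inv_in S_S)
    then show "\<exists>a>0. \<exists>b>0. norm (a *\<^sub>R s1 h) \<le> max R1 R2 \<and> norm (b *\<^sub>R s2 h) \<le> max R1 R2 \<and>
       norm ((1 / a) *\<^sub>R s1 (matrix_inv h)) \<le> max R1 R2 \<and> norm ((1 / b) *\<^sub>R s2 (matrix_inv h)) \<le> max R1 R2"
      using key[OF h ab q] key[OF inv_in[OF h], of "1 / a" "1 / b" "S a b *v (\<sigma> h *v q)"] ab q
      by (intro exI[of _ a] conjI exI[of _ b]) auto
  qed
  then show ?thesis using discrete finite_subset by blast
qed

text \<open>Two lattice coordinates, \<open>i0\<close> and \<open>i1\<close>, are spent on the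
  scalings of the two factors, while \<open>\<gamma>\<close> provides the action of the others. A
  lattice of full rank then acts properly on \<open>K\<close>, and a compact set meeting all its
  orbits yields finitely many coset representatives.\<close>

lemma lattice_cofinite:
  assumes dim2: "2 \<le> CARD('m)"
    and \<gamma>H: "\<And>g. g \<in> lattice \<Longrightarrow> \<gamma> g \<in> H" and \<gamma>0: "\<gamma> (0::real^'m) = mat 1"
    and \<gamma>add: "\<And>g h. g \<in> lattice \<Longrightarrow> h \<in> lattice \<Longrightarrow> \<gamma> (g + h) = \<gamma> g ** \<gamma> h"
    and inj: "\<And>g h. g \<in> lattice \<Longrightarrow> h \<in> lattice \<Longrightarrow> \<gamma> g = \<gamma> h \<Longrightarrow> g $ i0 = h $ i0 \<Longrightarrow> g $ i1 = h $ i1 \<Longrightarrow> g = h"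
  obtains T where "finite T" "\<And>h. h \<in> H \<Longrightarrow> \<exists>g\<in>lattice. \<exists>f\<in>T. h = \<gamma> g ** f"
proof -
  note model_proper = proper
  define \<tau> where "\<tau> g = S (2 powr (g $ i0)) (2 powr (g $ i1)) ** \<sigma> (\<gamma> g)" for g
  have \<tau>_vec: "\<tau> g *v x = S (2 powr (g $ i0)) (2 powr (g $ i1)) *v (\<sigma> (\<gamma> g) *v x)" for g x
    by (simp add: \<tau>_def matrix_vector_mul_assoc)
  interpret lattice_action K \<tau>
  proof
    show "convex K" by (rule convex_if_cone) (auto intro: K_add K_scale)
    show "\<tau> 0 = mat 1" by (simp add: \<tau>_def \<gamma>0)
    show "\<tau> (g + h) = \<tau> g ** \<tau> h" if "g \<in> lattice" "h \<in> lattice" for g h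
      using that by (simp add: matrix_eq \<tau>_vec \<gamma>add S_\<sigma> \<gamma>H S_S powr_add flip: matrix_vector_mul_assoc \<sigma>_\<sigma>)
    show "\<tau> g *v x \<in> K" if "g \<in> lattice" "x \<in> K" for g x
      using that by (simp add: \<tau>_vec S_in_K \<sigma>_in_K \<gamma>H)
    fix Q assume Q: "compact Q" "Q \<subseteq> K"
    define A where "A = {h \<in> H. \<exists>a>0. \<exists>b>0. \<exists>q\<in>Q. S a b *v (\<sigma> h *v q) \<in> Q}"
    have fA: "finite A" unfolding A_def by (rule model_proper[OF Q])
    \<comment> \<open>For one \<open>h\<close> the scalings that bring \<open>Q\<close> back to
      itself are bounded. Only finitely many \<open>h\<close> occur, so one bound serves all, and
      being integers the exponents are then finite in number.\<close>
    have "\<exists>N. \<forall>x y q. q \<in> Q \<longrightarrow> S (2 powr x) (2 powr y) *v (\<sigma> h *v q) \<in> Q \<longrightarrow> \<bar>x\<bar> \<le> N \<and> \<bar>y\<bar> \<le> N"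
      if h: "h \<in> A" for h
    proof -
      have hH: "h \<in> H" using h by (simp add: A_def)
      have c: "compact ((\<lambda>y. M *v y) ` Q)" for M :: "real^'m^'m"
        by (intro compact_continuous_image linear_continuous_on matrix_vector_mul_bounded_linear Q(1))
      have z: "0 \<notin> (\<lambda>y. P1 *v y) ` Q" "0 \<notin> (\<lambda>y. P2 *v y) ` Q" "0 \<notin> (\<lambda>y. s1 h *v y) ` Q" "0 \<notin> (\<lambda>y. s2 h *v y) ` Q"
        using K_nz Q(2) K_nz[OF \<sigma>_in_K[OF hH]] hH by (auto simp: subset_iff)
      obtain N1 where N1: "\<And>x q. q \<in> (\<lambda>y. s1 h *v y) ` Q \<Longrightarrow> (2 powr x) *\<^sub>R q \<in> (\<lambda>y. P1 *v y) ` Q \<Longrightarrow> \<bar>x\<bar> \<le> N1"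
        by (rule powr_scale_bound[OF c c z(3) z(1)]) (rule that, blast)
      obtain N2 where N2: "\<And>x q. q \<in> (\<lambda>y. s2 h *v y) ` Q \<Longrightarrow> (2 powr x) *\<^sub>R q \<in> (\<lambda>y. P2 *v y) ` Q \<Longrightarrow> \<bar>x\<bar> \<le> N2"
        by (rule powr_scale_bound[OF c c z(4) z(2)]) (rule that, blast)
      have "\<bar>x\<bar> \<le> max N1 N2 \<and> \<bar>y\<bar> \<le> max N1 N2"
        if q: "q \<in> Q" "S (2 powr x) (2 powr y) *v (\<sigma> h *v q) \<in> Q" for x y q
      proof -
        have "(2 powr x) *\<^sub>R (s1 h *v q) \<in> (\<lambda>y. P1 *v y) ` Q"
          by (rule image_eqI[OF _ q(2)]) (simp add: hH)
        moreover have "(2 powr y) *\<^sub>R (s2 h *v q) \<in> (\<lambda>y. P2 *v y) ` Q"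
          by (rule image_eqI[OF _ q(2)]) (simp add: hH)
        ultimately show ?thesis using N1 N2 q(1) by (meson image_eqI le_max_iff_disj)
      qed
      then show ?thesis by blast
    qed
    then obtain N where N: "\<And>h x y q. h \<in> A \<Longrightarrow> q \<in> Q \<Longrightarrow> S (2 powr x) (2 powr y) *v (\<sigma> h *v q) \<in> Q \<Longrightarrow> \<bar>x\<bar> \<le> N h \<and> \<bar>y\<bar> \<le> N h"
      by metis
    define B where "B = (\<Sum>h\<in>A. \<bar>N h\<bar>)"
    have NB: "N h \<le> B" if "h \<in> A" for h
    proof -
      have "\<bar>N h\<bar> \<le> B" unfolding B_def by (rule member_le_sum[OF that _ fA]) simp
      then show ?thesis by linarith
    qed
    let ?X = "{g \<in> lattice. \<exists>q\<in>Q. \<tau> g *v q \<in> Q}"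
    let ?I = "{k :: real. k \<in> \<int> \<and> - B \<le> k \<and> k \<le> B}"
    have "(\<lambda>g. (\<gamma> g, g $ i0, g $ i1)) ` ?X \<subseteq> A \<times> ?I \<times> ?I"
    proof (rule image_subsetI)
      fix g assume "g \<in> ?X"
      then obtain q where g: "g \<in> lattice" "q \<in> Q" "\<tau> g *v q \<in> Q" by blast
      then have A: "\<gamma> g \<in> A" unfolding A_def \<tau>_vec 
        by (intro CollectI conjI \<gamma>H exI[of _ "2 powr (g $ i0)"] exI[of _ "2 powr (g $ i1)"]) auto
      have "\<bar>g $ i0\<bar> \<le> B" "\<bar>g $ i1\<bar> \<le> B"
        using N[OF A g(2), of "g $ i0" "g $ i1"] g(3) NB[OF A] by (auto simp: \<tau>_vec)
      then show "(\<gamma> g, g $ i0, g $ i1) \<in> A \<times> ?I \<times> ?I"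
        using A g(1) by (auto simp: lattice_def)
    qed
    moreover have "finite (A \<times> ?I \<times> ?I)" using fA by (intro finite_cartesian_product finite_int_segment)
    moreover have "inj_on (\<lambda>g. (\<gamma> g, g $ i0, g $ i1)) ?X" by (rule inj_onI) (auto intro: inj)
    ultimately show "finite ?X" using finite_subset finite_imageD by blast
  qed (auto intro: K_add K_scale openK K_ne simp: K_ne)
  obtain Q where Q: "compact Q" "Q \<subseteq> K" "K = orb Q" using cocompact[OF dim2] .
  obtain k where k: "k \<in> K" using K_ne by blast
  \<comment> \<open>The base point \<open>k\<close> is added because the representative
    \<open>f\<close> will be seen to carry \<open>k\<close> into \<open>Q\<close> up to scaling;
    both must lie in one compact set.\<close>
  define T where "T = {h \<in> H. \<exists>a>0. \<exists>b>0. \<exists>q\<in>insert k Q. S a b *v (\<sigma> h *v q) \<in> insert k Q}"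
  have "finite T" unfolding T_def by (rule model_proper) (use Q k in auto)
  moreover have "\<exists>g\<in>lattice. \<exists>f\<in>T. h = \<gamma> g ** f" if h: "h \<in> H" for h
  proof -
    have "\<sigma> h *v k \<in> orb Q" using \<sigma>_in_K[OF h k] Q(3) by simp
    then obtain g q where g: "g \<in> lattice" "q \<in> Q" "\<sigma> h *v k = \<tau> g *v q" unfolding orb_def by blast
    define f where "f = matrix_inv (\<gamma> g) ** h"
    have gH: "\<gamma> g \<in> H" using \<gamma>H g by blast
    have fH: "f \<in> H" unfolding f_def using gH h by (intro mult_in inv_in)
    define a b where "a = 2 powr (g $ i0)" and "b = 2 powr (g $ i1)"
    have ab: "a > 0" "b > 0" by (simp_all add: a_def b_def)
    have "\<sigma> f *v k = \<sigma> (matrix_inv (\<gamma> g)) *v (\<tau> g *v q)"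
      using gH h g(3) by (simp add: f_def inv_in flip: \<sigma>_\<sigma>)
    also have "\<dots> = S a b *v q" using gH by (simp add: \<tau>_vec S_\<sigma>[symmetric] inv_in a_def b_def)
    finally have "S (1 / a) (1 / b) *v (\<sigma> f *v k) = q" using ab by (simp add: S_S)
    then have "f \<in> T" unfolding T_def using fH ab g(2)
      by (intro CollectI conjI exI[of _ "1 / a"] exI[of _ "1 / b"] bexI[of _ k]) auto
    moreover have "h = \<gamma> g ** f" using gH by (simp add: f_def matrix_mul_assoc inv_right)
    ultimately show ?thesis using g(1) by blast
  qed
  ultimately show thesis by (rule that)
qed

text \<open>A slice for the two scalings: both block components get norm 1 and the remaining
  component is kept, so functions of \<open>unit_scale k\<close> are invariant under all positive
  scalings.\<close>

definition "unit_scale k = S (1 / norm (P1 *v k)) (1 / norm (P2 *v k)) *v k"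

lemma unit_scale_S: "a > 0 \<Longrightarrow> b > 0 \<Longrightarrow> unit_scale (S a b *v k) = unit_scale k"
  by (simp add: unit_scale_def S_S)

lemma unit_scale_in_K: "k \<in> K \<Longrightarrow> unit_scale k \<in> K"
  unfolding unit_scale_def using K_nz[of k] by (intro S_in_K) auto

lemma unit_scale_eq: "unit_scale k = (1 / norm (P1 *v k)) *\<^sub>R (P1 *v k) + (1 / norm (P2 *v k)) *\<^sub>R (P2 *v k)
    + (k - P1 *v k - P2 *v k)"
  by (simp add: unit_scale_def S_vec)

lemma differentiable_matrix_vector: "(\<lambda>x. M *v x) differentiable (at x)" for M :: "real^'n^'k"
  by (intro linear_imp_differentiable matrix_vector_mul_linear)

lemma differentiable_norm_matrix:
  fixes M :: "real^'n^'k"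
  assumes "M *v k \<noteq> 0" shows "(\<lambda>k. norm (M *v k)) differentiable (at k)"
proof -
  have "norm differentiable (at (M *v k))" by (rule differentiable_norm_at[OF assms])
  then show ?thesis
    using differentiable_chain_at[OF differentiable_matrix_vector[of M k]] by (simp add: o_def)
qed

lemma differentiable_unit_scale: "k \<in> K \<Longrightarrow> unit_scale differentiable (at k)"
  unfolding unit_scale_eq[abs_def] divide_inverse
  using K_nz[of k]
  by (intro differentiable_add differentiable_diff differentiable_scaleR differentiable_mult differentiable_inverse
      differentiable_norm_matrix differentiable_matrix_vector differentiable_const differentiable_ident) auto

text \<open>Equivariant maps \<open>F : C \<rightarrow> K\<close> and \<open>\<theta> : K \<rightarrow> C\<close>: the composition is onto up to scaling, while the
  two-parameter scaling invariance of \<open>\<theta>\<close> makes its image negligible.\<close>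

theorem not_cocompact:
  assumes C: "block H (mat 1) (\<lambda>h. h) C"
    and discC: "\<And>R. finite {h \<in> H. \<exists>a>0. norm (a *\<^sub>R h) \<le> R \<and> norm ((1 / a) *\<^sub>R matrix_inv h) \<le> R}"
    and Q: "compact Q" "Q \<subseteq> C" and cover: "\<And>y. y \<in> C \<Longrightarrow> \<exists>h\<in>H. \<exists>a>0. \<exists>q\<in>Q. y = a *\<^sub>R (h *v q)"
  shows False
proof -
  have oC: "open C" and nC: "ncone C" and hC: "\<And>h y. h \<in> H \<Longrightarrow> y \<in> C \<Longrightarrow> h *v y \<in> C" and neC: "C \<noteq> {}"
    using blockD(6,7,9,10)[OF C] by auto
  have properC: "finite {h \<in> H. \<exists>a>0. \<exists>q\<in>Q'. a *\<^sub>R (h *v q) \<in> Q'}" if Q': "compact Q'" "Q' \<subseteq> C" for Q'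
  proof -
    obtain R where R: "\<And>h a q. h \<in> H \<Longrightarrow> a > 0 \<Longrightarrow> q \<in> Q' \<Longrightarrow> a *\<^sub>R (h *v q) \<in> Q' \<Longrightarrow> norm (a *\<^sub>R h) \<le> R"
      using block_bound[OF C Q'] by metis
    have "{h \<in> H. \<exists>a>0. \<exists>q\<in>Q'. a *\<^sub>R (h *v q) \<in> Q'} \<subseteq>
        {h \<in> H. \<exists>a>0. norm (a *\<^sub>R h) \<le> R \<and> norm ((1 / a) *\<^sub>R matrix_inv h) \<le> R}"
    proof clarify
      fix h a q assume h: "h \<in> H" and a: "0 < a" and q: "q \<in> Q'" "a *\<^sub>R (h *v q) \<in> Q'"
      have "(1 / a) *\<^sub>R (matrix_inv h *v (a *\<^sub>R (h *v q))) = q"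
        using h a by (simp add: matrix_vector_mult_scaleR inv_act)
      then have "norm ((1 / a) *\<^sub>R matrix_inv h) \<le> R"
        using R[OF inv_in[OF h], of "1 / a" "a *\<^sub>R (h *v q)"] a q by simp
      then show "\<exists>a>0. norm (a *\<^sub>R h) \<le> R \<and> norm ((1 / a) *\<^sub>R matrix_inv h) \<le> R"
        using R[OF h a q] a by blast
    qed
    then show ?thesis using discC finite_subset by blast
  qed
  obtain k0 where k0: "k0 \<in> K" using K_ne by blast
  obtain c0 where c0: "c0 \<in> C" using neC by blast
  \<comment> \<open>The bump is evaluated on directions only, so that \<open>F\<close> ignores
    positive scaling of its argument.\<close>
  define \<nu> :: "real^'m \<Rightarrow> real^'m" where "\<nu> z = (1 / norm z) *\<^sub>R z" for z
  have \<nu>_scale: "\<nu> (a *\<^sub>R z) = \<nu> z" if "a > 0" for a z using that by (simp add: \<nu>_def)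
  have c\<nu>: "continuous_on C \<nu>" unfolding \<nu>_def
    using ncone_nz[OF nC] by (intro continuous_intros) auto
  have \<nu>C: "\<nu> z \<in> C" if "z \<in> C" for z
    unfolding \<nu>_def using that ncone_nz[OF nC that] by (intro ncone_scale[OF nC]) auto
  have "compact (\<nu> ` Q)" by (intro compact_continuous_image continuous_on_subset[OF c\<nu>] Q)
  moreover have "\<nu> ` Q \<subseteq> C" using \<nu>C Q by blast
  ultimately obtain \<beta> :: "real^'m \<Rightarrow> real" and Q1 where \<beta>: "\<And>x. \<beta> differentiable (at x)" "\<And>x. 0 \<le> \<beta> x"
    "\<And>x. x \<in> \<nu> ` Q \<Longrightarrow> 0 < \<beta> x" "compact Q1" "Q1 \<subseteq> C" "\<And>x. \<beta> x \<noteq> 0 \<Longrightarrow> x \<in> Q1"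
    using bump_exists[OF _ oC] by metis
  define f where "f h y = \<beta> (\<nu> (matrix_inv h *v y)) *\<^sub>R (\<sigma> h *v k0)" for h y
  define F where "F = esum H f"
  have lf: "loc_fin H f C"
    unfolding loc_fin_def
  proof
    fix y assume "y \<in> C"
    then obtain e where e: "e > 0" "cball y e \<subseteq> C" using oC open_contains_cball by blast
    let ?Q = "Q1 \<union> cball y e"
    have fin: "finite {h \<in> H. \<exists>a>0. \<exists>q\<in>?Q. a *\<^sub>R (h *v q) \<in> ?Q}"
      by (rule properC) (use \<beta> e in auto)
    have "{h \<in> H. \<exists>z\<in>ball y e. f h z \<noteq> 0} \<subseteq> {h \<in> H. \<exists>a>0. \<exists>q\<in>?Q. a *\<^sub>R (h *v q) \<in> ?Q}"
    proof clarify
      fix h z assume h: "h \<in> H" and z: "z \<in> ball y e" "f h z \<noteq> 0"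
      define w where "w = matrix_inv h *v z"
      have "z \<in> C" using z e by (meson ball_subset_cball subsetD)
      then have wC: "w \<in> C" unfolding w_def by (intro hC inv_in h)
      then have wn: "norm w > 0" using ncone_nz[OF nC] by auto
      have "\<nu> w \<in> Q1" using z(2) \<beta>(6) by (auto simp: f_def w_def)
      moreover have "norm w *\<^sub>R (h *v \<nu> w) = z"
        using wn h by (simp add: \<nu>_def matrix_vector_mult_scaleR w_def inv_act)
      ultimately show "\<exists>a>0. \<exists>q\<in>?Q. a *\<^sub>R (h *v q) \<in> ?Q"
        using wn z(1) by (intro exI[of _ "norm w"] conjI bexI[of _ "\<nu> w"]) auto
    qed
    then show "\<exists>e>0. finite {h \<in> H. \<exists>z\<in>ball y e. f h z \<noteq> 0}" using fin e(1) finite_subset by blast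
  qed
  have cont_\<beta>: "continuous_on X \<beta>" for X
    by (intro continuous_at_imp_continuous_on ballI differentiable_imp_continuous_within \<beta>(1))
  have "continuous_on C F"
    unfolding F_def
  proof (rule continuous_on_esum[OF lf])
    fix h assume h: "h \<in> H"
    have "continuous_on C (\<lambda>y. \<nu> (matrix_inv h *v y))"
      by (rule continuous_on_compose2[OF c\<nu>])
        (use hC[OF inv_in[OF h]] in \<open>auto intro: linear_continuous_on matrix_vector_mul_bounded_linear\<close>)
    then have "continuous_on C (\<lambda>y. \<beta> (\<nu> (matrix_inv h *v y)))"
      by (rule continuous_on_compose2[OF cont_\<beta>]) auto
    then show "continuous_on C (f h)" unfolding f_def by (intro continuous_intros)
  qed
  note cF = this
  have F_eq: "F (a *\<^sub>R (g *v y)) = \<sigma> g *v F y" if g: "g \<in> H" and a: "a > 0" and y: "y \<in> C" for g a y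
    unfolding F_def
  proof (rule esum_equivariant[where m="\<lambda>h. g ** h" and T="\<lambda>y. a *\<^sub>R (g *v y)"])
    show "f (g ** h) (a *\<^sub>R (g *v y)) = \<sigma> g *v f h y" if h: "h \<in> H" for h
      using g h a by (simp add: f_def inv_mult matrix_vector_mult_scaleR \<nu>_scale inv_act \<sigma>_\<sigma>
          flip: matrix_vector_mul_assoc)
  qed (use bij_left_mult[OF g] loc_fin_finite[OF lf y] in auto)
  have F_K: "F y \<in> K" if y: "y \<in> C" for y
  proof -
    obtain h a q where h: "h \<in> H" "a > 0" "q \<in> Q" "y = a *\<^sub>R (h *v q)" using cover[OF y] by blast
    have "f h y \<noteq> 0"
    proof -
      have "\<nu> (matrix_inv h *v y) = \<nu> q" using h by (simp add: matrix_vector_mult_scaleR inv_act \<nu>_scale)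
      then have "\<beta> (\<nu> (matrix_inv h *v y)) > 0" using \<beta>(3) h(3) by simp
      moreover have "\<sigma> h *v k0 \<noteq> 0" using K_nz[OF \<sigma>_in_K[OF h(1) k0]] by (metis matrix_vector_mult_0_right)
      ultimately show ?thesis by (simp add: f_def)
    qed
    moreover have "f h y \<in> K" if "h \<in> H" "f h y \<noteq> 0" for h
      unfolding f_def using that \<beta>(2)[of "\<nu> (matrix_inv h *v y)"]
      by (intro K_scale \<sigma>_in_K k0) (auto simp: f_def)
    ultimately show ?thesis unfolding F_def esum_def using h(1)
      by (intro sum_in_cone loc_fin_finite[OF lf y]) (auto intro: K_add)
  qed
  \<comment> \<open>Only values of \<open>F\<close> have to be seen by the second map: its bump is
    positive on this compact slice of them, which puts \<open>\<theta> (F y)\<close> in the cone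
    although \<open>\<theta>\<close> may vanish elsewhere on \<open>K\<close>.\<close>
  define QK where "QK = unit_scale ` F ` Q"
  have cus: "continuous_on K unit_scale"
    by (intro continuous_at_imp_continuous_on ballI differentiable_imp_continuous_within differentiable_unit_scale)
  have QK: "compact QK" "QK \<subseteq> K"
    unfolding QK_def using F_K Q unit_scale_in_K
    by (auto intro!: compact_continuous_image continuous_on_subset[OF cus] continuous_on_subset[OF cF])
  obtain \<beta>' :: "real^'m \<Rightarrow> real" and Q2 where \<beta>': "\<And>x. \<beta>' differentiable (at x)" "\<And>x. 0 \<le> \<beta>' x"
    "\<And>x. x \<in> QK \<Longrightarrow> 0 < \<beta>' x" "compact Q2" "Q2 \<subseteq> K" "\<And>x. \<beta>' x \<noteq> 0 \<Longrightarrow> x \<in> Q2"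
    using bump_exists[OF QK(1) openK QK(2)] by metis
  define t where "t h k = \<beta>' (unit_scale (\<sigma> (matrix_inv h) *v k)) *\<^sub>R (h *v c0)" for h k
  define \<theta> where "\<theta> = esum H t"
  have lt: "loc_fin H t K"
    unfolding loc_fin_def
  proof
    fix y assume "y \<in> K"
    then obtain e where e: "e > 0" "cball y e \<subseteq> K" using openK open_contains_cball by blast
    let ?Q = "Q2 \<union> cball y e"
    have fin: "finite {h \<in> H. \<exists>a>0. \<exists>b>0. \<exists>q\<in>?Q. S a b *v (\<sigma> h *v q) \<in> ?Q}"
      by (rule proper) (use \<beta>' e in auto)
    have "{h \<in> H. \<exists>z\<in>ball y e. t h z \<noteq> 0} \<subseteq> {h \<in> H. \<exists>a>0. \<exists>b>0. \<exists>q\<in>?Q. S a b *v (\<sigma> h *v q) \<in> ?Q}"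
    proof clarify
      fix h z assume h: "h \<in> H" and z: "z \<in> ball y e" "t h z \<noteq> 0"
      define w where "w = \<sigma> (matrix_inv h) *v z"
      have "z \<in> K" using z e by (meson ball_subset_cball subsetD)
      then have wK: "w \<in> K" unfolding w_def by (intro \<sigma>_in_K inv_in h)
      have "unit_scale w \<in> Q2" using z(2) \<beta>'(6) by (auto simp: t_def w_def)
      moreover have "S (norm (P1 *v w)) (norm (P2 *v w)) *v (\<sigma> h *v unit_scale w) = z"
        using K_nz[OF wK] h by (simp add: unit_scale_def S_\<sigma> S_S) (simp add: w_def)
      ultimately show "\<exists>a>0. \<exists>b>0. \<exists>q\<in>?Q. S a b *v (\<sigma> h *v q) \<in> ?Q"
        using K_nz[OF wK] z(1)
        by (intro exI[of _ "norm (P1 *v w)"] conjI exI[of _ "norm (P2 *v w)"] bexI[of _ "unit_scale w"]) auto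
    qed
    then show "\<exists>e>0. finite {h \<in> H. \<exists>z\<in>ball y e. t h z \<noteq> 0}" using fin e(1) finite_subset by blast
  qed
  have d\<theta>: "\<theta> differentiable (at k)" if k: "k \<in> K" for k
    unfolding \<theta>_def
  proof (rule differentiable_esum[OF lt k])
    fix h assume h: "h \<in> H"
    have "(unit_scale \<circ> (\<lambda>k. \<sigma> (matrix_inv h) *v k)) differentiable (at k)"
      by (intro differentiable_chain_at differentiable_matrix_vector differentiable_unit_scale \<sigma>_in_K inv_in h k)
    then have "(\<beta>' \<circ> (unit_scale \<circ> (\<lambda>k. \<sigma> (matrix_inv h) *v k))) differentiable (at k)"
      by (rule differentiable_chain_at) (rule \<beta>'(1))
    then show "t h differentiable (at k)"
      unfolding t_def by (intro differentiable_scaleR differentiable_const) (simp add: o_def)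
  qed
  have \<theta>_S: "\<theta> (S a b *v k) = \<theta> k" if "a > 0" "b > 0" for a b k
  proof -
    have "t h (S a b *v k) = t h k" if "h \<in> H" for h
      using that \<open>a > 0\<close> \<open>b > 0\<close> by (simp add: t_def S_\<sigma>[symmetric] inv_in unit_scale_S)
    then show ?thesis unfolding \<theta>_def esum_def by (intro sum.cong) auto
  qed
  have \<theta>_eq: "\<theta> (\<sigma> g *v k) = g *v \<theta> k" if g: "g \<in> H" and k: "k \<in> K" for g k
    unfolding \<theta>_def
  proof (rule esum_equivariant[where m="\<lambda>h. g ** h" and T="\<lambda>k. \<sigma> g *v k"])
    show "t (g ** h) (\<sigma> g *v k) = g *v t h k" if h: "h \<in> H" for h
      using g h by (simp add: t_def inv_mult inv_in matrix_vector_mult_scaleR \<sigma>_\<sigma>[symmetric] matrix_vector_mul_assoc[symmetric])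
  qed (use bij_left_mult[OF g] loc_fin_finite[OF lt k] in auto)
  have \<theta>F_C: "\<theta> (F y) \<in> C" if y: "y \<in> C" for y
  proof -
    obtain h a q where h: "h \<in> H" "a > 0" "q \<in> Q" "y = a *\<^sub>R (h *v q)" using cover[OF y] by blast
    have Fy: "F y = \<sigma> h *v F q" using F_eq h Q by blast
    have "t h (F y) \<noteq> 0"
    proof -
      have "\<beta>' (unit_scale (\<sigma> (matrix_inv h) *v F y)) > 0"
        using \<beta>'(3)[of "unit_scale (F q)"] h(3) by (simp add: Fy h(1) QK_def)
      moreover have "h *v c0 \<noteq> 0" using ncone_nz[OF nC hC[OF h(1) c0]] .
      ultimately show ?thesis by (simp add: t_def)
    qed
    moreover have "t h (F y) \<in> C" if "h \<in> H" "t h (F y) \<noteq> 0" for h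
      unfolding t_def using that \<beta>'(2)[of "unit_scale (\<sigma> (matrix_inv h) *v F y)"]
      by (intro ncone_scale[OF nC] hC c0) (auto simp: t_def)
    ultimately show ?thesis unfolding \<theta>_def esum_def using h(1)
      by (intro sum_in_cone loc_fin_finite[OF lt F_K[OF y]]) (auto intro: ncone_add[OF nC])
  qed
  have c\<theta>F: "continuous_on C (\<lambda>y. \<theta> (F y))"
  proof (rule continuous_on_compose2[OF _ cF])
    show "continuous_on K \<theta>"
      by (intro continuous_at_imp_continuous_on ballI differentiable_imp_continuous_within d\<theta>)
  qed (use F_K in auto)
  \<comment> \<open>\<open>\<theta> (F y)\<close> does not scale with \<open>y\<close>; this factor
    restores homogeneity and gives \<open>G y\<close> the norm of \<open>y\<close>. It costs exact
    equivariance, since the group does not preserve the norm, so \<open>G\<close> is compared with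
    the identity by estimates.\<close>
  define \<kappa> where "\<kappa> y = norm y / norm (\<theta> (F y))" for y
  define G where "G y = \<kappa> y *\<^sub>R \<theta> (F y)" for y
  have kpos: "\<kappa> y > 0" if "y \<in> C" for y
    using ncone_nz[OF nC that] ncone_nz[OF nC \<theta>F_C[OF that]] by (simp add: \<kappa>_def)
  have "\<exists>\<alpha> \<beta>. \<alpha> > 0 \<and> \<beta> > 0 \<and> (\<forall>y\<in>C. G y - \<alpha> *\<^sub>R y \<in> C \<and> \<beta> *\<^sub>R y - G y \<in> C)"
  proof -
    let ?T = "(\<lambda>y. \<theta> (F y)) ` Q"
    have T: "compact ?T" "?T \<subseteq> C"
      using \<theta>F_C Q by (auto intro!: compact_continuous_image continuous_on_subset[OF c\<theta>F])
    obtain e1 where e1: "e1 > 0" "\<And>q q'. q \<in> ?T \<Longrightarrow> q' \<in> Q \<Longrightarrow> q - e1 *\<^sub>R q' \<in> C"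
      using compact_cone_dominates[OF oC T Q(1)] by metis
    obtain e2 where e2: "e2 > 0" "\<And>q q'. q \<in> Q \<Longrightarrow> q' \<in> ?T \<Longrightarrow> q - e2 *\<^sub>R q' \<in> C"
      using compact_cone_dominates[OF oC Q T(1)] by metis
    obtain c where c: "c > 0" "\<And>u w. u \<in> C \<Longrightarrow> w \<in> C \<Longrightarrow> norm u \<le> c * norm (u + w)"
      using ncone_normal[OF nC] by metis
    \<comment> \<open>On compact sets the points q and \<open>\<theta> (F q)\<close> dominate
      multiples of each other, with constants \<open>e1\<close> and \<open>e2\<close>, and the group
      carries this to every orbit. Normality turns it into inequalities of norms, which pin
      \<open>\<kappa> y\<close> between a e2 / c and c a / e1.\<close>
    have "G y - (e1 * e2 / c) *\<^sub>R y \<in> C \<and> (c / (e1 * e2)) *\<^sub>R y - G y \<in> C" if y: "y \<in> C" for y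
    proof -
      obtain h a q where h: "h \<in> H" "a > 0" "q \<in> Q" "y = a *\<^sub>R (h *v q)" using cover[OF y] by blast
      define z where "z = \<theta> (F y)"
      have z: "z = h *v \<theta> (F q)" using F_eq[OF h(1,2)] \<theta>_eq[OF h(1) F_K] h Q by (auto simp: z_def)
      have zC: "z \<in> C" using \<theta>F_C[OF y] by (simp add: z_def)
      have "h *v (\<theta> (F q) - e1 *\<^sub>R q) \<in> C" "h *v (q - e2 *\<^sub>R \<theta> (F q)) \<in> C"
        using e1(2)[of "\<theta> (F q)" q] e2(2)[of q "\<theta> (F q)"] h(1,3) by (auto intro: hC)
      moreover have "h *v (\<theta> (F q) - e1 *\<^sub>R q) = z - (e1 / a) *\<^sub>R y"
        using h(2) by (simp add: z h(4) vec_distribs)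
      moreover have "a *\<^sub>R (h *v (q - e2 *\<^sub>R \<theta> (F q))) = y - (a * e2) *\<^sub>R z"
        using h(2) by (simp add: z h(4) vec_distribs scaleR_right_diff_distrib)
      ultimately have lo: "z - (e1 / a) *\<^sub>R y \<in> C" and hi: "y - (a * e2) *\<^sub>R z \<in> C"
        using ncone_scale[OF nC h(2)] by metis+
      have e1y: "(e1 / a) *\<^sub>R y \<in> C" and e2z: "(a * e2) *\<^sub>R z \<in> C"
        using y zC e1 e2 h(2) by (auto intro: ncone_scale[OF nC])
      have n1: "norm ((e1 / a) *\<^sub>R y) \<le> c * norm z" using c(2)[OF e1y lo] by simp
      have n2: "norm ((a * e2) *\<^sub>R z) \<le> c * norm y" using c(2)[OF e2z hi] by simp
      have nz: "norm z > 0" "norm y > 0" using ncone_nz[OF nC] zC y by auto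
      define l where "l = \<kappa> y"
      have l: "l > 0" "l = norm y / norm z" using kpos[OF y] by (simp_all add: l_def \<kappa>_def z_def)
      have l1: "l \<le> c * a / e1"
        using n1 nz e1(1) h(2) by (simp add: l(2) field_simps)
      have l2: "a * e2 / c \<le> l"
        using n2 nz e2(1) h(2) c(1) by (simp add: l(2) field_simps)
      have Gy: "G y = l *\<^sub>R z" by (simp add: G_def l_def z_def)
      have A: "G y - (e1 * e2 / c) *\<^sub>R y = l *\<^sub>R (z - (e1 / a) *\<^sub>R y) + (l * e1 / a - e1 * e2 / c) *\<^sub>R y"
        by (simp add: Gy algebra_simps)
      have A2: "l * e1 / a - e1 * e2 / c \<ge> 0"
      proof -
        have "(a * e2 / c) * (e1 / a) \<le> l * (e1 / a)" using l2 e1(1) h(2) by (intro mult_right_mono) auto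
        then show ?thesis using h(2) by (simp add: mult.commute)
      qed
      have B: "(c / (e1 * e2)) *\<^sub>R y - G y = (l / (a * e2)) *\<^sub>R (y - (a * e2) *\<^sub>R z) + (c / (e1 * e2) - l / (a * e2)) *\<^sub>R y"
        using h(2) e2(1) by (simp add: Gy algebra_simps)
      have B2: "c / (e1 * e2) - l / (a * e2) \<ge> 0"
      proof -
        have "l * (1 / (a * e2)) \<le> (c * a / e1) * (1 / (a * e2))" using l1 e2(1) h(2) by (intro mult_right_mono) auto
        then show ?thesis using h(2) by simp
      qed
      have *: "u + r *\<^sub>R y \<in> C" if "u \<in> C" "r \<ge> 0" for u r
        using that ncone_add[OF nC that(1), of "r *\<^sub>R y"] ncone_scale[OF nC _ y, of r] by (cases "r = 0") auto
      show ?thesis unfolding A B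
      proof
        show "l *\<^sub>R (z - (e1 / a) *\<^sub>R y) + (l * e1 / a - e1 * e2 / c) *\<^sub>R y \<in> C"
          by (rule *[OF ncone_scale[OF nC l(1) lo] A2])
        have "l / (a * e2) > 0" using l(1) h(2) e2(1) by simp
        then show "(l / (a * e2)) *\<^sub>R (y - (a * e2) *\<^sub>R z) + (c / (e1 * e2) - l / (a * e2)) *\<^sub>R y \<in> C"
          by (rule *[OF ncone_scale[OF nC _ hi] B2])
      qed
    qed
    note bounds = this
    have "e1 * e2 / c > 0" "c / (e1 * e2) > 0" using c(1) e1(1) e2(1) by simp_all
    then have "e1 * e2 / c > 0 \<and> c / (e1 * e2) > 0 \<and>
        (\<forall>y\<in>C. G y - (e1 * e2 / c) *\<^sub>R y \<in> C \<and> (c / (e1 * e2)) *\<^sub>R y - G y \<in> C)"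
      using bounds by (intro conjI ballI) simp_all
    then show ?thesis 
      by - (rule exI[of _ "e1 * e2 / c"], rule exI[of _ "c / (e1 * e2)"])
  qed
  then obtain \<alpha> \<gamma> where ab: "\<alpha> > 0" "\<gamma> > 0" "\<And>y. y \<in> C \<Longrightarrow> G y - \<alpha> *\<^sub>R y \<in> C" "\<And>y. y \<in> C \<Longrightarrow> \<gamma> *\<^sub>R y - G y \<in> C"
    by blast
  have cG: "continuous_on C G"
    unfolding G_def \<kappa>_def using ncone_nz[OF nC \<theta>F_C] by (intro continuous_intros c\<theta>F) auto
  \<comment> \<open>\<open>\<theta>\<close> yields directions only. As it ignores both scalings, the
    norm of the first component is free to supply the radial scale, and the second scaling is used
    up by restricting to the hypersurface \<open>Z\<close>.\<close>
  define \<Theta> where "\<Theta> k = norm (P1 *v k) *\<^sub>R \<theta> k" for k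
  define Z where "Z = {k \<in> K. norm (P2 *v k) = 1}"
  have "C \<subseteq> \<Theta> ` Z"
  proof
    fix s assume "s \<in> C"
    then obtain y where y: "y \<in> C" "G y = s" using cone_map_surj[OF nC oC cG ab] by blast
    define k where "k = F y"
    have k: "k \<in> K" "norm (P1 *v k) > 0" "norm (P2 *v k) > 0" using F_K[OF y(1)] K_nz by (auto simp: k_def)
    define a b where "a = \<kappa> y / norm (P1 *v k)" and "b = 1 / norm (P2 *v k)"
    have pos: "a > 0" "b > 0" using k kpos[OF y(1)] by (auto simp: a_def b_def)
    have "S a b *v k \<in> Z" using k pos by (auto simp: Z_def S_in_K) (simp add: b_def)
    moreover have "\<Theta> (S a b *v k) = s"
      using k pos y(2) by (simp add: \<Theta>_def \<theta>_S G_def k_def) (simp add: a_def k_def)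
    ultimately show "s \<in> \<Theta> ` Z" by blast
  qed
  moreover have "negligible (\<Theta> ` Z)"
  proof (rule negligible_differentiable_image_negligible)
    show "\<Theta> differentiable_on Z"
      unfolding differentiable_on_def
    proof
      fix k assume "k \<in> Z"
      then have k: "k \<in> K" by (simp add: Z_def)
      have "\<Theta> differentiable (at k)"
        unfolding \<Theta>_def by (rule differentiable_scaleR[OF differentiable_norm_matrix[OF K_nz(1)[OF k]] d\<theta>[OF k]])
      then show "\<Theta> differentiable (at k within Z)" by (rule differentiable_at_withinI)
    qed
    \<comment> \<open>Scaling a point of \<open>Z\<close> up leaves this convex set at once, so
      \<open>Z\<close> lies on its frontier, and frontiers of convex sets are negligible.\<close>
    define B where "B = {k. norm (P2 *v k) \<le> 1}"
    have "convex B"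
    proof -
      have "B = (\<lambda>k. P2 *v k) -` cball 0 1" by (auto simp: B_def)
      then show ?thesis using convex_linear_vimage[OF matrix_vector_mul_linear convex_cball] by metis
    qed
    moreover have "Z \<subseteq> frontier B"
    proof
      fix k assume k: "k \<in> Z"
      have "k \<in> B" using k by (simp add: Z_def B_def)
      then have "k \<in> closure B" using closure_subset by blast
      moreover have "k \<notin> interior B"
      proof
        assume "k \<in> interior B"
        then obtain e where e: "e > 0" "ball k e \<subseteq> B" using mem_interior by blast
        define d where "d = e / (2 * (1 + norm k))"
        have np: "1 + norm k > 0" by (simp add: add_pos_nonneg)
        have d: "d > 0" using e(1) np by (simp add: d_def)
        have "d * norm k \<le> d * (1 + norm k)" using d by simp
        also have "\<dots> = e / 2"
        proof -
          have *: "e / (2 * p) * p = e / 2" if "p > 0" for p :: real using that by simp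
          show ?thesis unfolding d_def by (rule *[OF np])
        qed
        finally have "k + d *\<^sub>R k \<in> ball k e" using e(1) d by (simp add: dist_norm)
        then have "norm (P2 *v (k + d *\<^sub>R k)) \<le> 1" using e(2) by (auto simp: B_def)
        moreover have "P2 *v (k + d *\<^sub>R k) = (1 + d) *\<^sub>R (P2 *v k)" by (simp add: vec_distribs algebra_simps)
        ultimately show False using k d by (simp add: Z_def)
      qed
      ultimately show "k \<in> frontier B" by (simp add: frontier_def)
    qed
    ultimately show "negligible Z" using negligible_convex_frontier negligible_subset by blast
  qed simp
  ultimately have "negligible C" using negligible_subset by blast
  then show False using open_not_negligible[OF oC neC] by blast
qed

end

section \<open>Zassenhaus neighbourhoods and normal abelian subgroups\<close>

text \<open>Centralizers are taken in the full matrix algebra, where they are linear subspaces;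
  their dimension replaces chain conditions on subgroups.\<close>

definition Cent :: "(real^'m^'m) set \<Rightarrow> (real^'m^'m) set" where
  "Cent X = {B. \<forall>g\<in>X. B ** g = g ** B}"

definition comm :: "real^'m^'m \<Rightarrow> real^'m^'m \<Rightarrow> real^'m^'m" where
  "comm s w = s ** w ** matrix_inv s ** matrix_inv w"

text \<open>Iterated commutators [s1, [s2, ... [sn, s]]] with all entries in \<open>S\<close>. Their
  vanishing at some length is the form in which nilpotency is used.\<close>

fun comm_iter :: "(real^'m^'m) set \<Rightarrow> nat \<Rightarrow> (real^'m^'m) set" where
  "comm_iter S 0 = S"
| "comm_iter S (Suc n) = {comm s w | s w. s \<in> S \<and> w \<in> comm_iter S n}"

definition no_normal_abelian :: "(real^'m^'m) set \<Rightarrow> bool" where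
  "no_normal_abelian H \<longleftrightarrow> (\<forall>N. N \<subseteq> H \<and> mat 1 \<in> N \<and> (\<forall>a\<in>N. \<forall>b\<in>N. a ** b \<in> N) \<and>
     (\<forall>a\<in>N. matrix_inv a \<in> N) \<and> (\<forall>g\<in>H. \<forall>a\<in>N. g ** a ** matrix_inv g \<in> N) \<and>
     (\<forall>a\<in>N. \<forall>b\<in>N. a ** b = b ** a) \<longrightarrow> N = {mat 1})"

lemma subspace_Cent: "subspace (Cent X)"
  unfolding Cent_def subspace_def
  by (auto simp: matrix_add_ldistrib bounded_bilinear.add_left[OF bounded_bilinear_matrix_mult]
      matrix_scaleR_left matrix_scaleR_right bounded_bilinear.zero_left[OF bounded_bilinear_matrix_mult]
      bounded_bilinear.zero_right[OF bounded_bilinear_matrix_mult])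

lemma Cent_antimono: "X \<subseteq> Y \<Longrightarrow> Cent Y \<subseteq> Cent X"
  by (auto simp: Cent_def)

lemma Cent_mult: "a \<in> Cent X \<Longrightarrow> b \<in> Cent X \<Longrightarrow> a ** b \<in> Cent X"
  unfolding Cent_def by (auto simp: matrix_mul_assoc) (metis matrix_mul_assoc)

lemma Cent_inv: "a \<in> Cent X \<Longrightarrow> a ** b = mat 1 \<Longrightarrow> b ** a = mat 1 \<Longrightarrow> b \<in> Cent X"
  unfolding Cent_def
proof clarify
  fix g assume *: "\<forall>g\<in>X. a ** g = g ** a" "a ** b = mat 1" "b ** a = mat 1" "g \<in> X"
  have "b ** g = b ** (g ** a) ** b" using *(2) by (simp flip: matrix_mul_assoc)
  also have "\<dots> = b ** (a ** g) ** b" using * by simp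
  also have "\<dots> = g ** b" using *(3) by (simp add: matrix_mul_assoc)
  finally show "b ** g = g ** b" .
qed

lemma conj_commute:
  fixes X :: "real^'m^'m"
  assumes "c ** c' = mat 1" "c' ** c = mat 1" and e: "X ** (c' ** g ** c) = (c' ** g ** c) ** X"
  shows "(c ** X ** c') ** g = g ** (c ** X ** c')"
proof -
  have "(c ** X ** c') ** g = c ** X ** c' ** g ** (c ** c')" by (simp add: assms)
  also have "\<dots> = c ** (X ** (c' ** g ** c)) ** c'" by (simp add: matrix_mul_assoc)
  also have "\<dots> = (c ** c') ** g ** c ** X ** c'" unfolding e by (simp add: matrix_mul_assoc)
  also have "\<dots> = g ** (c ** X ** c')" by (simp add: assms matrix_mul_assoc)
  finally show ?thesis .
qed

text \<open>Centralizers grow as the sets shrink, and dimensions of spaces of matrices are bounded;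
  at maximal dimension nothing can be added.\<close>

lemma Cent_stable:
  assumes "\<And>i. \<G> (Suc i) \<subseteq> \<G> i"
  obtains i where "\<And>j. j \<ge> i \<Longrightarrow> Cent (\<G> j) = Cent (\<G> i)"
proof -
  have dec: "\<G> j \<subseteq> \<G> i" if "i \<le> j" for i j using lift_Suc_antimono_le[of \<G>, OF assms that] .
  have "\<exists>i. True \<and> (\<forall>j. True \<longrightarrow> dim (Cent (\<G> j)) \<le> dim (Cent (\<G> i)))"
    by (rule ex_has_greatest_nat[of _ 0 _ "Suc (DIM(real^'a^'a))"])
      (auto simp only: less_Suc_eq_le intro: dim_subset_UNIV)
  then obtain i where i: "\<And>j. dim (Cent (\<G> j)) \<le> dim (Cent (\<G> i))" by blast
  show thesis
    by (rule that[of i], rule sym, rule subspace_dim_equal)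
      (auto simp: i subspace_Cent intro: Cent_antimono[OF dec, THEN subsetD])
qed

text \<open>Take a finite subset whose centralizer has least dimension: one more element of
  \<open>X\<close> cannot shrink it, so it already commutes with all of \<open>X\<close>.\<close>

lemma Cent_finite:
  obtains S where "finite S" "S \<subseteq> X" "Cent S = Cent X"
proof -
  define P where "P n \<longleftrightarrow> (\<exists>S. finite S \<and> S \<subseteq> X \<and> dim (Cent S) = n)" for n
  have "\<exists>n. P n" unfolding P_def by (intro exI[of _ "dim (Cent {})"] exI[of _ "{}"]) auto
  then have "P (LEAST n. P n)" by (rule LeastI_ex)
  then obtain S where S: "finite S" "S \<subseteq> X" "dim (Cent S) = (LEAST n. P n)" unfolding P_def by blast
  have "Cent S \<subseteq> Cent X"
  proof (unfold Cent_def[of X], clarify)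
    fix B g assume B: "B \<in> Cent S" and g: "g \<in> X"
    have "P (dim (Cent (insert g S)))" unfolding P_def using S g by (intro exI[of _ "insert g S"]) auto
    then have "dim (Cent S) \<le> dim (Cent (insert g S))" unfolding S(3) by (rule Least_le)
    then have "Cent (insert g S) = Cent S"
      by (intro subspace_dim_equal subspace_Cent Cent_antimono) auto
    then have "B \<in> Cent (insert g S)" using B by simp
    then show "B ** g = g ** B" by (auto simp: Cent_def)
  qed
  then show thesis using S Cent_antimono[OF S(2)] by (intro that[of S]) auto
qed

context matgrp
begin

lemma comm_eq_one: assumes "s \<in> H" "w \<in> H" "comm s w = mat 1" shows "s ** w = w ** s"
proof -
  have "s ** w = comm s w ** w ** s"
    unfolding comm_def using assms by (simp add: inv_left flip: matrix_mul_assoc)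
  then show ?thesis using assms(3) by simp
qed

lemma comm_in: "s \<in> H \<Longrightarrow> w \<in> H \<Longrightarrow> comm s w \<in> H"
  unfolding comm_def by (intro mult_in inv_in)

text \<open>The longest nontrivial iterated commutator of a finite set with the same centralizer \<open>B\<close> as
  \<open>\<G> i\<close> lies in the normal abelian subgroup \<open>H \<inter> B \<inter> Cent B\<close>.\<close>

lemma nilpotent_filtration_trivial:
  assumes noab: "no_normal_abelian H"
    and dec: "\<And>i. \<G> (Suc i) \<subseteq> \<G> i" and sub: "\<And>i. \<G> i \<subseteq> H"
    and conj: "\<And>\<gamma> i. \<gamma> \<in> H \<Longrightarrow> \<exists>j. \<forall>g\<in>\<G> j. \<gamma> ** g ** matrix_inv \<gamma> \<in> \<G> i"
    and nil: "\<And>S. finite S \<Longrightarrow> S \<subseteq> \<G> 0 \<Longrightarrow> \<exists>L. comm_iter S L \<subseteq> {mat 1}"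
  shows "\<exists>i. \<G> i \<subseteq> {mat 1}"
proof -
  obtain i where i: "\<And>j. j \<ge> i \<Longrightarrow> Cent (\<G> j) = Cent (\<G> i)" using Cent_stable[of \<G>, OF dec] by blast
  have dec': "\<G> j \<subseteq> \<G> i" if "i \<le> j" for i j using lift_Suc_antimono_le[of \<G>, OF dec that] .
  \<comment> \<open>The stable centralizer is normalized by all of \<open>H\<close>: conjugation
    carries a late term of the filtration into term \<open>i\<close>, and late terms have the same
    centralizer \<open>B\<close>.\<close>
  define B where "B = Cent (\<G> i)"
  have B_conj: "\<gamma> ** X ** matrix_inv \<gamma> \<in> B" if \<gamma>: "\<gamma> \<in> H" and X: "X \<in> B" for \<gamma> X
  proof -
    obtain j where j: "\<forall>g\<in>\<G> j. matrix_inv \<gamma> ** g ** \<gamma> \<in> \<G> i"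
      using conj[OF inv_in[OF \<gamma>], of i] by (auto simp: inv_inv \<gamma>)
    have "(\<gamma> ** X ** matrix_inv \<gamma>) ** g = g ** (\<gamma> ** X ** matrix_inv \<gamma>)" if "g \<in> \<G> (max i j)" for g
    proof (rule conj_commute)
      have "matrix_inv \<gamma> ** g ** \<gamma> \<in> \<G> i" using j dec'[of j "max i j"] that by auto
      then show "X ** (matrix_inv \<gamma> ** g ** \<gamma>) = matrix_inv \<gamma> ** g ** \<gamma> ** X"
        using X by (simp add: B_def Cent_def)
    qed (simp_all add: inv_left inv_right \<gamma>)
    then have "\<gamma> ** X ** matrix_inv \<gamma> \<in> Cent (\<G> (max i j))" by (simp add: Cent_def)
    then show ?thesis using i[of "max i j"] by (simp add: B_def)
  qed
  \<comment> \<open>Members of \<open>N\<close> lie in \<open>B\<close> and in the centralizer of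
    \<open>B\<close>, so they commute with one another; normality holds because conjugation
    preserves \<open>B\<close> and therefore its centralizer.\<close>
  define N where "N = H \<inter> B \<inter> Cent B"
  have "N = {mat 1}"
  proof (rule noab[unfolded no_normal_abelian_def, rule_format], intro conjI ballI)
    show "N \<subseteq> H" by (auto simp: N_def)
    show "mat 1 \<in> N" by (auto simp: N_def one_in B_def Cent_def)
    show "a ** b \<in> N" if "a \<in> N" "b \<in> N" for a b
      using that by (auto simp: N_def B_def intro: mult_in Cent_mult)
    show "matrix_inv a \<in> N" if "a \<in> N" for a
      using that by (auto simp: N_def B_def inv_left inv_right intro: inv_in Cent_inv)
    show "a ** b = b ** a" if ab: "a \<in> N" "b \<in> N" for a b
    proof -
      have "a \<in> B" "b \<in> Cent B" using ab by (auto simp: N_def)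
      then have "b ** a = a ** b" unfolding Cent_def by blast
      then show ?thesis by (rule sym)
    qed
    show "g ** a ** matrix_inv g \<in> N" if g: "g \<in> H" and a: "a \<in> N" for g a
    proof -
      have "g ** a ** matrix_inv g \<in> Cent B"
        unfolding Cent_def
      proof clarify
        fix X assume "X \<in> B"
        then have "matrix_inv g ** X ** g \<in> B" using B_conj[OF inv_in[OF g]] by (simp add: inv_inv g)
        moreover have "a \<in> Cent B" using a by (simp add: N_def)
        ultimately have "a ** (matrix_inv g ** X ** g) = (matrix_inv g ** X ** g) ** a"
          unfolding Cent_def by blast
        then show "g ** a ** matrix_inv g ** X = X ** (g ** a ** matrix_inv g)"
          by (rule conj_commute[OF inv_right[OF g] inv_left[OF g]])
      qed
      then show ?thesis using g a B_conj by (auto simp: N_def intro!: mult_in inv_in)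
    qed
  qed
  have "\<G> i \<subseteq> {mat 1}"
  proof (rule ccontr)
    assume "\<not> \<G> i \<subseteq> {mat 1}"
    then obtain g0 where g0: "g0 \<in> \<G> i" "g0 \<noteq> mat 1" by blast
    obtain S0 where S0: "finite S0" "S0 \<subseteq> \<G> i" "Cent S0 = B" using Cent_finite[of "\<G> i"] by (auto simp: B_def)
    \<comment> \<open>\<open>g0\<close> keeps the set nontrivial, and \<open>S0\<close> forces
      anything commuting with all of \<open>S\<close> into \<open>B\<close>.\<close>
    define S where "S = insert g0 S0"
    have S: "finite S" "S \<subseteq> \<G> i" "S \<subseteq> \<G> 0" "S \<subseteq> H"
      using S0 g0 dec'[of 0 i] sub by (auto simp: S_def)
    have CS: "Cent S \<subseteq> B" using Cent_antimono[of S0 S] S0(3) by (auto simp: S_def)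
    obtain L where L: "comm_iter S L \<subseteq> {mat 1}" using nil[OF S(1,3)] by blast
    define l where "l = (LEAST L. comm_iter S L \<subseteq> {mat 1})"
    have l: "comm_iter S l \<subseteq> {mat 1}" unfolding l_def using L by (rule LeastI)
    have "l \<noteq> 0"
    proof
      assume "l = 0"
      then have "S \<subseteq> {mat 1}" using l by simp
      then show False using g0 by (auto simp: S_def)
    qed
    then obtain n where n: "l = Suc n" using not0_implies_Suc by blast
    then have "n < (LEAST L. comm_iter S L \<subseteq> {mat 1})" by (simp add: l_def)
    then have "\<not> comm_iter S n \<subseteq> {mat 1}" by (rule not_less_Least)
    then obtain w where w: "w \<in> comm_iter S n" "w \<noteq> mat 1" by blast
    have inCent: "v \<in> H \<inter> Cent B" if "v \<in> comm_iter S k" for v k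
      using that
    proof (induction k arbitrary: v)
      case 0
      then show ?case using S(2,4) by (auto simp: B_def Cent_def)
    next
      case (Suc k)
      then obtain s u where su: "s \<in> S" "u \<in> comm_iter S k" "v = comm s u" by auto
      have "s \<in> H \<inter> Cent B" using su(1) S(2,4) by (auto simp: B_def Cent_def)
      moreover have "u \<in> H \<inter> Cent B" using Suc.IH su(2) by blast
      ultimately show ?case using su(3)
        by (auto simp: comm_def inv_left inv_right intro!: mult_in inv_in Cent_mult Cent_inv[of s B "matrix_inv s"] Cent_inv[of u B "matrix_inv u"])
    qed
    have wH: "w \<in> H" "w \<in> Cent B" using inCent[OF w(1)] by auto
    have "w ** s = s ** w" if "s \<in> S" for s
    proof -
      have "comm s w = mat 1" using l n that w(1) by auto
      then show ?thesis using comm_eq_one[of s w] that S(4) wH by auto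
    qed
    then have "w \<in> B" using CS by (auto simp: Cent_def)
    then have "w \<in> N" using wH by (simp add: N_def)
    then show False using \<open>N = {mat 1}\<close> w(2) by simp
  qed
  then show ?thesis by blast
qed

end

text \<open>With \<kappa> the Frobenius norm of the identity, two requirements decide the constant:
  it is at most 1/2, which bounds inverses by 2 \<kappa>, and 8 \<kappa>^2 times it is at most 1/2,
  which makes commutators contract.\<close>

definition zassenhaus_radius :: "'m::finite itself \<Rightarrow> real" where
  "zassenhaus_radius _ = 1 / (16 * (norm (mat 1 :: real^'m^'m))\<^sup>2 + 2)"

lemma zassenhaus_radius_pos: "zassenhaus_radius TYPE('m::finite) > 0"
  by (simp add: zassenhaus_radius_def add_nonneg_pos)

text \<open>T U T' U' - 1 equals (T U - U T) T' U', and T U - U T is the commutator of T - 1 with U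
  - 1. The small norm of T - 1 therefore multiplies that of U - 1, while the inverses cost a
  constant.\<close>

lemma norm_commutator:
  fixes T :: "real^'m^'m"
  assumes T: "T ** T' = mat 1" "T' ** T = mat 1" and U: "U ** U' = mat 1" "U' ** U = mat 1"
    and nT: "norm (T - mat 1) \<le> zassenhaus_radius TYPE('m)" and nU: "norm (U - mat 1) \<le> zassenhaus_radius TYPE('m)"
  shows "norm (T ** U ** T' ** U' - mat 1) \<le> norm (U - mat 1) / 2"
proof -
  define \<delta> where "\<delta> = zassenhaus_radius TYPE('m)"
  define \<kappa> where "\<kappa> = norm (mat 1 :: real^'m^'m)"
  have \<kappa>0: "\<kappa> \<ge> 0" by (simp add: \<kappa>_def)
  have \<delta>: "\<delta> > 0" "\<delta> \<le> 1 / 2" "8 * \<kappa>\<^sup>2 * \<delta> \<le> 1 / 2"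
  proof -
    have d: "\<delta> = 1 / (16 * \<kappa>\<^sup>2 + 2)" by (simp add: \<delta>_def \<kappa>_def zassenhaus_radius_def)
    define q where "q = 16 * \<kappa>\<^sup>2 + 2"
    have q: "q \<ge> 2" "16 * \<kappa>\<^sup>2 \<le> q" "\<delta> = 1 / q" using d by (simp_all add: q_def)
    show "\<delta> > 0" "\<delta> \<le> 1 / 2" "8 * \<kappa>\<^sup>2 * \<delta> \<le> 1 / 2" unfolding q(3) using q(1,2) by (simp_all add: field_simps)
  qed
  \<comment> \<open>From V' = 1 - V' (V - 1), the norm of V' is at most \<kappa> plus half of
    itself.\<close>
  have inv_bound: "norm V' \<le> 2 * \<kappa>" if V: "V' ** V = mat 1" "norm (V - mat 1) \<le> \<delta>" for V V' :: "real^'m^'m"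
  proof -
    have "V' = mat 1 - V' ** (V - mat 1)" by (simp add: matrix_diff_ldistrib V)
    then have "norm V' \<le> \<kappa> + norm (V' ** (V - mat 1))" unfolding \<kappa>_def using norm_triangle_ineq4 by metis
    also have "norm (V' ** (V - mat 1)) \<le> norm V' * norm (V - mat 1)" by (rule norm_matrix_mult_le)
    also have "norm V' * norm (V - mat 1) \<le> norm V' * (1 / 2)" using V(2) \<delta>(2) by (intro mult_left_mono) auto
    finally show ?thesis by simp
  qed
  have "T ** U ** T' ** U' - mat 1 = (T ** U - U ** T) ** (T' ** U')"
  proof -
    have "U ** T ** (T' ** U') = U ** (T ** T') ** U'" by (simp add: matrix_mul_assoc)
    then have "U ** T ** (T' ** U') = mat 1" by (simp add: T U)
    then show ?thesis by (simp add: matrix_diff_rdistrib matrix_mul_assoc)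
  qed
  also have "T ** U - U ** T = (T - mat 1) ** (U - mat 1) - (U - mat 1) ** (T - mat 1)"
    by (simp add: matrix_diff_ldistrib matrix_diff_rdistrib)
  finally have "norm (T ** U ** T' ** U' - mat 1)
      \<le> norm ((T - mat 1) ** (U - mat 1) - (U - mat 1) ** (T - mat 1)) * norm (T' ** U')"
    using norm_matrix_mult_le by metis
  also have "\<dots> \<le> (2 * \<delta> * norm (U - mat 1)) * ((2 * \<kappa>) * (2 * \<kappa>))"
  proof (rule mult_mono)
    have "norm ((T - mat 1) ** (U - mat 1)) \<le> \<delta> * norm (U - mat 1)"
      using norm_matrix_mult_le[of "T - mat 1" "U - mat 1"] mult_right_mono[OF nT norm_ge_zero, of "U - mat 1"]
      by (simp add: \<delta>_def)
    moreover have "norm ((U - mat 1) ** (T - mat 1)) \<le> \<delta> * norm (U - mat 1)"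
      using norm_matrix_mult_le[of "U - mat 1" "T - mat 1"] mult_right_mono[OF nT norm_ge_zero, of "U - mat 1"]
      by (simp add: \<delta>_def mult.commute)
    ultimately show "norm ((T - mat 1) ** (U - mat 1) - (U - mat 1) ** (T - mat 1)) \<le> 2 * \<delta> * norm (U - mat 1)"
      using norm_triangle_ineq4[of "(T - mat 1) ** (U - mat 1)" "(U - mat 1) ** (T - mat 1)"] by linarith
    have "norm (T' ** U') \<le> norm T' * norm U'" by (rule norm_matrix_mult_le)
    also have "\<dots> \<le> (2 * \<kappa>) * (2 * \<kappa>)"
      using inv_bound[OF T(2)] inv_bound[OF U(2)] nT nU \<kappa>0 by (intro mult_mono) (auto simp: \<delta>_def)
    finally show "norm (T' ** U') \<le> (2 * \<kappa>) * (2 * \<kappa>)" .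
  qed (use \<delta> in auto)
  also have "\<dots> = (8 * \<kappa>\<^sup>2 * \<delta>) * norm (U - mat 1)" by (simp add: power2_eq_square)
  also have "\<dots> \<le> (1 / 2) * norm (U - mat 1)" using \<delta>(3) by (rule mult_right_mono) simp
  finally show ?thesis by simp
qed

definition (in matgrp) "mat_hom R \<longleftrightarrow> R (mat 1) = (mat 1 :: real^'m^'m) \<and> (\<forall>g\<in>H. \<forall>h\<in>H. R (g ** h) = R g ** R h)"

text \<open>Smallness will be measured up to a factor from \<open>Z\<close>. Such factors commute
  with each other and with the image of \<open>R\<close>, so commutators do not see them.\<close>

definition (in matgrp) central :: "(real^'m^'m \<Rightarrow> real^'m^'m) \<Rightarrow> (real^'m^'m) set \<Rightarrow> bool" where
  "central R Z \<longleftrightarrow> (\<forall>c\<in>Z. (\<exists>c'. c ** c' = mat 1 \<and> c' ** c = mat 1) \<and> (\<forall>h\<in>H. c ** R h = R h ** c) \<and>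
     (\<forall>d\<in>Z. c ** d = d ** c))"

section \<open>The Zassenhaus argument modulo central factors\<close>

context matgrp
begin

lemma mat_hom_inv: "mat_hom R \<Longrightarrow> h \<in> H \<Longrightarrow> R h ** R (matrix_inv h) = mat 1"
  "mat_hom R \<Longrightarrow> h \<in> H \<Longrightarrow> R (matrix_inv h) ** R h = mat 1"
  unfolding mat_hom_def by (metis inv_in inv_right, metis inv_in inv_left)

lemma commutator_central:
  assumes R: "mat_hom R" and Z: "central R Z" and c: "c \<in> Z" "d \<in> Z" and s: "s \<in> H" "w \<in> H"
    and c': "c ** c' = mat 1" "c' ** c = mat 1" and d': "d ** d' = mat 1" "d' ** d = mat 1"
  shows "R (comm s w) = (c ** R s) ** (d ** R w) ** (R (matrix_inv s) ** c') ** (R (matrix_inv w) ** d')"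
proof -
  have com: "c ** R h = R h ** c" "d ** R h = R h ** d" "d ** c = c ** d" if "h \<in> H" for h
    using Z c that by (auto simp: central_def)
  have com': "c' ** R h = R h ** c'" if "h \<in> H" for h
    using Cent_inv[of c "{R h}" c'] com(1)[OF that] c' by (auto simp: Cent_def)
  define W where "W = R s ** R w ** R (matrix_inv s) ** R (matrix_inv w)"
  have "(c ** R s) ** (d ** R w) ** (R (matrix_inv s) ** c') ** (R (matrix_inv w) ** d')
      = c ** (R s ** d) ** R w ** R (matrix_inv s) ** (c' ** R (matrix_inv w)) ** d'"
    by (simp add: matrix_mul_assoc)
  also have "\<dots> = c ** (d ** R s) ** R w ** R (matrix_inv s) ** (R (matrix_inv w) ** c') ** d'"
    using com com' s by (simp add: inv_in)
  also have "\<dots> = c ** d ** W ** c' ** d'" by (simp add: W_def matrix_mul_assoc)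
  also have "W = R (comm s w)" using R s by (simp add: W_def comm_def mat_hom_def mult_in inv_in)
  also have "c ** d ** R (comm s w) ** c' ** d' = c ** (d ** R (comm s w)) ** c' ** d'" by (simp add: matrix_mul_assoc)
  also have "\<dots> = c ** R (comm s w) ** d ** c' ** d'" using com(2) comm_in[OF s] by (simp add: matrix_mul_assoc)
  also have "\<dots> = R (comm s w) ** c ** d ** c' ** d'" using com(1) comm_in[OF s] by simp
  also have "\<dots> = R (comm s w) ** (d ** (c ** c')) ** d'" using com(3)[OF one_in] by (simp flip: matrix_mul_assoc)
      (simp add: matrix_mul_assoc)
  also have "\<dots> = R (comm s w)" using c' d' by (simp flip: matrix_mul_assoc)
  finally show ?thesis by simp
qed

text \<open>Each commutator with a member of \<open>S\<close> halves the distance to the identity,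
  and after the first one the factor from \<open>Z\<close> has cancelled. Long commutators thus come
  within \<epsilon> of the identity under \<open>R\<close> itself, where discreteness without
  \<open>Z\<close> is enough.\<close>

lemma small_elements_nilpotent:
  assumes R: "mat_hom R" and Z: "central R Z" "mat 1 \<in> Z"
    and disc: "\<epsilon> > 0" "\<And>h. h \<in> H \<Longrightarrow> norm (R h - mat 1) < \<epsilon> \<Longrightarrow> h = mat 1"
    and S: "S \<subseteq> H" "\<And>s. s \<in> S \<Longrightarrow> \<exists>c\<in>Z. norm (c ** R s - mat 1) \<le> zassenhaus_radius TYPE('m)"
  shows "\<exists>L. comm_iter S L \<subseteq> {mat 1}"
proof -
  define \<delta> where "\<delta> = zassenhaus_radius TYPE('m)"
  have \<delta>: "\<delta> > 0" by (simp add: \<delta>_def zassenhaus_radius_pos)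
  have *: "w \<in> H \<and> (\<exists>c\<in>Z. norm (c ** R w - mat 1) \<le> \<delta> / 2 ^ n \<and> (n > 0 \<longrightarrow> c = mat 1))"
    if "w \<in> comm_iter S n" for w n
    using that
  proof (induction n arbitrary: w)
    case 0
    then show ?case using S by (auto simp: \<delta>_def)
  next
    case (Suc n)
    then obtain s u where su: "s \<in> S" "u \<in> comm_iter S n" "w = comm s u" by auto
    obtain d where d: "u \<in> H" "d \<in> Z" "norm (d ** R u - mat 1) \<le> \<delta> / 2 ^ n" using Suc.IH[OF su(2)] by blast
    obtain c where c: "c \<in> Z" "norm (c ** R s - mat 1) \<le> \<delta>" using S(2)[OF su(1)] by (auto simp: \<delta>_def)
    have sH: "s \<in> H" using su(1) S(1) by blast
    obtain c' d' where cd: "c ** c' = mat 1" "c' ** c = mat 1" "d ** d' = mat 1" "d' ** d = mat 1"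
      using Z(1) c(1) d(2) unfolding central_def by metis
    have i1: "(x ** R h) ** (R (matrix_inv h) ** x') = mat 1" "(R (matrix_inv h) ** x') ** (x ** R h) = mat 1"
      if "h \<in> H" "x ** x' = mat 1" "x' ** x = mat 1" for h x x'
    proof -
      have "(x ** R h) ** (R (matrix_inv h) ** x') = x ** (R h ** R (matrix_inv h)) ** x'"
        by (simp add: matrix_mul_assoc)
      then show "(x ** R h) ** (R (matrix_inv h) ** x') = mat 1" using mat_hom_inv[OF R that(1)] that by simp
      have "(R (matrix_inv h) ** x') ** (x ** R h) = R (matrix_inv h) ** (x' ** x) ** R h"
        by (simp add: matrix_mul_assoc)
      then show "(R (matrix_inv h) ** x') ** (x ** R h) = mat 1" using mat_hom_inv[OF R that(1)] that by simp
    qed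
    have "\<delta> / 2 ^ n \<le> \<delta>" using \<delta> by (simp add: field_simps)
    then have "norm (R w - mat 1) \<le> norm (d ** R u - mat 1) / 2"
      unfolding su(3) commutator_central[OF R Z(1) c(1) d(2) sH d(1) cd]
      using c(2) d(3) i1[OF sH cd(1,2)] i1[OF d(1) cd(3,4)]
      by (intro norm_commutator) (auto simp: \<delta>_def)
    then have "norm (R w - mat 1) \<le> \<delta> / 2 ^ Suc n" using d(3) by simp
    then show ?case using su sH d(1) Z(2) by (auto intro!: comm_in bexI[of _ "mat 1"])
  qed
  obtain n where n: "\<delta> / \<epsilon> < 2 ^ n" using real_arch_pow[of 2 "\<delta> / \<epsilon>"] by auto
  have "\<delta> / 2 ^ Suc n < \<epsilon>"
  proof -
    have "\<delta> < \<epsilon> * 2 ^ n" using n disc(1) by (simp add: field_simps)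
    then have "\<delta> / 2 ^ n < \<epsilon>" by (simp add: field_simps)
    moreover have "\<delta> / 2 ^ Suc n \<le> \<delta> / 2 ^ n" using \<delta> by (simp add: field_simps)
    ultimately show ?thesis by linarith
  qed
  then have "comm_iter S (Suc n) \<subseteq> {mat 1}" using *[of _ "Suc n"] disc(2) by fastforce
  then show ?thesis by blast
qed

text \<open>The filtration consists of the elements within \<delta> / (i + 1) of the identity modulo
  \<open>Z\<close>; conjugation by a fixed element enlarges that distance by a bounded factor.
  Nilpotency is a hypothesis because \<open>R\<close> need not be known to be discrete: finite sets
  of small elements may be treated through a nearby representation that is.\<close>

theorem zassenhaus:
  assumes noab: "no_normal_abelian H" and R: "mat_hom R" and Z: "central R Z"
    and nil: "\<And>S. finite S \<Longrightarrow> S \<subseteq> H \<Longrightarrow> (\<And>s. s \<in> S \<Longrightarrow> \<exists>c\<in>Z. norm (c ** R s - mat 1) < zassenhaus_radius TYPE('m))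
      \<Longrightarrow> \<exists>L. comm_iter S L \<subseteq> {mat 1}"
  obtains \<epsilon> where "\<epsilon> > 0" "\<And>h c. h \<in> H \<Longrightarrow> c \<in> Z \<Longrightarrow> norm (c ** R h - mat 1) < \<epsilon> \<Longrightarrow> h = mat 1"
proof -
  define \<delta> where "\<delta> = zassenhaus_radius TYPE('m)"
  have \<delta>: "\<delta> > 0" by (simp add: \<delta>_def zassenhaus_radius_pos)
  define \<G> where "\<G> i = {h \<in> H. \<exists>c\<in>Z. norm (c ** R h - mat 1) < \<delta> / real (Suc i)}" for i
  have "\<exists>i. \<G> i \<subseteq> {mat 1}"
  proof (rule nilpotent_filtration_trivial[OF noab])
    show "\<G> (Suc i) \<subseteq> \<G> i" for i
    proof -
      have "\<delta> / real (Suc (Suc i)) \<le> \<delta> / real (Suc i)" using \<delta> by (intro divide_left_mono) auto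
      then show ?thesis unfolding \<G>_def by force
    qed
    show "\<G> i \<subseteq> H" for i by (auto simp: \<G>_def)
    show "\<exists>L. comm_iter S L \<subseteq> {mat 1}" if "finite S" "S \<subseteq> \<G> 0" for S
      by (rule nil) (use that in \<open>auto simp: \<G>_def \<delta>_def\<close>)
    fix \<gamma> i assume \<gamma>: "\<gamma> \<in> H"
    define M where "M = norm (R \<gamma>) * norm (R (matrix_inv \<gamma>))"
    have M: "M \<ge> 0" by (simp add: M_def)
    obtain j :: nat where j: "M * real (Suc i) \<le> real j" using real_arch_simple by blast
    have "\<gamma> ** g ** matrix_inv \<gamma> \<in> \<G> i" if g: "g \<in> \<G> j" for g
    proof -
      obtain c where c: "g \<in> H" "c \<in> Z" "norm (c ** R g - mat 1) < \<delta> / real (Suc j)" using g by (auto simp: \<G>_def)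
      have com: "c ** R \<gamma> = R \<gamma> ** c" using Z c \<gamma> by (auto simp: central_def)
      have "c ** R (\<gamma> ** g ** matrix_inv \<gamma>) = c ** R \<gamma> ** R g ** R (matrix_inv \<gamma>)"
        using R \<gamma> c(1) by (simp add: mat_hom_def mult_in inv_in matrix_mul_assoc)
      then have "c ** R (\<gamma> ** g ** matrix_inv \<gamma>) - mat 1 = R \<gamma> ** (c ** R g - mat 1) ** R (matrix_inv \<gamma>)"
        by (simp add: matrix_diff_ldistrib matrix_diff_rdistrib com mat_hom_inv[OF R \<gamma>] matrix_mul_assoc)
      then have "norm (c ** R (\<gamma> ** g ** matrix_inv \<gamma>) - mat 1) \<le> norm (R \<gamma> ** (c ** R g - mat 1)) * norm (R (matrix_inv \<gamma>))"
        using norm_matrix_mult_le by metis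
      also have "\<dots> \<le> (norm (R \<gamma>) * norm (c ** R g - mat 1)) * norm (R (matrix_inv \<gamma>))"
        by (intro mult_right_mono norm_matrix_mult_le) auto
      also have "\<dots> = M * norm (c ** R g - mat 1)" by (simp add: M_def)
      also have "\<dots> \<le> M * (\<delta> / real (Suc j))" using c(3) M by (intro mult_left_mono) auto
      also have "\<dots> < \<delta> / real (Suc i)"
      proof -
        have "M * real (Suc i) < real (Suc j)" using j by linarith
        then have "\<delta> * (M * real (Suc i)) < \<delta> * real (Suc j)" using \<delta> by simp
        then show ?thesis by (simp add: field_simps del: of_nat_Suc)
      qed
      finally show ?thesis using c \<gamma> by (auto simp: \<G>_def intro!: mult_in inv_in bexI[of _ c])
    qed
    then show "\<exists>j. \<forall>g\<in>\<G> j. \<gamma> ** g ** matrix_inv \<gamma> \<in> \<G> i" by blast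
  qed
  then obtain i where i: "\<G> i \<subseteq> {mat 1}" by blast
  show thesis
    by (rule that[of "\<delta> / real (Suc i)"]) (use \<delta> i in \<open>auto simp: \<G>_def simp del: of_nat_Suc\<close>)
qed

end

section \<open>Degeneration along an invariant subspace\<close>

lemma finite_separated:
  fixes f :: "'a \<Rightarrow> 'b::heine_borel"
  assumes "d > 0" and sep: "\<And>x y. x \<in> T \<Longrightarrow> y \<in> T \<Longrightarrow> dist (f x) (f y) < d \<Longrightarrow> x = y"
    and bdd: "bounded (f ` T)"
  shows "finite T"
proof -
  have *: "u = v" if uv: "u \<in> f ` T" "v \<in> f ` T" "dist u v < d" for u v
  proof -
    obtain x y where xy: "x \<in> T" "y \<in> T" "u = f x" "v = f y" using uv(1,2) by blast
    then have "x = y" using sep[OF xy(1,2)] uv(3) by simp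
    then show ?thesis using xy by simp
  qed
  have "\<forall>u\<in>f ` T. \<forall>v\<in>f ` T. dist v u < d \<longrightarrow> v = u" by (intro ballI impI) (rule *)
  with \<open>d > 0\<close> have "closed (f ` T)" by (rule discrete_imp_closed)
  then have c: "compact (f ` T)" using bdd by (simp add: compact_eq_bounded_closed)
  have "finite (f ` T)"
  proof (rule ccontr)
    assume "infinite (f ` T)"
    moreover have "\<forall>S. infinite S \<and> S \<subseteq> f ` T \<longrightarrow> (\<exists>x\<in>f ` T. x islimpt S)"
      using c by (simp only: compact_eq_Bolzano_Weierstrass)
    then have "infinite (f ` T) \<and> f ` T \<subseteq> f ` T \<longrightarrow> (\<exists>x\<in>f ` T. x islimpt f ` T)" by (rule spec)
    ultimately obtain u where u: "u \<in> f ` T" "u islimpt f ` T" by (elim impE bexE) simp_all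
    then obtain v where "v \<in> f ` T" "v \<noteq> u" "dist v u < d" using \<open>d > 0\<close> unfolding islimpt_approachable by (elim allE[of _ d] impE) auto
    then show False using *[of v u] u(1) by simp
  qed
  moreover have "inj_on f T" by (rule inj_onI) (use sep \<open>d > 0\<close> in auto)
  ultimately show ?thesis using finite_imageD by blast
qed

section \<open>Orthogonal projections, Auerbach bases and one-dimensional blocks\<close>

lemma continuous_on_det: "continuous_on X (det :: real^'m^'m \<Rightarrow> real)"
  unfolding det_def[abs_def] by (intro continuous_intros)

lemma orth_proj_exists:
  fixes V :: "(real^'m) set"
  assumes V: "subspace V"
  obtains P :: "real^'m^'m" where "\<And>x. P *v x \<in> V" "\<And>x. x \<in> V \<Longrightarrow> P *v x = x"
    "\<And>x y. y \<in> V \<Longrightarrow> (x - P *v x) \<bullet> y = 0"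
proof -
  obtain B where B: "B \<subseteq> V" "pairwise orthogonal B" "\<And>x. x \<in> B \<Longrightarrow> norm x = 1" "independent B" "span B = V"
    using orthonormal_basis_subspace[OF V] by metis
  have fB: "finite B" using B(4) independent_imp_finite by blast
  define p where "p x = (\<Sum>b\<in>B. (b \<bullet> x) *\<^sub>R b)" for x :: "real^'m"
  have lp: "linear p"
    unfolding p_def by (rule linearI) (simp_all add: inner_add_right scaleR_left_distrib sum.distrib scaleR_sum_right)
  have pV: "p x \<in> V" for x
    unfolding p_def by (intro subspace_sum V subspace_scale) (use B(1) in auto)
  have orthB: "(x - p x) \<bullet> b = 0" if b: "b \<in> B" for x b
  proof -
    have "p x \<bullet> b = (\<Sum>c\<in>B. (c \<bullet> x) * (c \<bullet> b))" by (simp add: p_def inner_sum_left)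
    also have "\<dots> = (\<Sum>c\<in>B. if c = b then b \<bullet> x else 0)"
    proof (rule sum.cong)
      fix c assume c: "c \<in> B"
      show "(c \<bullet> x) * (c \<bullet> b) = (if c = b then b \<bullet> x else 0)"
      proof (cases "c = b")
        case True
        then show ?thesis using B(3)[OF b] by (simp add: dot_square_norm)
      next
        case False
        then show ?thesis using B(2) b c by (auto simp: pairwise_def orthogonal_def)
      qed
    qed simp
    also have "\<dots> = b \<bullet> x" using fB b by simp
    finally show ?thesis by (simp add: inner_diff_left inner_commute[of x b])
  qed
  have orth: "(x - p x) \<bullet> y = 0" if "y \<in> V" for x y
  proof -
    have "orthogonal (x - p x) y"
      by (rule orthogonal_to_span[of y B]) (use that B(5) orthB in \<open>auto simp: orthogonal_def\<close>)
    then show ?thesis by (simp add: orthogonal_def)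
  qed
  have "matrix p *v x = p x" for x by (rule matrix_works[OF lp[unfolded linear_matrix_vector_mul_eq[symmetric]]])
  moreover have "p x = x" if "x \<in> V" for x
  proof -
    have "x - p x \<in> V" using that pV V by (intro subspace_diff)
    then have "(x - p x) \<bullet> (x - p x) = 0" by (rule orth)
    then show ?thesis by simp
  qed
  ultimately show thesis using pV orth by (intro that[of "matrix p"]) auto
qed

text \<open>Among the matrices with columns in \<open>B\<close>, one of maximal volume is taken. By
  Cramer's rule, replacing column k by a point of \<open>B\<close> multiplies the determinant by the
  k-th coordinate of that point, so all coordinates are at most 1 in absolute value.\<close>

lemma auerbach:
  fixes B :: "(real^'m) set"
  assumes B: "compact B" "convex B" "\<And>y. y \<in> B \<Longrightarrow> - y \<in> B" and r: "r > 0" "cball 0 r \<subseteq> B"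
  obtains A A' :: "real^'m^'m" where "A ** A' = mat 1" "A' ** A = mat 1"
    "\<And>y. y \<in> B \<Longrightarrow> norm (A *v y) \<le> CARD('m)" "\<And>z. norm z \<le> 1 / CARD('m) \<Longrightarrow> A' *v z \<in> B"
proof -
  define \<M> :: "(real^'m^'m) set" where "\<M> = {M. \<forall>i. M *v axis i 1 \<in> B}"
  obtain b where b: "\<And>y. y \<in> B \<Longrightarrow> norm y \<le> b" using compact_imp_bounded[OF B(1)] bounded_iff by metis
  have "bounded \<M>"
    unfolding bounded_iff
  proof (intro exI ballI)
    fix M assume "M \<in> \<M>"
    then have "(\<Sum>j\<in>UNIV. norm (M *v axis j 1)) \<le> (\<Sum>j\<in>(UNIV :: 'm set). b)"
      by (intro sum_mono b) (auto simp: \<M>_def)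
    then show "norm M \<le> (\<Sum>j\<in>(UNIV :: 'm set). b)" using norm_matrix_le_sum_columns[of M] by linarith
  qed
  moreover have "closed \<M>"
  proof -
    have "\<M> = (\<Inter>i. (\<lambda>M. M *v axis i 1) -` B)" by (auto simp: \<M>_def)
    moreover have "closed ((\<lambda>M :: real^'m^'m. M *v axis i 1) -` B)" for i
      by (intro closed_vimage compact_imp_closed[OF B(1)]
          bounded_linear.continuous_on[OF bounded_bilinear.bounded_linear_left[OF bounded_bilinear_matrix_vector_mult]] continuous_on_id)
    ultimately show ?thesis by auto
  qed
  ultimately have c\<M>: "compact \<M>" using compact_eq_bounded_closed by blast
  \<comment> \<open>The ball inside \<open>B\<close> supplies a competitor with nonzero determinant,
    so the maximizer is invertible.\<close>
  define R where "R = r *\<^sub>R (mat 1 :: real^'m^'m)"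
  have R: "R \<in> \<M>" using r by (auto simp: \<M>_def R_def matrix_vector_scaleR_left)
  then obtain M where M: "M \<in> \<M>" "\<And>X. X \<in> \<M> \<Longrightarrow> \<bar>det X\<bar> \<le> \<bar>det M\<bar>"
    using continuous_attains_sup[OF c\<M>, of "\<lambda>X. \<bar>det X\<bar>"] continuous_on_det by (auto intro!: continuous_intros)
  have "det R \<noteq> 0"
  proof -
    have "R ** ((1 / r) *\<^sub>R mat 1) = mat 1" using r(1) by (simp add: R_def matrix_scaleR_left matrix_scaleR_right)
    then show ?thesis by (metis det_I det_mul mult_zero_left zero_neq_one)
  qed
  then have dM: "det M \<noteq> 0" using M(2)[OF R] by auto
  then obtain A where A: "A ** M = mat 1" "M ** A = mat 1"
    by (metis invertible_det_nz invertible_def)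
  show thesis
  proof (rule that[OF A])
    fix y assume y: "y \<in> B"
    define a where "a = A *v y"
    have Ma: "M *v a = y" by (simp add: a_def matrix_vector_mul_assoc A)
    have "\<bar>a $ k\<bar> \<le> 1" for k
    proof -
      define X where "X = (\<chi> i j. if j = k then (M *v a) $ i else M $ i $ j)"
      have "X *v axis j 1 = (if j = k then y else M *v axis j 1)" for j
        by (simp add: X_def matrix_vector_mult_basis column_def vec_eq_iff Ma)
      then have "X \<in> \<M>" using M(1) y by (simp add: \<M>_def)
      then have "\<bar>det X\<bar> \<le> \<bar>det M\<bar>" by (rule M(2))
      moreover have "det X = a $ k * det M" unfolding X_def by (rule cramer_lemma)
      ultimately have "\<bar>a $ k\<bar> * \<bar>det M\<bar> \<le> 1 * \<bar>det M\<bar>" by (simp add: abs_mult)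
      then show ?thesis using dM by (simp only: mult_le_cancel_right)
    qed
    then have "(\<Sum>k\<in>UNIV. \<bar>a $ k\<bar>) \<le> (\<Sum>k\<in>(UNIV :: 'm set). 1)" by (intro sum_mono)
    then show "norm (A *v y) \<le> CARD('m)" using norm_le_l1_cart[of a] by (simp add: a_def)
  next
    fix z :: "real^'m" assume z: "norm z \<le> 1 / CARD('m)"
    have B0: "0 \<in> B" using r by auto
    \<comment> \<open>In the main case M z is \<open>w\<close> times a convex combination of
      columns, their negatives and 0, with \<open>w\<close> the l1 norm of z. The radius 1 /
      CARD('m) makes \<open>w\<close> at most 1, and 0 takes the remaining weight.\<close>
    define w where "w = (\<Sum>i\<in>UNIV. \<bar>z $ i\<bar>)"
    have "w \<le> (\<Sum>i\<in>(UNIV :: 'm set). 1 / CARD('m))"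
      unfolding w_def using component_le_norm_cart[of z] z by (intro sum_mono) (meson order_trans)
    then have w1: "w \<le> 1" by simp
    have w0: "w \<ge> 0" by (simp add: w_def sum_nonneg)
    have Mz: "M *v z = (\<Sum>i\<in>UNIV. \<bar>z $ i\<bar> *\<^sub>R (sgn (z $ i) *\<^sub>R (M *v axis i 1)))"
      by (simp add: matrix_mult_sum[of M z] matrix_vector_mult_basis scalar_mult_eq_scaleR abs_mult_sgn)
    show "M *v z \<in> B"
    proof (cases "w = 0")
      case True
      then have "z = 0" unfolding w_def by (simp add: sum_nonneg_eq_0_iff vec_eq_iff)
      then show ?thesis using B0 by simp
    next
      case False
      have sB: "sgn (z $ i) *\<^sub>R (M *v axis i 1) \<in> B" for i
        using M(1) B(3) B0 by (cases "z $ i" "0 :: real" rule: linorder_cases) (auto simp: \<M>_def)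
      have "(\<Sum>i\<in>UNIV. (\<bar>z $ i\<bar> / w) *\<^sub>R (sgn (z $ i) *\<^sub>R (M *v axis i 1))) \<in> B"
        by (rule convex_sum[OF _ B(2)]) (use False w0 sB in \<open>auto simp: w_def simp flip: sum_divide_distrib\<close>)
      then have "w *\<^sub>R (\<Sum>i\<in>UNIV. (\<bar>z $ i\<bar> / w) *\<^sub>R (sgn (z $ i) *\<^sub>R (M *v axis i 1))) + (1 - w) *\<^sub>R 0 \<in> B"
        using w0 w1 B0 by (intro convexD[OF B(2)]) auto
      then show ?thesis using False by (simp add: Mz scaleR_sum_right)
    qed
  qed
qed

text \<open>The open ray of \<open>e\<close> with trivial action: a factor that exists only to be
  scaled, which provides a parameter independent of the other factor.\<close>

lemma block_trivial:
  fixes e :: "real^'m"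
  assumes e: "e \<noteq> 0"
  obtains P K where "block H P (\<lambda>h. P) K" "\<And>x. P *v x = ((x \<bullet> e) / (e \<bullet> e)) *\<^sub>R e"
proof -
  define p where "p x = ((x \<bullet> e) / (e \<bullet> e)) *\<^sub>R e" for x
  define P where "P = matrix p"
  have lp: "linear p" unfolding p_def
    by (rule linearI) (simp_all add: inner_add_left add_divide_distrib scaleR_left_distrib)
  have P: "P *v x = ((x \<bullet> e) / (e \<bullet> e)) *\<^sub>R e" for x
    unfolding P_def matrix_works[OF lp[unfolded linear_matrix_vector_mul_eq[symmetric]]] p_def ..
  have PP: "P ** P = P" using e by (simp add: matrix_eq P flip: matrix_vector_mul_assoc)
  define K where "K = {t *\<^sub>R e | t. t > 0}"
  have "{y. P *v y \<in> K} = {y. e \<bullet> y > 0}"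
  proof -
    have ee: "e \<bullet> e > 0" using e by simp
    have "P *v y \<in> K \<longleftrightarrow> (y \<bullet> e) / (e \<bullet> e) > 0" for y
    proof -
      have "P *v y \<in> K \<longleftrightarrow> (\<exists>t>0. (y \<bullet> e) / (e \<bullet> e) = t)" using e by (auto simp: K_def P)
      then show ?thesis by blast
    qed
    then have "P *v y \<in> K \<longleftrightarrow> e \<bullet> y > 0" for y
      by (simp add: pos_less_divide_eq[OF ee] inner_commute[of y])
    then show ?thesis by simp
  qed
  then have op: "open {y. P *v y \<in> K}" by (simp add: open_halfspace_gt)
  have "ncone K"
    unfolding ncone_def
  proof (intro conjI ballI allI impI)
    show "u + w \<in> K" if "u \<in> K" "w \<in> K" for u w
      using that by (auto simp: K_def) (metis add_pos_pos scaleR_left_distrib)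
    show "a *\<^sub>R u \<in> K" if "a > 0" "u \<in> K" for a u
      using that by (auto simp: K_def)
    show "0 \<notin> K" using e by (auto simp: K_def)
    have "norm u \<le> 1 * norm (u + w)" if uw: "u \<in> K" "w \<in> K" for u w
    proof -
      obtain s t where "s > 0" "t > 0" "u = s *\<^sub>R e" "w = t *\<^sub>R e" using uw by (auto simp: K_def)
      then show ?thesis by (simp add: mult_right_mono flip: scaleR_left_distrib)
    qed
    then show "\<exists>c. \<forall>u\<in>K. \<forall>w\<in>K. norm u \<le> c * norm (u + w)" by blast
  qed
  moreover have "P *v k = k" if "k \<in> K" for k using that e by (auto simp: K_def P)
  moreover have "e \<in> K" unfolding K_def by (auto intro!: exI[of _ 1])
  ultimately have "block H P (\<lambda>h. P) K" unfolding block_def using PP op by auto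
  then show thesis using P by (rule that)
qed

fun mpow :: "real^'m^'m \<Rightarrow> nat \<Rightarrow> real^'m^'m" where
  "mpow A 0 = mat 1"
| "mpow A (Suc n) = A ** mpow A n"

text \<open>The lifted group with its hypotheses in matrix form. Finite generation appears as an
  induction rule, the shape in which convergence on generators extends to the group; the
  determinants serve to control scalar factors.\<close>

locale cone_group = matgrp H for H :: "(real^'m^'m) set" +
  fixes C :: "(real^'m) set" and gens :: "(real^'m^'m) set"
  assumes bC: "block H (mat 1) (\<lambda>h. h) C"
    and discrete_one: "\<exists>\<epsilon>>0. \<forall>h\<in>H. norm (h - mat 1) < \<epsilon> \<longrightarrow> h = mat 1"
    and det_one: "\<And>h. h \<in> H \<Longrightarrow> \<bar>det h\<bar> = 1"
    and torsion_free: "\<And>h k. h \<in> H \<Longrightarrow> k > 0 \<Longrightarrow> mpow h k = mat 1 \<Longrightarrow> h = mat 1"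
    and noab: "no_normal_abelian H"
    and gens: "finite gens" "gens \<subseteq> H"
    and gens_induct: "\<And>P h. h \<in> H \<Longrightarrow> P (mat 1) \<Longrightarrow> (\<And>s. s \<in> gens \<Longrightarrow> P s) \<Longrightarrow> (\<And>s. s \<in> gens \<Longrightarrow> P (matrix_inv s))
      \<Longrightarrow> (\<And>a b. a \<in> H \<Longrightarrow> b \<in> H \<Longrightarrow> P a \<Longrightarrow> P b \<Longrightarrow> P (a ** b)) \<Longrightarrow> P h"
begin

section \<open>Discreteness modulo scalars and blocks from a subspace off the boundary of the
  cone\<close>

lemma C_facts: "open C" "ncone C" "C \<noteq> {}" "\<And>h y. h \<in> H \<Longrightarrow> y \<in> C \<Longrightarrow> h *v y \<in> C"
  using blockD(6,7,9,10)[OF bC] by auto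

lemma closure_invariant: "h \<in> H \<Longrightarrow> y \<in> closure C \<Longrightarrow> h *v y \<in> closure C"
proof -
  assume h: "h \<in> H" and y: "y \<in> closure C"
  have "(\<lambda>y. h *v y) ` closure C \<subseteq> closure ((\<lambda>y. h *v y) ` C)"
    by (rule closure_linear_image_subset) (rule matrix_vector_mul_linear)
  also have "\<dots> \<subseteq> closure C" by (rule closure_mono) (use C_facts(4)[OF h] in auto)
  finally show ?thesis using y by blast
qed

text \<open>If two rescaled images are closer than \<epsilon> divided by a bound for the inverses,
  the quotient of the two elements is within \<epsilon> of the identity modulo \<open>Z\<close>,
  hence trivial. The images are uniformly separated in a bounded set.\<close>

lemma finite_bounded:
  assumes R: "mat_hom R" and Z: "central R Z" "\<And>c d c'. c \<in> Z \<Longrightarrow> d \<in> Z \<Longrightarrow> c ** c' = mat 1 \<Longrightarrow> c' ** c = mat 1 \<Longrightarrow> c' ** d \<in> Z"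
    and disc: "\<epsilon> > 0" "\<And>h c. h \<in> H \<Longrightarrow> c \<in> Z \<Longrightarrow> norm (c ** R h - mat 1) < \<epsilon> \<Longrightarrow> h = mat 1"
  shows "finite {h \<in> H. \<exists>c\<in>Z. \<exists>c'. c ** c' = mat 1 \<and> c' ** c = mat 1 \<and> norm (c ** R h) \<le> M \<and> norm (c' ** R (matrix_inv h)) \<le> M}"
    (is "finite ?T")
proof -
  define pr where "pr h c c' \<longleftrightarrow> c \<in> Z \<and> c ** c' = mat 1 \<and> c' ** c = mat 1 \<and> norm (c ** R h) \<le> M \<and>
      norm (c' ** R (matrix_inv h)) \<le> M" for h c c'
  have "\<forall>h\<in>?T. \<exists>c. \<exists>c'. pr h c c'" unfolding pr_def by blast
  then obtain c where "\<forall>h\<in>?T. \<exists>c'. pr h (c h) c'" by (rule bchoice[THEN exE])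
  then obtain c' where pr: "\<forall>h\<in>?T. pr h (c h) (c' h)" by (rule bchoice[THEN exE])
  have c: "c h \<in> Z" "c h ** c' h = mat 1" "c' h ** c h = mat 1" "norm (c h ** R h) \<le> M"
    "norm (c' h ** R (matrix_inv h)) \<le> M" if h: "h \<in> ?T" for h
    using pr[rule_format, OF h] by (simp_all add: pr_def)
  define N where "N = max M 1"
  show ?thesis
  proof (rule finite_separated[where f="\<lambda>h. c h ** R h" and d="\<epsilon> / N"])
    show "\<epsilon> / N > 0" using disc(1) by (simp add: N_def)
    show "bounded ((\<lambda>h. c h ** R h) ` ?T)" unfolding bounded_iff using c(4) by blast
    fix g h assume g: "g \<in> ?T" and h: "h \<in> ?T" and d: "dist (c g ** R g) (c h ** R h) < \<epsilon> / N"
    have gH: "g \<in> H" and hH: "h \<in> H" using g h by auto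
    define X where "X = c' g ** R (matrix_inv g)"
    have com: "R (matrix_inv g) ** c h = c h ** R (matrix_inv g)" "c g ** R g = R g ** c g"
      using Z(1) c(1)[OF h] c(1)[OF g] gH by (auto simp: central_def inv_in)
    have "X ** (c h ** R h) = c' g ** (R (matrix_inv g) ** c h) ** R h" by (simp add: X_def matrix_mul_assoc)
    also have "\<dots> = (c' g ** c h) ** (R (matrix_inv g) ** R h)" unfolding com by (simp add: matrix_mul_assoc)
    also have "\<dots> = (c' g ** c h) ** R (matrix_inv g ** h)" using R gH hH by (simp add: mat_hom_def inv_in)
    finally have 1: "X ** (c h ** R h) = (c' g ** c h) ** R (matrix_inv g ** h)" .
    have "X ** (c g ** R g) = c' g ** (R (matrix_inv g) ** R g) ** c g" unfolding com by (simp add: X_def matrix_mul_assoc)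
    then have 2: "X ** (c g ** R g) = mat 1" using mat_hom_inv[OF R gH] c(3)[OF g] by simp
    have "norm ((c' g ** c h) ** R (matrix_inv g ** h) - mat 1) = norm (X ** (c h ** R h - c g ** R g))"
      by (simp add: matrix_diff_ldistrib 1 2)
    also have "\<dots> \<le> norm X * norm (c h ** R h - c g ** R g)" by (rule norm_matrix_mult_le)
    also have "\<dots> \<le> N * norm (c h ** R h - c g ** R g)"
      using c(5)[OF g] by (intro mult_right_mono) (auto simp: X_def N_def)
    also have "\<dots> < \<epsilon>" using d by (simp add: dist_norm norm_minus_commute N_def field_simps)
    finally have "matrix_inv g ** h = mat 1"
      using disc(2) Z(2)[OF c(1)[OF g] c(1)[OF h] c(2,3)[OF g]] gH hH by (meson mult_in inv_in)
    then have "g ** (matrix_inv g ** h) = g" by simp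
    then show "g = h" using gH by (simp add: matrix_mul_assoc inv_right)
  qed
qed

text \<open>The determinant of a h has absolute value \<open>a\<close> to the power CARD('m), so a
  bound on a h bounds \<open>a\<close>, and the bound on the inverse bounds 1 / a. The scalar can
  then be dropped at the cost of a constant.\<close>

lemma discrete_C: "finite {h \<in> H. \<exists>a>0. norm (a *\<^sub>R h) \<le> R \<and> norm ((1 / a) *\<^sub>R matrix_inv h) \<le> R}"
proof -
  obtain \<epsilon> where e: "\<epsilon> > 0" "\<And>h. h \<in> H \<Longrightarrow> norm (h - mat 1) < \<epsilon> \<Longrightarrow> h = mat 1" using discrete_one by blast
  have fin: "finite {h \<in> H. \<exists>c\<in>{mat 1}. \<exists>c'. c ** c' = mat 1 \<and> c' ** c = mat 1 \<and> norm (c ** h) \<le> M \<and> norm (c' ** matrix_inv h) \<le> M}" for M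
    by (rule finite_bounded[of "\<lambda>h. h" "{mat 1}" \<epsilon>]) (use e in \<open>auto simp: mat_hom_def central_def\<close>)
  have "compact (det ` cball (0 :: real^'m^'m) R)" by (intro compact_continuous_image continuous_on_det) auto
  then obtain D where D: "\<And>M :: real^'m^'m. norm M \<le> R \<Longrightarrow> \<bar>det M\<bar> \<le> D"
    using compact_imp_bounded bounded_iff by (metis imageI mem_cball_0 real_norm_def)
  define D' where "D' = max 1 D"
  have a_bound: "a \<le> D'" if "a > 0" "h \<in> H" "norm (a *\<^sub>R h) \<le> R" for a h
  proof -
    have "(\<chi> i. a *s h $ i) = a *\<^sub>R h" by (simp add: vec_eq_iff)
    then have dh: "\<bar>det (a *\<^sub>R h)\<bar> = a ^ CARD('m)"
      using det_rows_mul[of "\<lambda>i. a" "\<lambda>i. h $ i"] that(1) det_one[OF that(2)] by (simp add: abs_mult)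
    have "a ^ CARD('m) \<le> D" using D[OF that(3)] dh by simp
    show ?thesis
    proof (cases "a \<ge> 1")
      case True
      then have "a ^ 1 \<le> a ^ CARD('m)" by (intro power_increasing) auto
      then show ?thesis using \<open>a ^ CARD('m) \<le> D\<close> by (simp add: D'_def)
    qed (simp add: D'_def)
  qed
  have "{h \<in> H. \<exists>a>0. norm (a *\<^sub>R h) \<le> R \<and> norm ((1 / a) *\<^sub>R matrix_inv h) \<le> R}
      \<subseteq> {h \<in> H. \<exists>c\<in>{mat 1}. \<exists>c'. c ** c' = mat 1 \<and> c' ** c = mat 1 \<and> norm (c ** h) \<le> R * D' \<and> norm (c' ** matrix_inv h) \<le> R * D'}"
  proof clarify
    fix h a assume h: "h \<in> H" and a: "a > 0" "norm (a *\<^sub>R h) \<le> R" "norm ((1 / a) *\<^sub>R matrix_inv h) \<le> R"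
    have "a \<le> D'" "1 / a \<le> D'" using a_bound[OF a(1) h a(2)] a_bound[OF _ inv_in[OF h] a(3)] a(1) by auto
    have R0: "R \<ge> 0" using a(2) norm_ge_zero order_trans by blast
    have "norm h = (1 / a) * norm (a *\<^sub>R h)" using a(1) by simp
    also have "\<dots> \<le> D' * R" using \<open>1 / a \<le> D'\<close> a R0 by (intro mult_mono) (auto simp: D'_def)
    finally have 1: "norm h \<le> R * D'" by (simp add: mult.commute)
    have "norm (matrix_inv h) = a * norm ((1 / a) *\<^sub>R matrix_inv h)" using a(1) by simp
    also have "\<dots> \<le> D' * R" using \<open>a \<le> D'\<close> a R0 by (intro mult_mono) (auto simp: D'_def)
    finally have 2: "norm (matrix_inv h) \<le> R * D'" by (simp add: mult.commute)
    show "\<exists>c\<in>{mat 1}. \<exists>c'. c ** c' = mat 1 \<and> c' ** c = mat 1 \<and> norm (c ** h) \<le> R * D' \<and> norm (c' ** matrix_inv h) \<le> R * D'"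
      using 1 2 by auto
  qed
  then show ?thesis using fin finite_subset by blast
qed

text \<open>The order unit argument of \<open>block_bound\<close> at a single interior point, in a
  form linear in \<open>R\<close>: a matrix preserving the cone is no larger than its value at
  \<open>q\<close>, up to a constant.\<close>

lemma orbit_bound:
  assumes q: "q \<in> C"
  obtains M where "M \<ge> 0" "\<forall>h\<in>H. \<forall>a>0. \<forall>R. norm (a *\<^sub>R (h *v q)) \<le> R \<longrightarrow> norm (a *\<^sub>R h) \<le> M * R"
proof -
  obtain d where d: "d > 0" "cball q d \<subseteq> C" using C_facts(1) q open_contains_cball by blast
  obtain c where c: "c > 0" "\<And>u w. u \<in> C \<Longrightarrow> w \<in> C \<Longrightarrow> norm u \<le> c * norm (u + w)"
    using ncone_normal[OF C_facts(2)] by metis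
  have "norm (a *\<^sub>R h) \<le> (CARD('m) * ((2 * c + 1) / d)) * R" if h: "h \<in> H" "a > 0" and R: "norm (a *\<^sub>R (h *v q)) \<le> R" for h a R
  proof -
    define g where "g = a *\<^sub>R h"
    have gC: "g *v y \<in> C" if "y \<in> C" for y
      using h that C_facts by (simp add: g_def matrix_vector_scaleR_left ncone_scale)
    have gq: "norm (g *v q) \<le> R" using R by (simp add: g_def matrix_vector_scaleR_left)
    have "norm (g *v u) \<le> (2 * c + 1) * R" if u: "norm u \<le> d" for u
    proof -
      have "q + u \<in> C" "q - u \<in> C" using d(2) u by (auto simp: dist_norm subset_iff)
      then have "norm (g *v (q + u)) \<le> c * norm (g *v (q + u) + g *v (q - u))" by (intro c(2) gC)
      also have "g *v (q + u) + g *v (q - u) = 2 *\<^sub>R (g *v q)"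
        by (simp add: matrix_vector_right_distrib matrix_vector_mult_diff_distrib scaleR_2)
      also have "c * norm (2 *\<^sub>R (g *v q)) \<le> c * (2 * R)" using gq c(1) by (intro mult_left_mono) auto
      finally have "norm (g *v q + g *v u) \<le> 2 * c * R" by (simp add: matrix_vector_right_distrib)
      then show ?thesis using norm_triangle_ineq4[of "g *v q + g *v u" "g *v q"] gq by (simp add: algebra_simps)
    qed
    from norm_matrix_le_of_ball[OF d(1) this] show ?thesis by (simp add: g_def)
  qed
  then show thesis using c(1) d(1) by (intro that[of "CARD('m) * ((2 * c + 1) / d)"]) simp_all
qed

text \<open>If the subspace meets the open cone, the second block is a line with trivial action.\<close>

lemma model_meets:
  assumes V: "subspace V" "V \<noteq> UNIV" "\<And>h v. h \<in> H \<Longrightarrow> v \<in> V \<Longrightarrow> h *v v \<in> V" and q: "q \<in> V \<inter> C"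
  shows "\<exists>P1 P2 s1 s2 K1 K2. model H P1 P2 s1 s2 K1 K2"
proof -
  obtain P where P: "\<And>x. P *v x \<in> V" "\<And>x. x \<in> V \<Longrightarrow> P *v x = x" "\<And>x y. y \<in> V \<Longrightarrow> (x - P *v x) \<bullet> y = 0"
    using orth_proj_exists[OF V(1)] by metis
  obtain x where "x \<notin> V" using V(2) by blast
  define e where "e = x - P *v x"
  have e: "e \<noteq> 0" "\<And>y. y \<in> V \<Longrightarrow> e \<bullet> y = 0" using \<open>x \<notin> V\<close> P(1)[of x] P(3) by (auto simp: e_def)
  obtain P1 K1 where b1: "block H P1 (\<lambda>h. P1) K1" and P1: "\<And>x. P1 *v x = ((x \<bullet> e) / (e \<bullet> e)) *\<^sub>R e"
    using block_trivial[OF e(1), of H] by metis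
  have hP: "P ** (h ** P) = h ** P" if "h \<in> H" for h
    using P V(3)[OF that] by (simp add: matrix_eq flip: matrix_vector_mul_assoc)
  have PP: "P ** P = P" using P by (simp add: matrix_eq flip: matrix_vector_mul_assoc)
  have b2: "block H P (\<lambda>h. h ** P) (C \<inter> V)"
    unfolding block_def
  proof (intro conjI ballI)
    show "P ** P = P" by (rule PP)
    show "(g ** h) ** P = (g ** P) ** (h ** P)" if "h \<in> H" for g h
      using hP[OF that] by (metis matrix_mul_assoc)
    show "P ** (h ** P) = h ** P" if "h \<in> H" for h by (rule hP[OF that])
    show "(h ** P) ** P = h ** P" for h using PP by (metis matrix_mul_assoc)
    have "{y. P *v y \<in> C \<inter> V} = (\<lambda>y. P *v y) -` C" using P(1) by auto
    then show "open {y. P *v y \<in> C \<inter> V}"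
      using open_vimage[OF C_facts(1) linear_continuous_on[OF matrix_vector_mul_bounded_linear]] by simp
    show "C \<inter> V \<noteq> {}" using q by blast
    obtain c where "\<And>u w. u \<in> C \<Longrightarrow> w \<in> C \<Longrightarrow> norm u \<le> c * norm (u + w)"
      using ncone_normal[OF C_facts(2)] by metis
    then show "ncone (C \<inter> V)"
      using C_facts(2) V(1) unfolding ncone_def by (auto intro: subspace_add subspace_scale)
    show "(h ** P) *v k \<in> C \<inter> V" if "h \<in> H" "k \<in> C \<inter> V" for h k
      using that P(2) V(3) C_facts(4) by (simp flip: matrix_vector_mul_assoc)
  qed (use P in auto)
  have qC: "q \<in> C" using q by blast
  obtain M where M0: "M \<ge> 0" "\<forall>h\<in>H. \<forall>a>0. \<forall>R. norm (a *\<^sub>R (h *v q)) \<le> R \<longrightarrow> norm (a *\<^sub>R h) \<le> M * R"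
    by (rule orbit_bound[OF qC])
  then have M: "\<And>h a R. h \<in> H \<Longrightarrow> a > 0 \<Longrightarrow> norm (a *\<^sub>R (h *v q)) \<le> R \<Longrightarrow> norm (a *\<^sub>R h) \<le> M * R" by blast
  \<comment> \<open>Since \<open>q\<close> lies in the subspace, h P and h agree at
    \<open>q\<close>, so the restricted block controls the whole matrix.\<close>
  have bd: "norm (a *\<^sub>R h) \<le> M * (R * norm q)" if "h \<in> H" "a > 0" "norm (a *\<^sub>R (h ** P)) \<le> R" for a h R
  proof (rule M[OF that(1,2)])
    have "a *\<^sub>R (h *v q) = (a *\<^sub>R (h ** P)) *v q"
      using P(2)[of q] q by (simp add: matrix_vector_scaleR_left flip: matrix_vector_mul_assoc)
    also have "norm \<dots> \<le> norm (a *\<^sub>R (h ** P)) * norm q" by (rule norm_matrix_vector_mult_le)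
    also have "\<dots> \<le> R * norm q" using that(3) by (rule mult_right_mono) simp
    finally show "norm (a *\<^sub>R (h *v q)) \<le> R * norm q" .
  qed
  have "model H P1 P (\<lambda>h. P1) (\<lambda>h. h ** P) K1 (C \<inter> V)"
  proof
    show "block H P1 (\<lambda>h. P1) K1" by (rule b1)
    show "block H P (\<lambda>h. h ** P) (C \<inter> V)" by (rule b2)
    show "P1 ** P = 0" by (simp add: matrix_eq P1 inner_commute[of "P *v _" e] e(2)[OF P(1)] flip: matrix_vector_mul_assoc)
    have "P *v e = 0"
    proof -
      have "(P *v e) \<bullet> (P *v e) = 0" using P(3)[of "P *v e" e] e(2)[of "P *v e"] P(1) by (simp add: inner_diff_left)
      then show ?thesis by simp
    qed
    then show "P ** P1 = 0" by (simp add: matrix_eq P1 matrix_vector_mult_scaleR flip: matrix_vector_mul_assoc)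
    fix R
    have "{h \<in> H. \<exists>a>0. \<exists>b>0. norm (a *\<^sub>R P1) \<le> R \<and> norm (b *\<^sub>R (h ** P)) \<le> R \<and>
       norm ((1 / a) *\<^sub>R P1) \<le> R \<and> norm ((1 / b) *\<^sub>R (matrix_inv h ** P)) \<le> R}
       \<subseteq> {h \<in> H. \<exists>a>0. norm (a *\<^sub>R h) \<le> M * (R * norm q) \<and> norm ((1 / a) *\<^sub>R matrix_inv h) \<le> M * (R * norm q)}"
      using bd inv_in by (smt (verit) Collect_mono_iff zero_less_divide_1_iff)
    then show "finite {h \<in> H. \<exists>a>0. \<exists>b>0. norm (a *\<^sub>R P1) \<le> R \<and> norm (b *\<^sub>R (h ** P)) \<le> R \<and>
       norm ((1 / a) *\<^sub>R P1) \<le> R \<and> norm ((1 / b) *\<^sub>R (matrix_inv h ** P)) \<le> R}"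
      using discrete_C finite_subset by blast
  qed
  then show ?thesis by blast
qed

text \<open>The quotient by \<open>V\<close> is carried by the range of 1 - P, and invariance of
  \<open>V\<close> makes it multiplicative. The preimage of the projected cone is V + C, hence open,
  and disjointness from \<open>V\<close> keeps 0 out. Normality is assumed because a projection of a
  sharp cone need not be sharp.\<close>

lemma block_quotient:
  fixes P :: "real^'m^'m"
  assumes V: "\<And>h v. h \<in> H \<Longrightarrow> v \<in> V \<Longrightarrow> h *v v \<in> V"
    and P: "\<And>x. P *v x \<in> V" "\<And>x. x \<in> V \<Longrightarrow> P *v x = x"
    and disj: "V \<inter> C = {}"
    and norm: "\<And>u w. u \<in> C \<Longrightarrow> w \<in> C \<Longrightarrow> norm (u - P *v u) \<le> c * norm ((u + w) - P *v (u + w))"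
  shows "block H (mat 1 - P) (\<lambda>h. (mat 1 - P) ** h) ((\<lambda>y. (mat 1 - P) *v y) ` C)"
proof -
  define Q where "Q = mat 1 - P"
  have Q: "Q *v x = x - P *v x" for x by (simp add: Q_def matrix_vector_mult_diff_rdistrib)
  have QV: "Q *v x = 0 \<longleftrightarrow> x \<in> V" for x using P(1)[of x] P(2)[of x] by (auto simp: Q)
  have QQ: "Q *v (Q *v x) = Q *v x" for x by (simp add: Q P matrix_vector_mult_diff_distrib)
  have Qh: "Q *v (h *v (Q *v x)) = Q *v (h *v x)" if "h \<in> H" for h x
  proof -
    have "Q *v (h *v (P *v x)) = 0" using V[OF that P(1)] QV by blast
    then show ?thesis by (simp add: Q[of x] matrix_vector_mult_diff_distrib)
  qed
  define K1 where "K1 = (\<lambda>y. Q *v y) ` C"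
  have b1: "block H Q (\<lambda>h. Q ** h) K1"
    unfolding block_def
  proof (intro conjI ballI)
    show "Q ** Q = Q" using QQ by (simp add: matrix_eq flip: matrix_vector_mul_assoc)
    show "Q ** (g ** h) = (Q ** g) ** (Q ** h)" if "g \<in> H" "h \<in> H" for g h
      using Qh[OF that(1)] by (simp add: matrix_eq flip: matrix_vector_mul_assoc)
    show "Q ** (Q ** h) = Q ** h" for h using QQ by (simp add: matrix_eq flip: matrix_vector_mul_assoc)
    show "(Q ** h) ** Q = Q ** h" if "h \<in> H" for h
      using Qh[OF that] by (simp add: matrix_eq flip: matrix_vector_mul_assoc)
    have "{y. Q *v y \<in> K1} = (\<Union>v\<in>V. (+) v ` C)"
    proof (intro Set.set_eqI iffI)
      fix y assume "y \<in> {y. Q *v y \<in> K1}"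
      then obtain c where c: "c \<in> C" "Q *v y = Q *v c" by (auto simp: K1_def)
      then have "y - c \<in> V" using QV[of "y - c"] by (simp add: matrix_vector_mult_diff_distrib)
      then show "y \<in> (\<Union>v\<in>V. (+) v ` C)" using c(1) by (intro UN_I[of "y - c"]) (auto intro!: image_eqI[of _ _ c])
    next
      fix y assume "y \<in> (\<Union>v\<in>V. (+) v ` C)"
      then obtain v c where "v \<in> V" "c \<in> C" "y = v + c" by blast
      then show "y \<in> {y. Q *v y \<in> K1}" using QV[of v] by (auto simp: K1_def matrix_vector_right_distrib)
    qed
    then show "open {y. Q *v y \<in> K1}" using C_facts(1) by (auto intro: open_translation)
    show "K1 \<noteq> {}" using C_facts(3) by (simp add: K1_def)
    show "Q *v y = y" if "y \<in> K1" for y using that QQ by (auto simp: K1_def)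
    show "(Q ** h) *v y \<in> K1" if "h \<in> H" "y \<in> K1" for h y
      using that Qh[OF that(1)] C_facts(4) by (auto simp: K1_def simp flip: matrix_vector_mul_assoc)
    show "ncone K1"
      unfolding ncone_def
    proof (intro conjI ballI allI impI)
      show "u + w \<in> K1" if "u \<in> K1" "w \<in> K1" for u w
        using that ncone_add[OF C_facts(2)] by (auto simp: K1_def simp flip: matrix_vector_right_distrib)
      show "a *\<^sub>R u \<in> K1" if "a > 0" "u \<in> K1" for a u
        using that ncone_scale[OF C_facts(2)] by (auto simp: K1_def simp flip: matrix_vector_mult_scaleR)
      show "0 \<notin> K1"
      proof
        assume "0 \<in> K1"
        then obtain y where "y \<in> C" "Q *v y = 0" by (auto simp: K1_def)
        then show False using QV disj by auto
      qed
      have "norm u \<le> c * norm (u + w)" if uw: "u \<in> K1" "w \<in> K1" for u w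
      proof -
        obtain x y where xy: "x \<in> C" "y \<in> C" "u = Q *v x" "w = Q *v y" using uw by (auto simp: K1_def)
        then show ?thesis using norm[OF xy(1,2)] by (simp flip: Q matrix_vector_right_distrib)
      qed
      then show "\<exists>c. \<forall>u\<in>K1. \<forall>w\<in>K1. norm u \<le> c * norm (u + w)" by blast
    qed
  qed simp
  then show ?thesis by (simp add: Q_def K1_def)
qed

text \<open>If the subspace meets the closed cone only in \<open>0\<close>, the first block is the quotient by it.\<close>

lemma model_disjoint:
  assumes V: "subspace V" "V \<noteq> {0}" "\<And>h v. h \<in> H \<Longrightarrow> v \<in> V \<Longrightarrow> h *v v \<in> V" and disj: "V \<inter> closure C \<subseteq> {0}"
  shows "\<exists>P1 P2 s1 s2 K1 K2. model H P1 P2 s1 s2 K1 K2"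
proof -
  obtain P where P: "\<And>x. P *v x \<in> V" "\<And>x. x \<in> V \<Longrightarrow> P *v x = x" "\<And>x y. y \<in> V \<Longrightarrow> (x - P *v x) \<bullet> y = 0"
    using orth_proj_exists[OF V(1)] by metis
  define Q where "Q = mat 1 - P"
  have Q: "Q *v x = x - P *v x" for x by (simp add: Q_def matrix_vector_mult_diff_rdistrib)
  have QV: "Q *v x = 0 \<longleftrightarrow> x \<in> V" for x using P(1)[of x] P(2)[of x] by (auto simp: Q)
  have QQ: "Q *v (Q *v x) = Q *v x" for x by (simp add: Q P matrix_vector_mult_diff_distrib)
  have Qh: "Q *v (h *v (Q *v x)) = Q *v (h *v x)" if "h \<in> H" for h x
  proof -
    have "Q *v (h *v (P *v x)) = 0" using V(3)[OF that P(1)] QV by blast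
    then show ?thesis by (simp add: Q[of x] matrix_vector_mult_diff_distrib)
  qed
  have V0: "0 \<in> V" using V(1) by (rule subspace_0)
  then obtain e where e: "e \<in> V" "e \<noteq> 0" using V(2) by blast
  obtain P2 K2 where b2: "block H P2 (\<lambda>h. P2) K2" and P2: "\<And>x. P2 *v x = ((x \<bullet> e) / (e \<bullet> e)) *\<^sub>R e"
    using block_trivial[OF e(2), of H] by metis
  \<comment> \<open>The unit vectors of the closed cone form a compact set avoiding
    \<open>V\<close>, so the projection is bounded below on the cone. This makes the projected cone
    sharp and lets the quotient block control the matrix.\<close>
  obtain k where k: "k > 0" "\<And>y. y \<in> closure C \<Longrightarrow> norm y \<le> k * norm (Q *v y)"
  proof -
    define S where "S = closure C \<inter> sphere 0 1"
    have cS: "compact S" unfolding S_def by (intro closed_Int_compact) auto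
    have "\<exists>m>0. \<forall>y\<in>S. m \<le> norm (Q *v y)"
    proof (cases "S = {}")
      case True
      then show ?thesis by (intro exI[of _ 1]) auto
    next
      case False
      have "continuous_on S (\<lambda>y. norm (Q *v y))"
        by (intro continuous_intros linear_continuous_on matrix_vector_mul_bounded_linear)
      then obtain y0 where y0: "y0 \<in> S" "\<And>y. y \<in> S \<Longrightarrow> norm (Q *v y0) \<le> norm (Q *v y)"
        using continuous_attains_inf[OF cS False] by metis
      have "y0 \<notin> V" using y0(1) disj by (auto simp: S_def)
      then show ?thesis using y0(2) QV by (intro exI[of _ "norm (Q *v y0)"]) auto
    qed
    then obtain m where m: "m > 0" "\<And>y. y \<in> S \<Longrightarrow> m \<le> norm (Q *v y)" by blast
    have "norm y \<le> (1 / m) * norm (Q *v y)" if y: "y \<in> closure C" for y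
    proof (cases "y = 0")
      case False
      have "(1 / norm y) *\<^sub>R y \<in> S" unfolding S_def using closure_cone(3)[OF C_facts(2) _ y, of "1 / norm y"] False by simp
      from m(2)[OF this] have "m \<le> norm (Q *v y) / norm y" by (simp add: matrix_vector_mult_scaleR)
      then show ?thesis using m(1) False by (simp add: field_simps)
    qed simp
    then show thesis using m(1) by (intro that[of "1 / m"]) auto
  qed
  define K1 where "K1 = (\<lambda>y. Q *v y) ` C"
  obtain c where c: "c > 0" "\<And>u w. u \<in> C \<Longrightarrow> w \<in> C \<Longrightarrow> norm u \<le> c * norm (u + w)"
    using ncone_normal[OF C_facts(2)] by metis
  have b1: "block H Q (\<lambda>h. Q ** h) K1"
    unfolding Q_def K1_def
  proof (rule block_quotient[OF V(3) P(1,2)])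
    show "V \<inter> C = {}" using disj ncone_nz[OF C_facts(2)] closure_subset by blast
    show "norm (x - P *v x) \<le> (norm Q * c * k) * norm ((x + y) - P *v (x + y))" if xy: "x \<in> C" "y \<in> C" for x y
    proof -
      have "norm (Q *v x) \<le> norm Q * norm x" by (rule norm_matrix_vector_mult_le)
      also have "\<dots> \<le> norm Q * (c * norm (x + y))" using c(2)[OF xy(1,2)] by (intro mult_left_mono) auto
      also have "\<dots> \<le> norm Q * (c * (k * norm (Q *v (x + y))))"
        using k(2)[of "x + y"] ncone_add[OF C_facts(2) xy(1,2)] closure_subset c(1)
        by (intro mult_left_mono) auto
      finally show ?thesis by (simp add: Q mult.assoc)
    qed
  qed
  obtain q where q: "q \<in> C" using C_facts(3) by blast
  obtain M where M0: "M \<ge> 0" "\<forall>h\<in>H. \<forall>a>0. \<forall>R. norm (a *\<^sub>R (h *v q)) \<le> R \<longrightarrow> norm (a *\<^sub>R h) \<le> M * R"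
    by (rule orbit_bound[OF q])
  then have M: "\<And>h a R. h \<in> H \<Longrightarrow> a > 0 \<Longrightarrow> norm (a *\<^sub>R (h *v q)) \<le> R \<Longrightarrow> norm (a *\<^sub>R h) \<le> M * R" by blast
  have bd: "norm (a *\<^sub>R h) \<le> M * (k * (R * norm q))" if "h \<in> H" "a > 0" "norm (a *\<^sub>R (Q ** h)) \<le> R" for a h R
  proof (rule M[OF that(1,2)])
    have "a *\<^sub>R (h *v q) \<in> closure C"
      using C_facts(4)[OF that(1) q] that(2) ncone_scale[OF C_facts(2)] closure_subset by blast
    then have "norm (a *\<^sub>R (h *v q)) \<le> k * norm (Q *v (a *\<^sub>R (h *v q)))" by (rule k(2))
    also have "Q *v (a *\<^sub>R (h *v q)) = (a *\<^sub>R (Q ** h)) *v q"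
      by (simp add: matrix_vector_scaleR_left matrix_vector_mult_scaleR flip: matrix_vector_mul_assoc)
    also have "k * norm \<dots> \<le> k * (R * norm q)"
      using norm_matrix_vector_mult_le[of "a *\<^sub>R (Q ** h)" q] mult_right_mono[OF that(3), of "norm q"] k(1)
      by (intro mult_left_mono) auto
    finally show "norm (a *\<^sub>R (h *v q)) \<le> k * (R * norm q)" .
  qed
  have "model H Q P2 (\<lambda>h. Q ** h) (\<lambda>h. P2) K1 K2"
  proof
    show "block H Q (\<lambda>h. Q ** h) K1" by (rule b1)
    show "block H P2 (\<lambda>h. P2) K2" by (rule b2)
    have "Q *v e = 0" using QV e(1) by blast
    then show "Q ** P2 = 0" by (simp add: matrix_eq P2 matrix_vector_mult_scaleR flip: matrix_vector_mul_assoc)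
    show "P2 ** Q = 0" using P(3)[OF e(1)] by (simp add: matrix_eq P2 Q flip: matrix_vector_mul_assoc)
    fix R
    have "{h \<in> H. \<exists>a>0. \<exists>b>0. norm (a *\<^sub>R (Q ** h)) \<le> R \<and> norm (b *\<^sub>R P2) \<le> R \<and>
       norm ((1 / a) *\<^sub>R (Q ** matrix_inv h)) \<le> R \<and> norm ((1 / b) *\<^sub>R P2) \<le> R}
       \<subseteq> {h \<in> H. \<exists>a>0. norm (a *\<^sub>R h) \<le> M * (k * (R * norm q)) \<and> norm ((1 / a) *\<^sub>R matrix_inv h) \<le> M * (k * (R * norm q))}"
      using bd inv_in by (smt (verit) Collect_mono_iff zero_less_divide_1_iff)
    then show "finite {h \<in> H. \<exists>a>0. \<exists>b>0. norm (a *\<^sub>R (Q ** h)) \<le> R \<and> norm (b *\<^sub>R P2) \<le> R \<and>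
       norm ((1 / a) *\<^sub>R (Q ** matrix_inv h)) \<le> R \<and> norm ((1 / b) *\<^sub>R P2) \<le> R}"
      using discrete_C finite_subset by blast
  qed
  then show ?thesis by blast
qed

end

section \<open>Subsequences, powers and scalings for the limit argument\<close>

lemma common_convergent_subseq:
  fixes \<F> :: "(nat \<Rightarrow> 'a::heine_borel) set"
  assumes "finite \<F>" "\<And>f. f \<in> \<F> \<Longrightarrow> bounded (range f)"
  shows "\<exists>r. strict_mono r \<and> (\<forall>f\<in>\<F>. convergent (f \<circ> r))"
  using assms
proof (induction \<F> rule: finite_induct)
  case empty
  show ?case by (intro exI[of _ id]) (simp add: strict_mono_def)
next
  case (insert f \<F>)
  have "\<exists>r. strict_mono r \<and> (\<forall>g\<in>\<F>. convergent (g \<circ> r))"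
    by (rule insert.IH, rule insert.prems) simp
  then obtain r where r: "strict_mono r" "\<forall>g\<in>\<F>. convergent (g \<circ> r)" by blast
  have "bounded (range (f \<circ> r))" using insert.prems[of f] bounded_subset by (metis image_comp image_mono insertI1 subset_UNIV)
  then obtain l r' where r': "strict_mono r'" "((f \<circ> r) \<circ> r') \<longlonglongrightarrow> l" using bounded_imp_convergent_subsequence by blast
  have "convergent (g \<circ> (r \<circ> r'))" if "g \<in> insert f \<F>" for g
  proof (cases "g = f")
    case True
    then show ?thesis using r'(2) by (auto simp: o_assoc convergent_def)
  next
    case False
    then have "convergent (g \<circ> r)" using that r(2) by auto
    then show ?thesis using convergent_subseq_convergent[OF _ r'(1)] by (simp add: o_assoc)
  qed
  then show ?case using strict_mono_o[OF r(1) r'(1)] by blast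
qed

context matgrp
begin

lemma mpow_in: "h \<in> H \<Longrightarrow> mpow h n \<in> H"
  by (induction n) (auto intro: one_in mult_in)

lemma mpow_add: "mpow h (m + n) = mpow h m ** mpow h n"
  by (induction m) (auto simp: matrix_mul_assoc)

lemma mpow_hom: "mat_hom R \<Longrightarrow> h \<in> H \<Longrightarrow> R h = mat 1 \<Longrightarrow> R (mpow h n) = mat 1"
  by (induction n) (auto simp: mat_hom_def mpow_in)

lemma finite_mpow:
  assumes h: "h \<in> H" and f: "finite T" "\<And>n. mpow h n \<in> T"
  shows "\<exists>k>0. mpow h k = mat 1"
proof -
  have "\<not> inj (mpow h)"
  proof
    assume "inj (mpow h)"
    then have "infinite (range (mpow h))" by (rule range_inj_infinite)
    moreover have "range (mpow h) \<subseteq> T" using f(2) by blast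
    ultimately show False using f(1) finite_subset by blast
  qed
  then obtain i j where "mpow h i = mpow h j" "i \<noteq> j" unfolding inj_def by blast
  then obtain i j where ij: "mpow h i = mpow h j" "i < j" by (metis linorder_neqE_nat)
  have "mpow h i ** mpow h (j - i) = mpow h i" using ij mpow_add[of h i "j - i"] by simp
  then have "matrix_inv (mpow h i) ** (mpow h i ** mpow h (j - i)) = matrix_inv (mpow h i) ** mpow h i" by simp
  then have "mpow h (j - i) = mat 1" by (simp add: matrix_mul_assoc inv_left mpow_in h)
  then show ?thesis using ij(2) by (intro exI[of _ "j - i"]) simp
qed

end

context premodel
begin

lemma mat_hom_\<sigma>: "mat_hom \<sigma>"
  by (simp add: mat_hom_def \<sigma>_mult)

definition "scalings = {S a b | a b. a > 0 \<and> b > 0}"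

lemma S_inv: "a > 0 \<Longrightarrow> b > 0 \<Longrightarrow> S a b ** S (1 / a) (1 / b) = mat 1" "a > 0 \<Longrightarrow> b > 0 \<Longrightarrow> S (1 / a) (1 / b) ** S a b = mat 1"
  by (simp_all add: matrix_eq S_S flip: matrix_vector_mul_assoc)

lemma S_mult: "S a b ** S c d = S (a * c) (b * d)"
  by (simp add: matrix_eq S_S flip: matrix_vector_mul_assoc)

lemma central_scalings: "central \<sigma> scalings"
  unfolding central_def
proof (intro ballI conjI)
  fix c assume c: "c \<in> scalings"
  show "\<exists>c'. c ** c' = mat 1 \<and> c' ** c = mat 1" using c S_inv unfolding scalings_def by blast
  show "c ** \<sigma> h = \<sigma> h ** c" if "h \<in> H" for h
    using c S_\<sigma>[OF that] by (auto simp: scalings_def matrix_eq simp flip: matrix_vector_mul_assoc)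
  show "c ** d = d ** c" if "d \<in> scalings" for d
    using c that by (auto simp: scalings_def S_mult mult.commute)
qed

lemma scalings_inv_mult:
  assumes "c \<in> scalings" "d \<in> scalings" "c ** c' = mat 1" "c' ** c = mat 1" shows "c' ** d \<in> scalings"
proof -
  obtain a b where ab: "a > 0" "b > 0" "c = S a b" using assms(1) by (auto simp: scalings_def)
  have "c' = c' ** (c ** S (1 / a) (1 / b))" using S_inv(1)[OF ab(1,2)] ab(3) by simp
  also have "\<dots> = S (1 / a) (1 / b)" by (simp add: matrix_mul_assoc assms(4))
  finally have "c' = S (1 / a) (1 / b)" .
  moreover obtain e f where ef: "e > 0" "f > 0" "d = S e f" using assms(2) by (auto simp: scalings_def)
  ultimately have "c' ** d = S (1 / a * e) (1 / b * f)" by (simp add: S_mult)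
  moreover have "1 / a * e > 0" "1 / b * f > 0" using ab ef by simp_all
  ultimately show ?thesis unfolding scalings_def by blast
qed

end

context cone_group
begin

text \<open>Properness for a pair of blocks, from discreteness modulo scalings: Zassenhaus is applied to \<open>\<sigma>\<close>,
  whose kernel is finite, hence trivial.\<close>

lemma model_if_finite:
  assumes pm: "premodel H P1 P2 s1 s2 K1 K2"
    and fin: "\<And>M. finite {h \<in> H. norm (premodel.\<sigma> P1 P2 s1 s2 h) \<le> M \<and>
      norm (premodel.\<sigma> P1 P2 s1 s2 (matrix_inv h)) \<le> M}"
  shows "model H P1 P2 s1 s2 K1 K2"
proof -
  interpret pm: premodel H P1 P2 s1 s2 K1 K2 by (rule pm)
  let ?\<sigma> = "pm.\<sigma>"
  note hom = pm.mat_hom_\<sigma>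
  define \<kappa> where "\<kappa> = norm (mat 1 :: real^'m^'m)"
  define T where "T = {h \<in> H. norm (?\<sigma> h) \<le> 2 * \<kappa> + 1 \<and> norm (?\<sigma> (matrix_inv h)) \<le> 2 * \<kappa> + 1}"
  have fT: "finite T" unfolding T_def by (rule fin)
  have \<kappa>0: "\<kappa> \<ge> 0" by (simp add: \<kappa>_def)
  have near: "h \<in> T" if h: "h \<in> H" and n: "norm (?\<sigma> h - mat 1) \<le> 1 / 2" for h
  proof -
    have "norm (?\<sigma> h) \<le> \<kappa> + 1 / 2" using norm_triangle_ineq[of "mat 1" "?\<sigma> h - mat 1"] n by (simp add: \<kappa>_def)
    moreover have "norm (?\<sigma> (matrix_inv h)) \<le> 2 * \<kappa>"
    proof -
      let ?V = "?\<sigma> (matrix_inv h)"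
      have "?V = mat 1 - ?V ** (?\<sigma> h - mat 1)" by (simp add: matrix_diff_ldistrib mat_hom_inv[OF hom h])
      then have "norm ?V \<le> \<kappa> + norm (?V ** (?\<sigma> h - mat 1))" unfolding \<kappa>_def using norm_triangle_ineq4 by metis
      also have "norm (?V ** (?\<sigma> h - mat 1)) \<le> norm ?V * norm (?\<sigma> h - mat 1)" by (rule norm_matrix_mult_le)
      also have "\<dots> \<le> norm ?V * (1 / 2)" using n by (intro mult_left_mono) auto
      finally show ?thesis by simp
    qed
    ultimately show ?thesis using h \<kappa>0 by (simp add: T_def)
  qed
  have ker: "h = mat 1" if h: "h \<in> H" and e: "?\<sigma> h = mat 1" for h
  proof -
    have "mpow h n \<in> T" for n
      by (rule near[OF mpow_in[OF h]]) (simp add: mpow_hom[OF hom h e])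
    then obtain k where "k > 0" "mpow h k = mat 1" using finite_mpow[OF h fT] by blast
    then show ?thesis using torsion_free[OF h] by blast
  qed
  define \<epsilon> where "\<epsilon> = Min (insert (1 / 2) ((\<lambda>h. norm (?\<sigma> h - mat 1)) ` (T - {mat 1})))"
  have "\<epsilon> > 0"
  proof -
    have "norm (?\<sigma> h - mat 1) > 0" if "h \<in> T - {mat 1}" for h
      using ker[of h] that by (auto simp: T_def)
    then show ?thesis unfolding \<epsilon>_def using fT by (subst Min_gr_iff) auto
  qed
  have small: "h = mat 1" if h: "h \<in> H" and n: "norm (?\<sigma> h - mat 1) < \<epsilon>" for h
  proof (rule ccontr)
    assume "h \<noteq> mat 1"
    have "\<epsilon> \<le> 1 / 2" unfolding \<epsilon>_def using fT by (intro Min_le) auto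
    then have "h \<in> T - {mat 1}" using near[OF h] n \<open>h \<noteq> mat 1\<close> by auto
    then have "\<epsilon> \<le> norm (?\<sigma> h - mat 1)" unfolding \<epsilon>_def using fT by (intro Min_le) auto
    then show False using n by simp
  qed
  have one: "mat 1 \<in> pm.scalings" unfolding pm.scalings_def by (auto intro!: exI[of _ 1])
  \<comment> \<open>Two stages: \<open>fin\<close> makes \<open>\<sigma>\<close> discrete on its
    own, so elements small modulo scalings have vanishing long commutators; the Zassenhaus argument
    then yields discreteness modulo scalings.\<close>
  obtain \<epsilon>' where e': "\<epsilon>' > 0" "\<And>h c. h \<in> H \<Longrightarrow> c \<in> pm.scalings \<Longrightarrow> norm (c ** ?\<sigma> h - mat 1) < \<epsilon>' \<Longrightarrow> h = mat 1"
  proof (rule zassenhaus[OF noab hom pm.central_scalings])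
    show "\<exists>L. comm_iter S L \<subseteq> {mat 1}" if "S \<subseteq> H"
      "\<And>s. s \<in> S \<Longrightarrow> \<exists>c\<in>pm.scalings. norm (c ** ?\<sigma> s - mat 1) < zassenhaus_radius TYPE('m)" for S
      by (rule small_elements_nilpotent[OF hom pm.central_scalings one \<open>\<epsilon> > 0\<close> small that(1)])
        (use that(2) in \<open>force intro: less_imp_le\<close>)+
  qed (rule that)
  show ?thesis
  proof (intro model.intro pm model_axioms.intro)
    fix R
    define M where "M = R + R + norm (mat 1 - P1 - P2)"
    have "{h \<in> H. \<exists>a>0. \<exists>b>0. norm (a *\<^sub>R s1 h) \<le> R \<and> norm (b *\<^sub>R s2 h) \<le> R \<and>
       norm ((1 / a) *\<^sub>R s1 (matrix_inv h)) \<le> R \<and> norm ((1 / b) *\<^sub>R s2 (matrix_inv h)) \<le> R}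
      \<subseteq> {h \<in> H. \<exists>c\<in>pm.scalings. \<exists>c'. c ** c' = mat 1 \<and> c' ** c = mat 1 \<and> norm (c ** ?\<sigma> h) \<le> M \<and> norm (c' ** ?\<sigma> (matrix_inv h)) \<le> M}"
    proof clarify
      fix h a b assume h: "h \<in> H" and ab: "0 < a" "0 < b"
        and n: "norm (a *\<^sub>R s1 h) \<le> R" "norm (b *\<^sub>R s2 h) \<le> R"
        "norm ((1 / a) *\<^sub>R s1 (matrix_inv h)) \<le> R" "norm ((1 / b) *\<^sub>R s2 (matrix_inv h)) \<le> R"
      have bd: "norm (pm.S a b ** ?\<sigma> h) \<le> M"
        if "h \<in> H" "norm (a *\<^sub>R s1 h) \<le> R" "norm (b *\<^sub>R s2 h) \<le> R" for a b h
        unfolding pm.S_\<sigma>_eq[OF that(1)] M_def using that(2,3) by (intro norm_triangle_mono) auto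
      show "\<exists>c\<in>pm.scalings. \<exists>c'. c ** c' = mat 1 \<and> c' ** c = mat 1 \<and> norm (c ** ?\<sigma> h) \<le> M \<and> norm (c' ** ?\<sigma> (matrix_inv h)) \<le> M"
      proof (intro bexI[of _ "pm.S a b"] exI[of _ "pm.S (1 / a) (1 / b)"] conjI)
        show "pm.S a b \<in> pm.scalings" using ab by (auto simp: pm.scalings_def)
      qed (use ab n h bd inv_in pm.S_inv in auto)
    qed
    moreover have "finite {h \<in> H. \<exists>c\<in>pm.scalings. \<exists>c'. c ** c' = mat 1 \<and> c' ** c = mat 1 \<and>
        norm (c ** ?\<sigma> h) \<le> M \<and> norm (c' ** ?\<sigma> (matrix_inv h)) \<le> M}"
      by (rule finite_bounded[OF hom pm.central_scalings pm.scalings_inv_mult e'])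
    ultimately show "finite {h \<in> H. \<exists>a>0. \<exists>b>0. norm (a *\<^sub>R s1 h) \<le> R \<and> norm (b *\<^sub>R s2 h) \<le> R \<and>
       norm ((1 / a) *\<^sub>R s1 (matrix_inv h)) \<le> R \<and> norm ((1 / b) *\<^sub>R s2 (matrix_inv h)) \<le> R}"
      by (rule finite_subset)
  qed
qed

text \<open>The cone is the interior of V \<inter> closure C relative to V. For its invariance the
  ball is shrunk according to the norm of the inverse matrix; 0 is excluded because the closed cone
  contains no line.\<close>

lemma block_subspace_cone:
  fixes P :: "real^'m^'m"
  assumes V: "subspace V" "V \<noteq> {0}" "\<And>h v. h \<in> H \<Longrightarrow> v \<in> V \<Longrightarrow> h *v v \<in> V"
    and v: "v \<in> V" "d > 0" "\<And>u. u \<in> V \<Longrightarrow> norm u \<le> d \<Longrightarrow> v + u \<in> closure C"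
    and P: "\<And>x. P *v x \<in> V" "\<And>x. x \<in> V \<Longrightarrow> P *v x = x"
  shows "block H P (\<lambda>h. h ** P) {u \<in> V. \<exists>d>0. \<forall>w\<in>V. norm w \<le> d \<longrightarrow> u + w \<in> closure C}"
    (is "block H P _ ?K")
proof -
  have hP: "P ** (h ** P) = h ** P" if "h \<in> H" for h
    using P V(3)[OF that] by (simp add: matrix_eq flip: matrix_vector_mul_assoc)
  have PP: "P ** P = P" using P by (simp add: matrix_eq flip: matrix_vector_mul_assoc)
  have Kcl: "u \<in> closure C" if "u \<in> ?K" for u
    using that subspace_0[OF V(1)] by force
  note cl = closure_cone[OF C_facts(2)]
  show ?thesis
    unfolding block_def
  proof (intro conjI ballI)
    show "P ** P = P" by (rule PP)
    show "(g ** h) ** P = (g ** P) ** (h ** P)" if "h \<in> H" for g h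
      using hP[OF that] by (metis matrix_mul_assoc)
    show "P ** (h ** P) = h ** P" if "h \<in> H" for h by (rule hP[OF that])
    show "(h ** P) ** P = h ** P" for h using PP by (metis matrix_mul_assoc)
    show "?K \<noteq> {}" using v by auto
    show "open {y. P *v y \<in> ?K}"
      unfolding open_contains_ball
    proof
      fix y assume "y \<in> {y. P *v y \<in> ?K}"
      then obtain d where d: "d > 0" "\<And>w. w \<in> V \<Longrightarrow> norm w \<le> d \<Longrightarrow> P *v y + w \<in> closure C" by auto
      define e where "e = d / (2 * (1 + norm P))"
      have p1: "1 + norm P > 0" by (simp add: add_pos_nonneg)
      have e: "e > 0" using d(1) p1 by (simp add: e_def)
      have Pe: "norm P * e \<le> d / 2"
      proof -
        have "norm P * e \<le> (1 + norm P) * e" using e by (intro mult_right_mono) auto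
        also have "\<dots> = d / 2" unfolding e_def using p1 by (metis (no_types, opaque_lifting) less_irrefl
            mult.commute mult_divide_mult_cancel_left_if mult.right_neutral times_divide_eq_left times_divide_eq_right)
        finally show ?thesis .
      qed
      have "P *v z \<in> ?K" if z: "z \<in> ball y e" for z
      proof -
        have "norm (P *v (z - y)) \<le> norm P * norm (z - y)" by (rule norm_matrix_vector_mult_le)
        also have "\<dots> \<le> norm P * e" using z by (intro mult_left_mono) (auto simp: dist_norm norm_minus_commute)
        finally have n: "norm (P *v (z - y)) \<le> d / 2" using Pe by linarith
        have "P *v z + w \<in> closure C" if w: "w \<in> V" "norm w \<le> d / 2" for w
        proof -
          have "P *v y + (P *v (z - y) + w) \<in> closure C"
            using n w norm_triangle_ineq[of "P *v (z - y)" w] P(1) V(1) by (intro d(2)) (auto intro: subspace_add)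
          then show ?thesis by (simp add: matrix_vector_mult_diff_distrib)
        qed
        then show ?thesis using P(1) d(1) by (auto intro!: exI[of _ "d / 2"])
      qed
      then show "\<exists>e>0. ball y e \<subseteq> {y. P *v y \<in> ?K}" using e by blast
    qed
    show "P *v k = k" if "k \<in> ?K" for k using that P by simp
    show "(h ** P) *v u \<in> ?K" if h: "h \<in> H" and u: "u \<in> ?K" for h u
    proof -
      obtain d where d: "d > 0" "\<And>w. w \<in> V \<Longrightarrow> norm w \<le> d \<Longrightarrow> u + w \<in> closure C" using u by auto
      let ?i = "matrix_inv h"
      define e where "e = d / (1 + norm ?i)"
      have p1: "1 + norm ?i > 0" by (simp add: add_pos_nonneg)
      have e: "e > 0" using d(1) p1 by (simp add: e_def)
      have "h *v u + w \<in> closure C" if w: "w \<in> V" "norm w \<le> e" for w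
      proof -
        have "norm (?i *v w) \<le> norm ?i * norm w" by (rule norm_matrix_vector_mult_le)
        also have "\<dots> \<le> (1 + norm ?i) * e" using w p1 by (intro mult_mono) auto
        also have "\<dots> = d" using p1 by (simp add: e_def)
        finally have "u + ?i *v w \<in> closure C" using w V(3)[OF inv_in[OF h]] by (intro d(2)) auto
        then have "h *v (u + ?i *v w) \<in> closure C" by (rule closure_invariant[OF h])
        then show ?thesis by (simp add: matrix_vector_right_distrib inv_act h)
      qed
      then have "h *v u \<in> ?K" using u V(3)[OF h] e by auto
      moreover have "(h ** P) *v u = h *v u" using u P by (simp flip: matrix_vector_mul_assoc)
      ultimately show ?thesis by simp
    qed
    obtain c where c: "c > 0" "\<And>u w. u \<in> closure C \<Longrightarrow> w \<in> closure C \<Longrightarrow> norm u \<le> c * norm (u + w)"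
      using closure_normal[OF C_facts(2)] by metis
    show "ncone ?K"
      unfolding ncone_def
    proof (intro conjI ballI allI impI)
      show "u + w \<in> ?K" if uw: "u \<in> ?K" "w \<in> ?K" for u w
      proof -
        obtain d where d: "d > 0" "\<And>x. x \<in> V \<Longrightarrow> norm x \<le> d \<Longrightarrow> u + x \<in> closure C" using uw by auto
        have "u + w + x \<in> closure C" if "x \<in> V" "norm x \<le> d" for x
        proof -
          have "(u + x) + w \<in> closure C" by (rule cl(2)[OF d(2)[OF that] Kcl[OF uw(2)]])
          then show ?thesis by (simp add: algebra_simps)
        qed
        then show ?thesis using uw V(1) d(1) by (auto intro: subspace_add)
      qed
      show "a *\<^sub>R u \<in> ?K" if a: "a > 0" and u: "u \<in> ?K" for a u
      proof -
        obtain d where d: "d > 0" "\<And>x. x \<in> V \<Longrightarrow> norm x \<le> d \<Longrightarrow> u + x \<in> closure C" using u by auto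
        have "a *\<^sub>R u + x \<in> closure C" if "x \<in> V" "norm x \<le> a * d" for x
        proof -
          have "norm ((1 / a) *\<^sub>R x) \<le> d" using that(2) a by (simp add: field_simps)
          then have "a *\<^sub>R (u + (1 / a) *\<^sub>R x) \<in> closure C"
            using a that(1) V(1) by (intro cl(3) d(2)) (auto intro: subspace_scale)
          then show ?thesis using a by (simp add: scaleR_right_distrib)
        qed
        moreover have "a * d > 0" using a d(1) by simp
        ultimately show ?thesis using u V(1) by (auto intro: subspace_scale)
      qed
      show "0 \<notin> ?K"
      proof
        assume "0 \<in> ?K"
        then obtain d where d: "d > 0" "\<And>x. x \<in> V \<Longrightarrow> norm x \<le> d \<Longrightarrow> x \<in> closure C" by auto
        obtain e where e: "e \<in> V" "e \<noteq> 0" using V(1,2) subspace_0 by blast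
        define x where "x = (d / norm e) *\<^sub>R e"
        have x: "x \<in> V" "- x \<in> V" "norm x = d" using e V(1) d(1) by (auto simp: x_def intro: subspace_scale subspace_neg)
        then have "norm x \<le> c * norm (x + - x)" by (intro c(2) d(2)) auto
        then show False using x d(1) by simp
      qed
      have "norm u \<le> c * norm (u + w)" if "u \<in> ?K" "w \<in> ?K" for u w
        by (intro c(2) Kcl that)
      then show "\<exists>c. \<forall>u\<in>?K. \<forall>w\<in>?K. norm u \<le> c * norm (u + w)" by blast
    qed
  qed simp
qed

text \<open>If the subspace touches the cone only at the boundary, move \<open>x\<close> to \<open>x + t v\<close> with \<open>v\<close> in the
  relative interior of the face, renormalize by a basis adapted to the order unit norm of \<open>x + t v\<close>
  (Benzecri), and pass to the limit. The displacement of \<open>x + t v\<close> stays bounded, so the conjugated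
  representations converge; Zassenhaus makes the limit discrete and faithful.\<close>

lemma model_tangent:
  assumes V: "subspace V" "V \<noteq> {0}" "\<And>h v. h \<in> H \<Longrightarrow> v \<in> V \<Longrightarrow> h *v v \<in> V" and VC: "V \<inter> C = {}"
    and v: "v \<in> V" "d > 0" "\<And>u. u \<in> V \<Longrightarrow> norm u \<le> d \<Longrightarrow> v + u \<in> closure C"
  shows "\<exists>P1 P2 s1 s2 K1 K2. model H P1 P2 s1 s2 K1 K2"
proof -
  define N where "N = real CARD('m)"
  have N1: "N \<ge> 1" by (simp add: N_def Suc_leI)
  note cl = closure_cone[OF C_facts(2)] and C_cl = closure_subset[of C]
  obtain x where x: "x \<in> C" using C_facts(3) by blast
  have vcl: "v \<in> closure C" using v(3)[of 0] V(1) v(2) by (simp add: subspace_0)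
  define t where "t k = real (Suc k)" for k
  have t: "t k > 0" "t k \<ge> 1" for k by (simp_all add: t_def)
  define X where "X k = x + t k *\<^sub>R v" for k
  have XC: "X k \<in> C" for k
    unfolding X_def using t[of k] vcl by (intro add_closure_in_cone[OF C_facts(2,1) x] cl(3)) auto
  \<comment> \<open>Ball of radius \<open>l\<close> in the order unit norm of \<open>X k\<close>.
    The matrix \<open>A k\<close> below places the unit ball between the Euclidean balls of radius 1
    / N and N, so the two norms agree up to constants independent of \<open>k\<close>.\<close>
  define B where "B k l = {y. l *\<^sub>R X k - y \<in> closure C \<and> l *\<^sub>R X k + y \<in> closure C}" for k l
  have B_mono: "y \<in> B k m" if "y \<in> B k l" "l \<le> m" for y k l m
  proof -
    have "(m - l) *\<^sub>R X k \<in> closure C" using that(2) XC C_cl by (intro cl(3)) auto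
    then have "(m - l) *\<^sub>R X k + (l *\<^sub>R X k - y) \<in> closure C" "(m - l) *\<^sub>R X k + (l *\<^sub>R X k + y) \<in> closure C"
      using that(1) by (auto simp: B_def intro: cl(2))
    then show ?thesis by (simp add: B_def algebra_simps)
  qed
  have B_scale: "a *\<^sub>R y \<in> B k (a * l)" if "y \<in> B k l" "a \<ge> 0" for y k l a
  proof -
    have "a *\<^sub>R (l *\<^sub>R X k - y) \<in> closure C" "a *\<^sub>R (l *\<^sub>R X k + y) \<in> closure C"
      using that by (auto simp: B_def intro: cl(3))
    then show ?thesis by (simp add: B_def algebra_simps)
  qed
  obtain c where c: "c > 0" "\<And>u w. u \<in> closure C \<Longrightarrow> w \<in> closure C \<Longrightarrow> norm u \<le> c * norm (u + w)"
    using closure_normal[OF C_facts(2)] by metis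
  have "\<exists>A A' :: real^'m^'m. A ** A' = mat 1 \<and> A' ** A = mat 1 \<and> (\<forall>y\<in>B k 1. norm (A *v y) \<le> N) \<and>
      (\<forall>z. norm z \<le> 1 / N \<longrightarrow> A' *v z \<in> B k 1)" for k
  proof -
    obtain r where r: "r > 0" "cball (X k) r \<subseteq> C" using C_facts(1) XC open_contains_cball by blast
    have eq: "B k 1 = {y. X k - y \<in> closure C} \<inter> {y. X k + y \<in> closure C}" by (auto simp: B_def)
    have "closed (B k 1)"
      unfolding eq by (intro closed_Int closed_vimage[of "closure C", unfolded vimage_def] closed_closure continuous_intros)
    moreover have "bounded (B k 1)"
      unfolding bounded_iff
    proof (intro exI ballI)
      fix y assume y: "y \<in> B k 1"
      then have "norm (X k + y) \<le> c * norm ((X k + y) + (X k - y))" by (intro c(2)) (auto simp: B_def)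
      then have "norm (X k + y) \<le> c * norm (2 *\<^sub>R X k)" by (simp add: scaleR_2)
      then show "norm y \<le> c * norm (2 *\<^sub>R X k) + norm (X k)"
        using norm_triangle_ineq4[of "X k + y" "X k"] by simp
    qed
    moreover have "convex (B k 1)"
    proof (rule convexI)
      fix y z a b assume yz: "y \<in> B k 1" "z \<in> B k 1" and ab: "0 \<le> a" "0 \<le> b" "a + b = (1::real)"
      have "a *\<^sub>R (X k - y) + b *\<^sub>R (X k - z) \<in> closure C" "a *\<^sub>R (X k + y) + b *\<^sub>R (X k + z) \<in> closure C"
        using yz ab by (auto simp: B_def intro!: cl(2,3))
      moreover have "a *\<^sub>R (X k - y) + b *\<^sub>R (X k - z) = (a + b) *\<^sub>R X k - (a *\<^sub>R y + b *\<^sub>R z)"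
        "a *\<^sub>R (X k + y) + b *\<^sub>R (X k + z) = (a + b) *\<^sub>R X k + (a *\<^sub>R y + b *\<^sub>R z)" by (simp_all add: algebra_simps)
      ultimately show "a *\<^sub>R y + b *\<^sub>R z \<in> B k 1" using ab(3) by (simp add: B_def)
    qed
    moreover have "cball 0 r \<subseteq> B k 1"
    proof
      fix y :: "real^'m" assume "y \<in> cball 0 r"
      then have "X k - y \<in> C" "X k + y \<in> C" using r(2) by (auto simp: dist_norm subset_iff)
      then show "y \<in> B k 1" using C_cl by (auto simp: B_def)
    qed
    moreover have "- y \<in> B k 1" if "y \<in> B k 1" for y using that by (auto simp: B_def)
    ultimately obtain A A' :: "real^'m^'m" where "A ** A' = mat 1" "A' ** A = mat 1"
      "\<And>y. y \<in> B k 1 \<Longrightarrow> norm (A *v y) \<le> CARD('m)" "\<And>z. norm z \<le> 1 / CARD('m) \<Longrightarrow> A' *v z \<in> B k 1"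
      using auerbach[of "B k 1" r] r(1) compact_eq_bounded_closed by (metis (no_types, lifting))
    then show ?thesis unfolding N_def by blast
  qed
  then obtain A A' :: "nat \<Rightarrow> real^'m^'m" where AA: "\<And>k. A k ** A' k = mat 1" "\<And>k. A' k ** A k = mat 1"
    and A1: "\<And>k y. y \<in> B k 1 \<Longrightarrow> norm (A k *v y) \<le> N" and A1': "\<And>k z. norm z \<le> 1 / N \<Longrightarrow> A' k *v z \<in> B k 1"
    by metis
  have A'A: "A' k *v (A k *v y) = y" and AA': "A k *v (A' k *v y) = y" for k y
    by (simp_all add: matrix_vector_mul_assoc AA)
  have A2: "norm (A k *v y) \<le> N * l" if "y \<in> B k l" "l > 0" for k y l
  proof -
    have "(1 / l) *\<^sub>R y \<in> B k 1" using B_scale[OF that(1), of "1 / l"] that(2) by simp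
    then have "norm (A k *v ((1 / l) *\<^sub>R y)) \<le> N" by (rule A1)
    then show ?thesis using that(2) by (simp add: matrix_vector_mult_scaleR field_simps)
  qed
  have A2': "y \<in> B k l" if "norm (A k *v y) \<le> l / N" "l > 0" for k y l
  proof -
    have "norm ((1 / l) *\<^sub>R (A k *v y)) \<le> 1 / N" using that N1 by (simp add: field_simps)
    then have "A' k *v ((1 / l) *\<^sub>R (A k *v y)) \<in> B k 1" by (rule A1')
    then have "l *\<^sub>R (A' k *v ((1 / l) *\<^sub>R (A k *v y))) \<in> B k (l * 1)" using that(2) by (intro B_scale) auto
    then show ?thesis using that(2) by (simp add: matrix_vector_mult_scaleR A'A)
  qed
  \<comment> \<open>Order unit norms are monotone on the cone, and \<open>A k\<close> distorts them
    by at most N on either side, so the normality constant does not depend on \<open>k\<close> and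
    passes to the limit. The slack \<open>e\<close> covers norm 0, as \<open>A2'\<close> wants a
    positive radius.\<close>
  have normal: "norm (A k *v u) \<le> N * N * norm (A k *v (u + w))" if u: "u \<in> closure C" "w \<in> closure C" for k u w
  proof (rule field_le_epsilon)
    fix e :: real assume e: "e > 0"
    define l where "l = N * norm (A k *v (u + w)) + e / N"
    have l: "l > 0" using e N1 by (simp add: l_def add_nonneg_pos)
    have "norm (A k *v (u + w)) \<le> l / N" using e N1 by (simp add: l_def field_simps)
    then have "u + w \<in> B k l" using l by (rule A2')
    then have "l *\<^sub>R X k - (u + w) \<in> closure C" by (simp add: B_def)
    then have "(l *\<^sub>R X k - (u + w)) + w \<in> closure C" using u(2) by (rule cl(2))
    moreover have "(l *\<^sub>R X k - (u + w)) + w = l *\<^sub>R X k - u" by simp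
    moreover have "l *\<^sub>R X k + u \<in> closure C" using l u(1) XC C_cl by (auto intro!: cl(2) cl(3))
    ultimately have "u \<in> B k l" by (simp only: B_def mem_Collect_eq)
    then have "norm (A k *v u) \<le> N * l" using l by (rule A2)
    also have "N * l = N * N * norm (A k *v (u + w)) + e" using N1 by (simp add: l_def algebra_simps)
    finally show "norm (A k *v u) \<le> N * N * norm (A k *v (u + w)) + e" .
  qed
  have op_bound: "norm (A k ** M ** A' j) \<le> N * (N * m / (1 / N))"
    if "\<And>y. y \<in> B j 1 \<Longrightarrow> M *v y \<in> B k m" "m > 0" for k j M m
    unfolding N_def
  proof (rule norm_matrix_le_of_ball)
    fix u :: "real^'m" assume "norm u \<le> 1 / CARD('m)"
    then have "M *v (A' j *v u) \<in> B k m" using A1' that(1) by (simp add: N_def)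
    then have "norm (A k *v (M *v (A' j *v u))) \<le> N * m" using that(2) by (rule A2)
    then show "norm ((A k ** M ** A' j) *v u) \<le> CARD('m) * m" by (simp add: N_def matrix_vector_mul_assoc matrix_mul_assoc)
  qed simp
  \<comment> \<open>Displacement alone bounds the conjugates: if h X is at most m X in the cone
    order, then \<open>h\<close> maps the unit ball of \<open>X k\<close> into the ball of radius
    \<open>m\<close>.\<close>
  have conj_bound: "norm (A k ** h ** A' k) \<le> N * (N * m / (1 / N))"
    if h: "h \<in> H" and m: "m > 0" "m *\<^sub>R X k - h *v X k \<in> closure C" for k h m
  proof (rule op_bound[OF _ m(1)])
    fix y assume y: "y \<in> B k 1"
    have "h *v (X k - y) \<in> closure C" "h *v (X k + y) \<in> closure C"
      using y by (auto simp: B_def intro: closure_invariant[OF h])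
    then have "(m *\<^sub>R X k - h *v X k) + h *v (X k - y) \<in> closure C" "(m *\<^sub>R X k - h *v X k) + h *v (X k + y) \<in> closure C"
      using m(2) by (auto intro: cl(2))
    then show "h *v y \<in> B k m" by (simp add: B_def matrix_vector_right_distrib matrix_vector_mult_diff_distrib)
  qed
  \<comment> \<open>The points \<open>X k\<close> increase in the cone order, so the unit ball of
    \<open>X 0\<close> lies in that of \<open>X k\<close>. Nothing of the kind holds for the
    inverses, and the limit of the \<open>A k\<close> will be singular.\<close>
  have A_bound: "norm (A k) \<le> N * (N * 1 / (1 / N)) * norm (A 0)" for k
  proof -
    have "norm (A k ** mat 1 ** A' 0) \<le> N * (N * 1 / (1 / N))"
    proof (rule op_bound)
      fix y assume y: "y \<in> B 0 1"
      have "(t k - t 0) *\<^sub>R v \<in> closure C" using vcl by (intro cl(3)) (auto simp: t_def)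
      then have "(t k - t 0) *\<^sub>R v + (X 0 - y) \<in> closure C" "(t k - t 0) *\<^sub>R v + (X 0 + y) \<in> closure C"
        using y by (auto simp: B_def intro: cl(2))
      then show "mat 1 *v y \<in> B k 1" by (simp add: B_def X_def algebra_simps)
    qed simp
    moreover have "A k = A k ** A' 0 ** A 0" by (simp add: AA flip: matrix_mul_assoc)
    then have "norm (A k) \<le> norm (A k ** A' 0) * norm (A 0)" by (metis norm_matrix_mult_le)
    ultimately show ?thesis by (simp add: order_trans[OF _ mult_right_mono[OF _ norm_ge_zero]])
  qed
  have dominate: "\<exists>m>0. m *\<^sub>R y - z \<in> closure C" if "y \<in> C" for y z
  proof -
    obtain e where e: "e > 0" "ball y e \<subseteq> C" using C_facts(1) \<open>y \<in> C\<close> open_contains_ball by blast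
    define s where "s = e / (2 * (1 + norm z))"
    have p1: "1 + norm z > 0" by (simp add: add_pos_nonneg)
    have s: "s > 0" using e(1) p1 by (simp add: s_def)
    have "s * norm z < e"
    proof -
      have "s * norm z \<le> s * (1 + norm z)" using s by simp
      also have "\<dots> = e / 2" using p1 by (simp add: s_def field_simps)
      finally show ?thesis using e(1) by linarith
    qed
    then have "y - s *\<^sub>R z \<in> C" using e(2) s by (auto simp: dist_norm subset_iff)
    then have "(1 / s) *\<^sub>R (y - s *\<^sub>R z) \<in> C" using s by (intro ncone_scale[OF C_facts(2)]) auto
    then have "(1 / s) *\<^sub>R y - z \<in> closure C" using s C_cl by (auto simp: scaleR_right_diff_distrib)
    then show ?thesis using s by (intro exI[of _ "1 / s"]) auto
  qed
  have Vdominate: "(norm u / d) *\<^sub>R v + u \<in> closure C" "(norm u / d) *\<^sub>R v - u \<in> closure C" if u: "u \<in> V" for u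
  proof -
    have *: "(norm u / d) *\<^sub>R v + u \<in> closure C" if u: "u \<in> V" for u
    proof (cases "u = 0")
      case False
      have "v + (d / norm u) *\<^sub>R u \<in> closure C"
        using u V(1) v(2) False by (intro v(3)) (auto intro: subspace_scale)
      then have "(norm u / d) *\<^sub>R (v + (d / norm u) *\<^sub>R u) \<in> closure C" using v(2) by (intro cl(3)) auto
      then show ?thesis using False v(2) by (simp add: scaleR_right_distrib)
    qed (use cl(1) C_facts(3) in simp)
    show "(norm u / d) *\<^sub>R v + u \<in> closure C" by (rule *[OF u])
    show "(norm u / d) *\<^sub>R v - u \<in> closure C" using *[of "- u"] u V(1) by (simp add: subspace_neg)
  qed
  \<comment> \<open>\<open>x\<close> is interior in the cone and \<open>v\<close> is interior
    relative to V, so h x and h v are dominated by multiples of \<open>x\<close> and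
    \<open>v\<close>; the sum of the two factors serves x + t v for every t.\<close>
  have displacement: "\<exists>m>0. \<forall>k. m *\<^sub>R X k - h *v X k \<in> closure C" if h: "h \<in> H" for h
  proof -
    obtain m1 where m1: "m1 > 0" "m1 *\<^sub>R x - h *v x \<in> closure C" using dominate[OF x] by blast
    define m2 where "m2 = norm (h *v v) / d"
    have m2: "m2 \<ge> 0" "m2 *\<^sub>R v - h *v v \<in> closure C" using Vdominate(2)[OF V(3)[OF h v(1)]] v(2) by (simp_all add: m2_def)
    have "(m1 + m2) *\<^sub>R X k - h *v X k \<in> closure C" for k
    proof -
      have "((m1 *\<^sub>R x - h *v x) + m2 *\<^sub>R x) + t k *\<^sub>R ((m2 *\<^sub>R v - h *v v) + m1 *\<^sub>R v) \<in> closure C"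
        using m1 m2 x vcl t[of k] C_cl by (intro cl(2,3)) auto
      then show ?thesis by (simp add: X_def algebra_simps)
    qed
    then show ?thesis using m1(1) m2(1) by (intro exI[of _ "m1 + m2"]) auto
  qed
  define \<F> where "\<F> = insert A ((\<lambda>s k. A k ** s ** A' k) ` (gens \<union> matrix_inv ` gens))"
  have "finite \<F>" using gens(1) by (simp add: \<F>_def)
  moreover have "bounded (range f)" if fF: "f \<in> \<F>" for f
  proof -
    consider "f = A" | h where "h \<in> H" "f = (\<lambda>k. A k ** h ** A' k)"
      using fF gens(2) inv_in by (auto simp: \<F>_def)
    then show ?thesis
    proof cases
      case 1
      then show ?thesis using A_bound unfolding bounded_iff by blast
    next
      case 2
      obtain m where "m > 0" "\<forall>k. m *\<^sub>R X k - h *v X k \<in> closure C" using displacement[OF 2(1)] by blast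
      then show ?thesis using conj_bound[OF 2(1)] unfolding bounded_iff 2(2) by blast
    qed
  qed
  ultimately obtain r where r: "strict_mono r" "\<forall>f\<in>\<F>. convergent (f \<circ> r)" using common_convergent_subseq by metis
  define \<rho>k where "\<rho>k k h = A (r k) ** h ** A' (r k)" for k h
  have \<rho>k_one: "\<rho>k k (mat 1) = mat 1" and \<rho>k_mult: "\<rho>k k (g ** h) = \<rho>k k g ** \<rho>k k h" for k g h
  proof -
    show "\<rho>k k (mat 1) = mat 1" by (simp add: \<rho>k_def AA)
    have "\<rho>k k g ** \<rho>k k h = A (r k) ** g ** (A' (r k) ** A (r k)) ** h ** A' (r k)" by (simp add: \<rho>k_def matrix_mul_assoc)
    then show "\<rho>k k (g ** h) = \<rho>k k g ** \<rho>k k h" by (simp add: AA) (simp add: \<rho>k_def matrix_mul_assoc)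
  qed
  have conv: "convergent (\<lambda>k. \<rho>k k h)" if h: "h \<in> H" for h
    using h
  proof (rule gens_induct)
    show "convergent (\<lambda>k. \<rho>k k (mat 1))" by (simp add: \<rho>k_one convergent_const)
    have *: "convergent (\<lambda>k. \<rho>k k s)" if "s \<in> gens \<union> matrix_inv ` gens" for s
    proof -
      have "(\<lambda>k. A k ** s ** A' k) \<in> \<F>" using that by (auto simp: \<F>_def)
      then have "convergent ((\<lambda>k. A k ** s ** A' k) \<circ> r)" using r(2) by blast
      then show ?thesis by (simp add: \<rho>k_def o_def)
    qed
    show "convergent (\<lambda>k. \<rho>k k s)" "convergent (\<lambda>k. \<rho>k k (matrix_inv s))" if "s \<in> gens" for s
      using that by (auto intro: *)
    show "convergent (\<lambda>k. \<rho>k k (a ** b))" if ab: "convergent (\<lambda>k. \<rho>k k a)" "convergent (\<lambda>k. \<rho>k k b)" for a b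
    proof -
      obtain la lb where "(\<lambda>k. \<rho>k k a) \<longlonglongrightarrow> la" "(\<lambda>k. \<rho>k k b) \<longlonglongrightarrow> lb"
        using ab unfolding convergent_def by metis
      then have "(\<lambda>k. \<rho>k k a ** \<rho>k k b) \<longlonglongrightarrow> la ** lb" by (rule tendsto_matrix_mult)
      then show ?thesis unfolding \<rho>k_mult convergent_def by blast
    qed
  qed
  define \<rho> where "\<rho> h = lim (\<lambda>k. \<rho>k k h)" for h
  have lim_\<rho>: "(\<lambda>k. \<rho>k k h) \<longlonglongrightarrow> \<rho> h" if "h \<in> H" for h
    using conv[OF that] by (simp add: \<rho>_def convergent_LIMSEQ_iff)
  obtain Ai where Ai: "(\<lambda>k. A (r k)) \<longlonglongrightarrow> Ai" using r(2) by (auto simp: \<F>_def convergent_def o_def)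
  have Aiv: "(\<lambda>k. A (r k) *v y) \<longlonglongrightarrow> Ai *v y" for y by (intro tendsto_intros Ai)
  have hom_\<rho>: "mat_hom \<rho>"
    unfolding mat_hom_def
  proof (intro conjI ballI)
    show "\<rho> (mat 1) = mat 1" using LIMSEQ_unique[OF lim_\<rho>[OF one_in]] by (simp add: \<rho>k_one)
    show "\<rho> (g ** h) = \<rho> g ** \<rho> h" if "g \<in> H" "h \<in> H" for g h
      using LIMSEQ_unique[OF lim_\<rho>[OF mult_in[OF that]]] tendsto_matrix_mult[OF lim_\<rho>[OF that(1)] lim_\<rho>[OF that(2)]]
      by (simp add: \<rho>k_mult)
  qed
  \<comment> \<open>The limit of the \<open>A k\<close> intertwines the given action with the limit
    representation, so its kernel is invariant.\<close>
  have Ai_h: "Ai *v (h *v y) = \<rho> h *v (Ai *v y)" if h: "h \<in> H" for h y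
  proof (rule LIMSEQ_unique[OF Aiv])
    have "A (r k) *v (h *v y) = \<rho>k k h *v (A (r k) *v y)" for k
      by (simp add: \<rho>k_def A'A flip: matrix_vector_mul_assoc)
    then show "(\<lambda>k. A (r k) *v (h *v y)) \<longlonglongrightarrow> \<rho> h *v (Ai *v y)"
      using tendsto_matrix_vector_mult[OF lim_\<rho>[OF h] Aiv[of y]] by simp
  qed
  \<comment> \<open>Vectors of V have size of order 1 / t in the norm of \<open>X k\<close>, because
    a multiple of \<open>v\<close> dominates them in both signs. Adding 1 to the norm of
    \<open>u\<close> keeps the radius \<open>l\<close> positive.\<close>
  have VA: "t k * norm (A k *v u) \<le> N * ((norm u + 1) / d)" if u: "u \<in> V" for u k
  proof -
    have tk: "t k > 0" by (rule t)
    define l where "l = (norm u + 1) / d"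
    have l: "l > 0" using v(2) by (simp add: l_def add_nonneg_pos)
    have lu: "l *\<^sub>R v + u \<in> closure C" "l *\<^sub>R v - u \<in> closure C"
    proof -
      have "(1 / d) *\<^sub>R v \<in> closure C" using v(2) vcl by (intro cl(3)) auto
      then have "(1 / d) *\<^sub>R v + ((norm u / d) *\<^sub>R v + u) \<in> closure C" "(1 / d) *\<^sub>R v + ((norm u / d) *\<^sub>R v - u) \<in> closure C"
        using Vdominate[OF u] by (auto intro: cl(2))
      then show "l *\<^sub>R v + u \<in> closure C" "l *\<^sub>R v - u \<in> closure C"
        by (simp_all add: l_def algebra_simps add_divide_distrib)
    qed
    have "l *\<^sub>R x + t k *\<^sub>R (l *\<^sub>R v + u) \<in> closure C" "l *\<^sub>R x + t k *\<^sub>R (l *\<^sub>R v - u) \<in> closure C"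
      using lu l tk x C_cl by (auto intro!: cl(2,3))
    then have "t k *\<^sub>R u \<in> B k l" by (simp add: B_def X_def algebra_simps)
    then have "norm (A k *v (t k *\<^sub>R u)) \<le> N * l" using l by (rule A2)
    then show ?thesis using tk by (simp add: l_def matrix_vector_mult_scaleR)
  qed
  have AiV: "Ai *v u = 0" if u: "u \<in> V" for u
  proof -
    have "(\<lambda>k. A (r k) *v u) \<longlonglongrightarrow> 0"
    proof (rule Lim_null_comparison)
      show "\<forall>\<^sub>F k in sequentially. norm (A (r k) *v u) \<le> (N * ((norm u + 1) / d)) / real (Suc k)"
      proof (rule always_eventually, rule allI)
        fix k
        have rk: "real (Suc k) \<le> t (r k)" using seq_suble[OF r(1), of k] by (simp add: t_def)
        have "norm (A (r k) *v u) * real (Suc k) \<le> norm (A (r k) *v u) * t (r k)" using rk by (intro mult_left_mono) auto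
        also have "\<dots> \<le> N * ((norm u + 1) / d)" using VA[OF u, of "r k"] by (simp add: mult.commute)
        finally show "norm (A (r k) *v u) \<le> (N * ((norm u + 1) / d)) / real (Suc k)"
          by (simp only: pos_le_divide_eq[OF of_nat_0_less_iff[THEN iffD2, OF zero_less_Suc]])
      qed
      show "(\<lambda>k. (N * ((norm u + 1) / d)) / real (Suc k)) \<longlonglongrightarrow> 0"
        by (rule LIMSEQ_Suc[OF lim_const_over_n])
    qed
    then show ?thesis using LIMSEQ_unique[OF Aiv] by blast
  qed
  have Ai_normal: "norm (Ai *v u) \<le> N * N * norm (Ai *v (u + w))" if "u \<in> closure C" "w \<in> closure C" for u w
    by (rule LIMSEQ_le[OF tendsto_norm[OF Aiv] tendsto_mult_left[OF tendsto_norm[OF Aiv]]])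
      (use normal[OF that] in auto)
  \<comment> \<open>The limit does not collapse \<open>x\<close>: a norm below 1 / N would put l X -
    x in the closed cone with l < 1, and adding (1 - l) x would put a multiple of \<open>v\<close>
    in the open cone, against V \<inter> C = {}.\<close>
  have Ai_x: "norm (Ai *v x) \<ge> 1 / N"
  proof (rule LIMSEQ_le_const[OF tendsto_norm[OF Aiv]], intro exI allI impI, rule ccontr)
    fix k assume "\<not> 1 / N \<le> norm (A (r k) *v x)"
    then have n: "N * norm (A (r k) *v x) < 1" using N1 by (simp add: field_simps)
    define l where "l = (1 + N * norm (A (r k) *v x)) / 2"
    have l: "l > 0" "l < 1" "norm (A (r k) *v x) \<le> l / N"
      using n N1 by (auto simp: l_def field_simps add_pos_nonneg)
    have "x \<in> B (r k) l" by (rule A2'[OF l(3,1)])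
    then have "l *\<^sub>R X (r k) - x \<in> closure C" by (simp add: B_def)
    moreover have "(1 - l) *\<^sub>R x \<in> C" using l x by (intro ncone_scale[OF C_facts(2)]) auto
    ultimately have "(1 - l) *\<^sub>R x + (l *\<^sub>R X (r k) - x) \<in> C" using add_closure_in_cone[OF C_facts(2,1)] by blast
    then have "(l * t (r k)) *\<^sub>R v \<in> C" by (simp add: X_def algebra_simps)
    moreover have "(l * t (r k)) *\<^sub>R v \<in> V" using V(1) v(1) by (rule subspace_scale)
    ultimately show False using VC by blast
  qed
  have Ai_C: "Ai *v y \<noteq> 0" if y: "y \<in> C" for y
  proof
    assume z: "Ai *v y = 0"
    obtain m where m: "m > 0" "m *\<^sub>R y - x \<in> closure C" using dominate[OF y] by blast
    have "norm (Ai *v x) \<le> N * N * norm (Ai *v (x + (m *\<^sub>R y - x)))" using x C_cl m by (intro Ai_normal) auto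
    also have "\<dots> = 0" using z by (simp add: matrix_vector_mult_scaleR)
    moreover have "1 / N > 0" using N1 by simp
    ultimately show False using Ai_x by linarith
  qed
  \<comment> \<open>On a finite set the limit is close to \<open>\<rho>k k\<close> for late k. That
    representation is conjugate to the discrete group, hence discrete with a radius depending on k,
    which is enough for nilpotency.\<close>
  have disc_\<rho>: "\<exists>e>0. \<forall>h\<in>H. norm (\<rho> h - mat 1) < e \<longrightarrow> h = mat 1"
  proof -
    have c1: "central R {mat 1}" for R by (simp add: central_def)
    obtain e where "e > 0" "\<And>h c. h \<in> H \<Longrightarrow> c \<in> {mat 1} \<Longrightarrow> norm (c ** \<rho> h - mat 1) < e \<Longrightarrow> h = mat 1"
    proof (rule zassenhaus[OF noab hom_\<rho> c1])
      fix S assume S: "finite S" "S \<subseteq> H" "\<And>s. s \<in> S \<Longrightarrow> \<exists>c\<in>{mat 1}. norm (c ** \<rho> s - mat 1) < zassenhaus_radius TYPE('m)"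
      have "\<forall>\<^sub>F k in sequentially. \<forall>s\<in>S. norm (\<rho>k k s - mat 1) < zassenhaus_radius TYPE('m)"
      proof (rule eventually_ball_finite[OF S(1)], rule ballI)
        fix s assume s: "s \<in> S"
        have "(\<lambda>k. norm (\<rho>k k s - mat 1)) \<longlonglongrightarrow> norm (\<rho> s - mat 1)"
          using lim_\<rho>[of s] s S(2) by (intro tendsto_intros) auto
        then show "\<forall>\<^sub>F k in sequentially. norm (\<rho>k k s - mat 1) < zassenhaus_radius TYPE('m)"
          using order_tendstoD(2) S(3)[OF s] by auto
      qed
      then obtain k where k: "\<forall>s\<in>S. norm (\<rho>k k s - mat 1) < zassenhaus_radius TYPE('m)"
        using eventually_happens trivial_limit_sequentially by blast
      obtain \<epsilon> where \<epsilon>: "\<epsilon> > 0" "\<forall>h\<in>H. norm (h - mat 1) < \<epsilon> \<longrightarrow> h = mat 1" using discrete_one by blast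
      define b where "b = norm (A' (r k)) * norm (A (r k)) + 1"
      have b: "b > 0" by (simp add: b_def add_nonneg_pos)
      show "\<exists>L. comm_iter S L \<subseteq> {mat 1}"
      proof (rule small_elements_nilpotent[of "\<rho>k k" "{mat 1}" "\<epsilon> / b"])
        show "mat_hom (\<rho>k k)" by (simp add: mat_hom_def \<rho>k_one \<rho>k_mult)
        show "\<epsilon> / b > 0" using \<epsilon>(1) b by simp
        fix h assume h: "h \<in> H" "norm (\<rho>k k h - mat 1) < \<epsilon> / b"
        have "A' (r k) ** (\<rho>k k h - mat 1) ** A (r k) = (A' (r k) ** A (r k)) ** h ** (A' (r k) ** A (r k)) - A' (r k) ** A (r k)"
          by (simp add: \<rho>k_def matrix_diff_ldistrib matrix_diff_rdistrib matrix_mul_assoc)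
        then have "norm (h - mat 1) = norm (A' (r k) ** (\<rho>k k h - mat 1) ** A (r k))" by (simp add: AA)
        also have "\<dots> \<le> norm (A' (r k) ** (\<rho>k k h - mat 1)) * norm (A (r k))" by (rule norm_matrix_mult_le)
        also have "\<dots> \<le> (norm (A' (r k)) * norm (\<rho>k k h - mat 1)) * norm (A (r k))"
          by (intro mult_right_mono norm_matrix_mult_le) auto
        also have "\<dots> \<le> b * norm (\<rho>k k h - mat 1)" by (simp add: b_def algebra_simps)
        also have "\<dots> < \<epsilon>" using h(2) b by (simp add: field_simps)
        finally show "h = mat 1" using \<epsilon>(2) h(1) by blast
      qed (use k S(2) c1 in \<open>auto intro: less_imp_le\<close>)
    qed (rule that)
    then show ?thesis by auto
  qed
  \<comment> \<open>The kernel contains V and may be larger. The blocks are the quotient by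
    \<open>U\<close> and the restriction to V; the directions of \<open>U\<close> orthogonal to V go
    to the trivial part.\<close>
  define U where "U = {y. Ai *v y = 0}"
  have sU: "subspace U" unfolding U_def by (rule linear_subspace_kernel[OF matrix_vector_mul_linear])
  obtain P :: "real^'m^'m" where P: "\<And>x. P *v x \<in> U" "\<And>x. x \<in> U \<Longrightarrow> P *v x = x" "\<And>x y. y \<in> U \<Longrightarrow> (x - P *v x) \<bullet> y = 0"
    using orth_proj_exists[OF sU] by metis
  obtain P2 :: "real^'m^'m" where P2: "\<And>x. P2 *v x \<in> V" "\<And>x. x \<in> V \<Longrightarrow> P2 *v x = x" "\<And>x y. y \<in> V \<Longrightarrow> (x - P2 *v x) \<bullet> y = 0"
    using orth_proj_exists[OF V(1)] by metis
  define Q where "Q = mat 1 - P"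
  have Q: "Q *v y = y - P *v y" for y by (simp add: Q_def matrix_vector_mult_diff_rdistrib)
  have VU: "V \<subseteq> U" using AiV by (auto simp: U_def)
  have AiQ: "Ai *v (Q *v y) = Ai *v y" for y
    using P(1)[of y] by (simp add: Q matrix_vector_mult_diff_distrib U_def)
  have Uinv: "h *v y \<in> U" if "h \<in> H" "y \<in> U" for h y using that Ai_h by (simp add: U_def)
  obtain e where e: "e > 0" "\<And>y. e * norm (Q *v y) \<le> norm (Ai *v y)"
  proof -
    have s: "subspace {y. P *v y = 0}" by (rule linear_subspace_kernel[OF matrix_vector_mul_linear])
    have "\<exists>e>0. \<forall>y\<in>{y. P *v y = 0}. e * norm y \<le> norm (Ai *v y)"
    proof (rule injective_imp_isometric[OF closed_subspace[OF s] s matrix_vector_mul_bounded_linear], intro ballI impI)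
      fix y assume y: "y \<in> {y. P *v y = 0}" "Ai *v y = 0"
      then have "P *v y = y" by (intro P(2)) (simp add: U_def)
      then show "y = 0" using y(1) by simp
    qed
    then obtain e where e: "e > 0" "\<And>y. P *v y = 0 \<Longrightarrow> e * norm y \<le> norm (Ai *v y)" by auto
    have "P *v (Q *v y) = 0" for y by (simp add: Q matrix_vector_mult_diff_distrib P)
    then show thesis using e that[of e] AiQ by metis
  qed
  have b1: "block H Q (\<lambda>h. Q ** h) ((\<lambda>y. Q *v y) ` C)"
    unfolding Q_def
  proof (rule block_quotient[where V=U, OF Uinv P(1,2)])
    show "U \<inter> C = {}" using Ai_C by (auto simp: U_def)
    fix u w assume uw: "u \<in> C" "w \<in> C"
    have "e * norm (Q *v u) \<le> norm (Ai *v u)" by (rule e(2))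
    also have "\<dots> \<le> N * N * norm (Ai *v (u + w))" using uw C_cl by (intro Ai_normal) auto
    also have "\<dots> \<le> N * N * (norm Ai * norm (Q *v (u + w)))"
      using norm_matrix_vector_mult_le[of Ai "Q *v (u + w)"] N1 by (intro mult_left_mono) (auto simp: AiQ)
    finally have "norm (Q *v u) \<le> (N * N * norm Ai / e) * norm (Q *v (u + w))" using e(1) by (simp add: field_simps)
    then show "norm (u - P *v u) \<le> (N * N * norm Ai / e) * norm ((u + w) - P *v (u + w))" by (simp only: Q)
  qed
  define K2 where "K2 = {u \<in> V. \<exists>d>0. \<forall>w\<in>V. norm w \<le> d \<longrightarrow> u + w \<in> closure C}"
  have b2: "block H P2 (\<lambda>h. h ** P2) K2"
    unfolding K2_def by (rule block_subspace_cone[OF V v P2(1,2)])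
  have QV0: "Q *v y = 0" if "y \<in> V" for y using that VU P(2) by (auto simp: Q)
  have pm: "premodel H Q P2 (\<lambda>h. Q ** h) (\<lambda>h. h ** P2) ((\<lambda>y. Q *v y) ` C) K2"
  proof
    show "Q ** P2 = 0" using QV0[OF P2(1)] by (simp add: matrix_eq flip: matrix_vector_mul_assoc)
    have "P2 *v (Q *v y) = 0" for y
    proof -
      let ?z = "P2 *v (Q *v y)"
      have "(Q *v y) \<bullet> ?z = 0" unfolding Q using P(3) P2(1) VU by blast
      moreover have "(Q *v y - ?z) \<bullet> ?z = 0" by (rule P2(3)[OF P2(1)])
      ultimately have "?z \<bullet> ?z = 0" by (simp add: inner_diff_left)
      then show ?thesis by simp
    qed
    then show "P2 ** Q = 0" by (simp add: matrix_eq flip: matrix_vector_mul_assoc)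
  qed (rule b1 b2)+
  have "model H Q P2 (\<lambda>h. Q ** h) (\<lambda>h. h ** P2) ((\<lambda>y. Q *v y) ` C) K2"
  proof (rule model_if_finite[OF pm])
    interpret pm: premodel H Q P2 "\<lambda>h. Q ** h" "\<lambda>h. h ** P2" "(\<lambda>y. Q *v y) ` C" K2 by (rule pm)
    fix M
    \<comment> \<open>The image h \<open>X k\<close> has two parts: h x, seen in the limit by the
      quotient block through \<open>Ai\<close>, and t h v, seen by the block on V through
      \<open>VA\<close>. A bound on \<open>\<sigma> h\<close> therefore bounds the conjugates of
      \<open>h\<close> and their limit \<open>\<rho> h\<close>.\<close>
    define R where "R = norm Ai * (norm Q * (M * norm x)) + 1 + N * ((M * norm v + 1) / d)"
    define M' where "M' = N * (N * (N * R) / (1 / N))"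
    have bd: "norm (\<rho> h) \<le> M'" if h: "h \<in> H" and n: "norm (pm.\<sigma> h) \<le> M" for h
    proof -
      have M0: "M \<ge> 0" using n norm_ge_zero order_trans by blast
      have "norm (Ai *v (h *v x)) = norm (Ai *v (Q *v (pm.\<sigma> h *v x)))" using h by (simp add: AiQ flip: matrix_vector_mul_assoc)
      also have "\<dots> \<le> norm Ai * norm (Q *v (pm.\<sigma> h *v x))" by (rule norm_matrix_vector_mult_le)
      also have "\<dots> \<le> norm Ai * (norm Q * norm (pm.\<sigma> h *v x))" by (intro mult_left_mono norm_matrix_vector_mult_le) auto
      also have "\<dots> \<le> norm Ai * (norm Q * (M * norm x))"
        using norm_matrix_vector_mult_le[of "pm.\<sigma> h" x] mult_right_mono[OF n, of "norm x"]
        by (intro mult_left_mono) auto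
      finally have "norm (Ai *v (h *v x)) < norm Ai * (norm Q * (M * norm x)) + 1" by simp
      then have ev: "\<forall>\<^sub>F k in sequentially. norm (A (r k) *v (h *v x)) < norm Ai * (norm Q * (M * norm x)) + 1"
        using order_tendstoD(2)[OF tendsto_norm[OF Aiv]] by blast
      have hv: "norm (h *v v) \<le> M * norm v"
      proof -
        have "h *v v = P2 *v (pm.\<sigma> h *v v)" using h v(1) P2(2) by (simp flip: matrix_vector_mul_assoc)
        moreover have "pm.\<sigma> h *v v = h *v v"
        proof -
          have "Q *v (h *v v) = 0" "Q *v v = 0" using QV0 V(3)[OF h v(1)] v(1) by auto
          then show ?thesis using P2(2)[OF v(1)] by (simp add: pm.\<sigma>_vec flip: matrix_vector_mul_assoc)
        qed
        ultimately show ?thesis using norm_matrix_vector_mult_le[of "pm.\<sigma> h" v] mult_right_mono[OF n, of "norm v"] by simp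
      qed
      have ev2: "\<forall>\<^sub>F k in sequentially. norm (\<rho>k k h) \<le> M'"
        using ev
      proof eventually_elim
        case (elim k)
        have "A (r k) *v (h *v X (r k)) = A (r k) *v (h *v x) + t (r k) *\<^sub>R (A (r k) *v (h *v v))"
          by (simp add: X_def matrix_vector_right_distrib matrix_vector_mult_scaleR)
        then have "norm (A (r k) *v (h *v X (r k))) \<le> norm (A (r k) *v (h *v x)) + t (r k) * norm (A (r k) *v (h *v v))"
          using norm_triangle_ineq t(1)[of "r k"] by (metis abs_of_pos norm_scaleR)
        also have "t (r k) * norm (A (r k) *v (h *v v)) \<le> N * ((norm (h *v v) + 1) / d)"
          by (rule VA[OF V(3)[OF h v(1)]])
        also have "\<dots> \<le> N * ((M * norm v + 1) / d)" using hv N1 v(2) by (intro mult_left_mono divide_right_mono) auto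
        finally have "norm (A (r k) *v (h *v X (r k))) \<le> R" using elim by (simp add: R_def)
        then have "norm (A (r k) *v (h *v X (r k))) \<le> (N * R) / N" using N1 by simp
        moreover have "R > 0" using M0 N1 v(2) unfolding R_def by (intro add_pos_nonneg add_nonneg_pos mult_nonneg_nonneg divide_nonneg_nonneg) auto
        then have NR: "N * R > 0" using N1 by simp
        ultimately have "h *v X (r k) \<in> B (r k) (N * R)" by (rule A2')
        then show ?case unfolding \<rho>k_def M'_def by (intro conj_bound[OF h NR]) (simp add: B_def)
      qed
      show ?thesis
        by (rule tendsto_upperbound[OF tendsto_norm[OF lim_\<rho>[OF h]] ev2]) simp
    qed
    obtain \<epsilon> where \<epsilon>: "\<epsilon> > 0" "\<forall>h\<in>H. norm (\<rho> h - mat 1) < \<epsilon> \<longrightarrow> h = mat 1" using disc_\<rho> by blast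
    have "finite {h \<in> H. \<exists>c\<in>{mat 1}. \<exists>c'. c ** c' = mat 1 \<and> c' ** c = mat 1 \<and> norm (c ** \<rho> h) \<le> M' \<and> norm (c' ** \<rho> (matrix_inv h)) \<le> M'}"
      by (rule finite_bounded[OF hom_\<rho>, of "{mat 1}" \<epsilon>]) (use \<epsilon> in \<open>auto simp: central_def\<close>)
    moreover have "{h \<in> H. norm (pm.\<sigma> h) \<le> M \<and> norm (pm.\<sigma> (matrix_inv h)) \<le> M} \<subseteq>
        {h \<in> H. \<exists>c\<in>{mat 1}. \<exists>c'. c ** c' = mat 1 \<and> c' ** c = mat 1 \<and> norm (c ** \<rho> h) \<le> M' \<and> norm (c' ** \<rho> (matrix_inv h)) \<le> M'}"
      using bd inv_in by auto
    ultimately show "finite {h \<in> H. norm (pm.\<sigma> h) \<le> M \<and> norm (pm.\<sigma> (matrix_inv h)) \<le> M}" by (rule rev_finite_subset)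
  qed
  then show ?thesis by blast
qed

text \<open>In the boundary case the subspace is shrunk to the span of its intersection with the
  closed cone. The span is invariant, and the intersection, convex and containing 0, has interior
  relative to it: this is the vector and the radius that \<open>model_tangent\<close> asks
  for.\<close>

theorem model_exists:
  assumes V: "subspace V" "V \<noteq> {0}" "V \<noteq> UNIV" "\<And>h v. h \<in> H \<Longrightarrow> v \<in> V \<Longrightarrow> h *v v \<in> V"
  shows "\<exists>P1 P2 s1 s2 K1 K2. model H P1 P2 s1 s2 K1 K2"
proof -
  consider "V \<inter> C \<noteq> {}" | "V \<inter> closure C \<subseteq> {0}" | "V \<inter> C = {}" "\<not> V \<inter> closure C \<subseteq> {0}" by blast
  then show ?thesis
  proof cases
    case 1
    then obtain q where q: "q \<in> V \<inter> C" by blast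
    show ?thesis by (rule model_meets[OF V(1,3) _ q]) (rule V(4))
  next
    case 2
    show ?thesis by (rule model_disjoint[OF V(1,2) _ 2]) (rule V(4))
  next
    case 3
    define F where "F = V \<inter> closure C"
    define W where "W = span F"
    note cl = closure_cone[OF C_facts(2)]
    have WV: "W \<subseteq> V" unfolding W_def F_def by (intro span_minimal V(1)) auto
    have sW: "subspace W" by (simp add: W_def subspace_span)
    have W0: "W \<noteq> {0}" using 3(2) span_superset[of F] by (auto simp: W_def F_def)
    have Winv: "h *v w \<in> W" if h: "h \<in> H" and w: "w \<in> W" for h w
    proof -
      have "(\<lambda>y. h *v y) ` F \<subseteq> F" using V(4)[OF h] closure_invariant[OF h] by (auto simp: F_def)
      then have "span ((\<lambda>y. h *v y) ` F) \<subseteq> span F" by (rule span_mono)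
      moreover have "span ((\<lambda>y. h *v y) ` F) = (\<lambda>y. h *v y) ` span F"
        by (rule linear_span_image[OF matrix_vector_mul_linear])
      ultimately show ?thesis using w by (auto simp: W_def)
    qed
    have F0: "0 \<in> F" using cl(1) C_facts(3) V(1) by (simp add: F_def subspace_0)
    have cF: "convex F" unfolding F_def
      using convex_closure[OF ncone_convex[OF C_facts(2)]] subspace_imp_convex[OF V(1)] by (rule convex_Int[rotated])
    obtain v where v: "v \<in> rel_interior F" using rel_interior_eq_empty[OF cF] F0 by blast
    have aff: "affine hull F = W" unfolding W_def by (rule affine_hull_span_0) (rule hull_inc[OF F0])
    obtain e where e: "e > 0" "cball v e \<inter> W \<subseteq> F" using v unfolding mem_rel_interior_cball aff by blast
    have vF: "v \<in> F" using v rel_interior_subset by blast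
    have vW: "v \<in> W" using vF span_superset by (auto simp: W_def)
    show ?thesis
    proof (rule model_tangent[OF sW W0 Winv _ vW e(1)])
      show "W \<inter> C = {}" using WV 3(1) by blast
      show "v + u \<in> closure C" if "u \<in> W" "norm u \<le> e" for u
      proof -
        have "v + u \<in> cball v e \<inter> W" using that vW sW by (auto simp: dist_norm subspace_add)
        then show ?thesis using e(2) by (auto simp: F_def)
      qed
    qed
  qed
qed

end

section \<open>Lifting the projective action\<close>

lemma mem_proj_pt: "w \<in> proj_pt v \<longleftrightarrow> (\<exists>c. c \<noteq> 0 \<and> w = c *\<^sub>R v)"
  by (auto simp: proj_pt_def)

lemma proj_pt_self: "v \<in> proj_pt v"
  unfolding mem_proj_pt by (intro exI[of _ 1]) simp

lemma proj_pt_scale: "c \<noteq> 0 \<Longrightarrow> proj_pt (c *\<^sub>R v) = proj_pt v"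
proof (rule Set.set_eqI)
  fix w assume c: "c \<noteq> 0"
  show "w \<in> proj_pt (c *\<^sub>R v) \<longleftrightarrow> w \<in> proj_pt v"
  proof
    assume "w \<in> proj_pt v"
    then obtain d where "d \<noteq> 0" "w = d *\<^sub>R v" by (auto simp: mem_proj_pt)
    then show "w \<in> proj_pt (c *\<^sub>R v)" unfolding mem_proj_pt using c by (intro exI[of _ "d / c"]) simp
  next
    assume "w \<in> proj_pt (c *\<^sub>R v)"
    then obtain d where "d \<noteq> 0" "w = d *\<^sub>R (c *\<^sub>R v)" by (auto simp: mem_proj_pt)
    then show "w \<in> proj_pt v" unfolding mem_proj_pt using c by (intro exI[of _ "d * c"]) simp
  qed
qed

lemma mem_pgl_class: "B \<in> pgl_class A \<longleftrightarrow> (\<exists>c. c \<noteq> 0 \<and> B = c *\<^sub>R A)"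
  by (auto simp: pgl_class_def)

lemma pgl_class_self: "A \<in> pgl_class A"
  unfolding mem_pgl_class by (intro exI[of _ 1]) simp

lemma pgl_class_scale: "c \<noteq> 0 \<Longrightarrow> pgl_class (c *\<^sub>R A) = pgl_class A"
proof (rule Set.set_eqI)
  fix B assume c: "c \<noteq> 0"
  show "B \<in> pgl_class (c *\<^sub>R A) \<longleftrightarrow> B \<in> pgl_class A"
  proof
    assume "B \<in> pgl_class A"
    then obtain d where "d \<noteq> 0" "B = d *\<^sub>R A" by (auto simp: mem_pgl_class)
    then show "B \<in> pgl_class (c *\<^sub>R A)" unfolding mem_pgl_class using c by (intro exI[of _ "d / c"]) simp
  next
    assume "B \<in> pgl_class (c *\<^sub>R A)"
    then obtain d where "d \<noteq> 0" "B = d *\<^sub>R (c *\<^sub>R A)" by (auto simp: mem_pgl_class)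
    then show "B \<in> pgl_class A" unfolding mem_pgl_class using c by (intro exI[of _ "d * c"]) simp
  qed
qed

lemma PGL_simps: "carrier PGL = {pgl_class A | A. invertible A}" "\<one>\<^bsub>PGL\<^esub> = pgl_class (mat 1)"
  by (simp_all add: PGL_def)

lemma PGL_mult: "pgl_class A \<otimes>\<^bsub>PGL\<^esub> pgl_class B = pgl_class (A ** B)"
proof -
  have "{X ** Y | X Y. X \<in> pgl_class A \<and> Y \<in> pgl_class B} = pgl_class (A ** B)"
  proof (intro Set.set_eqI iffI)
    fix Z assume "Z \<in> {X ** Y | X Y. X \<in> pgl_class A \<and> Y \<in> pgl_class B}"
    then obtain c d where "c \<noteq> 0" "d \<noteq> 0" "Z = (c *\<^sub>R A) ** (d *\<^sub>R B)" by (auto simp: mem_pgl_class)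
    then show "Z \<in> pgl_class (A ** B)"
      unfolding mem_pgl_class by (intro exI[of _ "c * d"]) (simp add: matrix_scaleR_left matrix_scaleR_right)
  next
    fix Z assume "Z \<in> pgl_class (A ** B)"
    then obtain c where "c \<noteq> 0" "Z = (c *\<^sub>R A) ** B" by (auto simp: mem_pgl_class matrix_scaleR_left)
    then show "Z \<in> {X ** Y | X Y. X \<in> pgl_class A \<and> Y \<in> pgl_class B}"
      using pgl_class_self[of B] by (auto simp: mem_pgl_class)
  qed
  then show ?thesis by (simp add: PGL_def)
qed

lemma group_PGL: "group PGL"
proof (rule groupI)
  fix x y z :: "(real^'m^'m) set"
  show "x \<otimes>\<^bsub>PGL\<^esub> y \<in> carrier PGL" if xy: "x \<in> carrier PGL" "y \<in> carrier PGL"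
  proof -
    obtain A B where "invertible A" "invertible B" "x = pgl_class A" "y = pgl_class B" using xy by (auto simp: PGL_simps)
    then show ?thesis by (auto simp: PGL_mult) (auto simp: PGL_simps intro: invertible_mult)
  qed
  show "x \<otimes>\<^bsub>PGL\<^esub> y \<otimes>\<^bsub>PGL\<^esub> z = x \<otimes>\<^bsub>PGL\<^esub> (y \<otimes>\<^bsub>PGL\<^esub> z)"
    if "x \<in> carrier PGL" "y \<in> carrier PGL" "z \<in> carrier PGL"
    using that by (auto simp: PGL_simps(1) PGL_mult matrix_mul_assoc)
  show "\<one>\<^bsub>PGL\<^esub> \<otimes>\<^bsub>PGL\<^esub> x = x" if "x \<in> carrier PGL" using that by (auto simp: PGL_simps PGL_mult)
  show "\<exists>y\<in>carrier PGL. y \<otimes>\<^bsub>PGL\<^esub> x = \<one>\<^bsub>PGL\<^esub>" if x: "x \<in> carrier PGL"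
  proof -
    obtain A where A: "invertible A" "x = pgl_class A" using x by (auto simp: PGL_simps)
    then obtain B where B: "A ** B = mat 1" "B ** A = mat 1" by (auto simp: invertible_def)
    then have "invertible B" by (auto simp: invertible_def)
    then show ?thesis using A B by (intro bexI[of _ "pgl_class B"]) (auto simp: PGL_mult PGL_simps)
  qed
qed (auto simp: PGL_simps invertible_def intro!: exI[of _ "mat 1"])

lemma pgl_act_proj_pt: "pgl_act (pgl_class A) (proj_pt v) = proj_pt (A *v v)"
proof (intro Set.set_eqI iffI)
  fix w assume "w \<in> pgl_act (pgl_class A) (proj_pt v)"
  then obtain c d where "c \<noteq> 0" "d \<noteq> 0" "w = (c *\<^sub>R A) *v (d *\<^sub>R v)"
    by (auto simp: pgl_act_def mem_pgl_class mem_proj_pt)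
  then show "w \<in> proj_pt (A *v v)"
    unfolding mem_proj_pt by (intro exI[of _ "c * d"]) (simp add: matrix_vector_scaleR_left matrix_vector_mult_scaleR)
next
  fix w assume "w \<in> proj_pt (A *v v)"
  then obtain c where "c \<noteq> 0" "w = A *v (c *\<^sub>R v)" by (auto simp: mem_proj_pt matrix_vector_mult_scaleR)
  then show "w \<in> pgl_act (pgl_class A) (proj_pt v)"
    unfolding pgl_act_def using pgl_class_self[of A]
    by (intro UnionI[of "(*v) A ` proj_pt v"]) (auto simp del: matrix_vector_mult_scaleR simp: mem_proj_pt intro!: imageI)
qed

lemma matrix_inv_both: "invertible A \<Longrightarrow> A ** matrix_inv A = mat 1 \<and> matrix_inv A ** A = mat 1"
  unfolding invertible_def matrix_inv_def by (rule someI_ex)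

lemma det_scaleR: "det (c *\<^sub>R A) = c ^ CARD('m) * det A" for A :: "real^'m^'m"
proof -
  have "(\<chi> i. c *s A $ i) = c *\<^sub>R A" by (simp add: vec_eq_iff)
  then show ?thesis using det_rows_mul[of "\<lambda>i. c" "\<lambda>i. A $ i"] by simp
qed

lemma PGL_pow: "pgl_class A [^]\<^bsub>PGL\<^esub> (k::nat) = pgl_class (mpow A k)"
proof (induction k)
  case 0
  show ?case by (simp add: nat_pow_def PGL_simps)
next
  case (Suc k)
  have "mpow A k ** A = A ** mpow A k" by (induction k) (simp_all flip: matrix_mul_assoc)
  then show ?case using Suc by (simp add: nat_pow_def PGL_mult)
qed

locale projective_action =
  fixes \<Omega> :: "(real^'m) set set" and \<Gamma> :: "(real^'m^'m) set set"
  assumes pc: "properly_convex \<Omega>"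
    and dom: "proj_open \<Omega>" "\<Omega> \<noteq> {}"
    and sub: "subgroup \<Gamma> PGL" "\<Gamma> \<subseteq> PGL_of \<Omega>"
    and fg: "finitely_generated_sub PGL \<Gamma>"
    and disc: "pgl_discrete \<Gamma>"
    and tf: "torsion_free_sub PGL \<Gamma>"
    and noab: "\<And>N. N \<lhd> (PGL\<lparr>carrier := \<Gamma>\<rparr>) \<Longrightarrow> (\<forall>x\<in>N. \<forall>y\<in>N. x \<otimes>\<^bsub>PGL\<^esub> y = y \<otimes>\<^bsub>PGL\<^esub> x)
                 \<Longrightarrow> N = {\<one>\<^bsub>PGL\<^esub>}"
begin

definition "\<phi> = (SOME \<phi>. \<phi> \<noteq> 0 \<and> proj_closure \<Omega> \<subseteq> affine_chart \<phi> \<and> convex (chart_slice \<phi> \<Omega>)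
        \<and> convex (chart_slice \<phi> (proj_closure \<Omega>)) \<and> compact (chart_slice \<phi> (proj_closure \<Omega>)))"

definition "C = {v. \<phi> \<bullet> v > 0 \<and> proj_pt v \<in> \<Omega>}"

text \<open>Among the multiples of a representing matrix, the determinant condition fixes the size
  and preservation of \<open>C\<close> fixes the sign, so \<open>\<Gamma>\<close> lifts to
  \<open>H\<close> without a choice.\<close>

definition "H = {A :: real^'m^'m. invertible A \<and> pgl_class A \<in> \<Gamma> \<and> (\<forall>v\<in>C. A *v v \<in> C) \<and> \<bar>det A\<bar> = 1}"

lemma \<phi>: "proj_closure \<Omega> \<subseteq> affine_chart \<phi>" "convex (chart_slice \<phi> \<Omega>)" "compact (chart_slice \<phi> (proj_closure \<Omega>))"
proof -
  have "\<exists>\<phi>. \<phi> \<noteq> 0 \<and> proj_closure \<Omega> \<subseteq> affine_chart \<phi> \<and> convex (chart_slice \<phi> \<Omega>)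
        \<and> convex (chart_slice \<phi> (proj_closure \<Omega>)) \<and> compact (chart_slice \<phi> (proj_closure \<Omega>))"
    using pc unfolding properly_convex_def by blast
  from someI_ex[OF this] show "proj_closure \<Omega> \<subseteq> affine_chart \<phi>" "convex (chart_slice \<phi> \<Omega>)" "compact (chart_slice \<phi> (proj_closure \<Omega>))"
    unfolding \<phi>_def by blast+
qed

section \<open>The open sharp cone over the domain\<close>

lemma \<Omega>_RP: "p \<in> \<Omega> \<Longrightarrow> \<exists>v. v \<noteq> 0 \<and> p = proj_pt v"
  using dom(1) by (auto simp: proj_open_def RP_def)

lemma proj_pt_nz: "proj_pt v \<in> \<Omega> \<Longrightarrow> v \<noteq> 0"
proof
  assume "proj_pt v \<in> \<Omega>" "v = 0"
  then obtain w where w: "w \<noteq> 0" "proj_pt v = proj_pt w" using \<Omega>_RP by blast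
  then have "w \<in> proj_pt v" using proj_pt_self[of w] by simp
  then show False using w(1) \<open>v = 0\<close> by (auto simp: mem_proj_pt)
qed

lemma Union_\<Omega>: "v \<in> \<Union>\<Omega> \<longleftrightarrow> proj_pt v \<in> \<Omega>"
proof
  assume "v \<in> \<Union>\<Omega>"
  then obtain p where p: "p \<in> \<Omega>" "v \<in> p" by blast
  then obtain w where w: "p = proj_pt w" using \<Omega>_RP by blast
  then obtain c where "c \<noteq> 0" "v = c *\<^sub>R w" using p(2) by (auto simp: mem_proj_pt)
  with p(1) w show "proj_pt v \<in> \<Omega>" by (simp add: proj_pt_scale)
next
  assume "proj_pt v \<in> \<Omega>"
  then show "v \<in> \<Union>\<Omega>" using proj_pt_self[of v] by (rule UnionI)
qed

lemma proj_closure_superset: "proj_pt v \<in> \<Omega> \<Longrightarrow> proj_pt v \<in> proj_closure \<Omega>"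
proof -
  assume v: "proj_pt v \<in> \<Omega>"
  have "v \<in> closure (\<Union>\<Omega>)" by (rule subsetD[OF closure_subset iffD2[OF Union_\<Omega> v]])
  then show ?thesis unfolding proj_closure_def using proj_pt_nz[OF v] by (intro CollectI exI[of _ v]) simp
qed

lemma \<phi>_nz: "proj_pt v \<in> \<Omega> \<Longrightarrow> \<phi> \<bullet> v \<noteq> 0"
  using proj_closure_superset[of v] \<phi>(1) proj_pt_self[of v] by (auto simp: affine_chart_def)

lemma C_scale: "a > 0 \<Longrightarrow> v \<in> C \<Longrightarrow> a *\<^sub>R v \<in> C"
  by (simp add: C_def proj_pt_scale)

lemma C_slice: assumes "v \<in> C" shows "(1 / (\<phi> \<bullet> v)) *\<^sub>R v \<in> chart_slice \<phi> \<Omega>"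
  using assms by (simp add: C_def chart_slice_def proj_pt_scale)

lemma C_add: assumes u: "u \<in> C" and w: "w \<in> C" shows "u + w \<in> C"
proof -
  define a b where "a = \<phi> \<bullet> u" and "b = \<phi> \<bullet> w"
  have ab: "a > 0" "b > 0" using u w by (simp_all add: a_def b_def C_def)
  have "(a / (a + b)) *\<^sub>R ((1 / a) *\<^sub>R u) + (b / (a + b)) *\<^sub>R ((1 / b) *\<^sub>R w) \<in> chart_slice \<phi> \<Omega>"
    using C_slice[OF u] C_slice[OF w] ab
    by (intro convexD[OF \<phi>(2)]) (auto simp: a_def b_def simp flip: add_divide_distrib)
  then have "(1 / (a + b)) *\<^sub>R (u + w) \<in> chart_slice \<phi> \<Omega>" using ab by (simp add: scaleR_right_distrib)
  then have "(1 / (a + b)) *\<^sub>R (u + w) \<in> C" unfolding chart_slice_def C_def by auto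
  then have "(a + b) *\<^sub>R ((1 / (a + b)) *\<^sub>R (u + w)) \<in> C"
    by (rule C_scale[rotated]) (use ab in simp)
  moreover have "(a + b) *\<^sub>R ((1 / (a + b)) *\<^sub>R (u + w)) = u + w" using ab by simp
  ultimately show ?thesis by metis
qed

lemma C_ne: "C \<noteq> {}"
proof -
  obtain v where "proj_pt v \<in> \<Omega>" using dom(2) \<Omega>_RP by blast
  then have "v \<in> C \<or> - v \<in> C" using \<phi>_nz[of v] proj_pt_scale[of "- 1" v] by (auto simp: C_def)
  then show ?thesis by blast
qed

lemma pm_C: "proj_pt v \<in> \<Omega> \<Longrightarrow> v \<in> C \<or> - v \<in> C"
  using \<phi>_nz[of v] proj_pt_scale[of "- 1" v] by (auto simp: C_def)

lemma open_C: "open C"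
proof -
  have "C = \<Union>\<Omega> \<inter> {v. \<phi> \<bullet> v > 0}" unfolding C_def using Union_\<Omega> by blast
  then show ?thesis using dom(1) by (simp add: proj_open_def open_halfspace_gt open_Int)
qed

text \<open>Compactness of the closed slice bounds norm v by a multiple of \<phi> \<bullet> v on the
  cone. The functional is additive and positive there, so the norm of a sum controls the norm of
  each summand.\<close>

lemma ncone_C: "ncone C"
proof -
  obtain b where b: "\<And>y. y \<in> chart_slice \<phi> (proj_closure \<Omega>) \<Longrightarrow> norm y \<le> b"
    using compact_imp_bounded[OF \<phi>(3)] bounded_iff by metis
  have n: "norm v \<le> \<bar>b\<bar> * (\<phi> \<bullet> v)" if v: "v \<in> C" for v
  proof -
    have p: "\<phi> \<bullet> v > 0" using v by (simp add: C_def)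
    have "(1 / (\<phi> \<bullet> v)) *\<^sub>R v \<in> chart_slice \<phi> (proj_closure \<Omega>)"
      using C_slice[OF v] proj_closure_superset by (auto simp: chart_slice_def)
    then have "norm v / (\<phi> \<bullet> v) \<le> b" using b p by fastforce
    then have "norm v \<le> b * (\<phi> \<bullet> v)" using p by (simp add: field_simps)
    also have "\<dots> \<le> \<bar>b\<bar> * (\<phi> \<bullet> v)" using p by (intro mult_right_mono) auto
    finally show ?thesis .
  qed
  have "norm u \<le> (\<bar>b\<bar> * norm \<phi>) * norm (u + w)" if uw: "u \<in> C" "w \<in> C" for u w
  proof -
    have "norm u \<le> \<bar>b\<bar> * (\<phi> \<bullet> u)" by (rule n[OF uw(1)])
    also have "\<dots> \<le> \<bar>b\<bar> * (\<phi> \<bullet> (u + w))" using uw by (intro mult_left_mono) (auto simp: C_def inner_add_right)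
    also have "\<dots> \<le> \<bar>b\<bar> * (norm \<phi> * norm (u + w))" by (intro mult_left_mono norm_cauchy_schwarz) auto
    finally show ?thesis by (simp add: mult.assoc)
  qed
  then show ?thesis unfolding ncone_def using C_add C_scale by (auto simp: C_def)
qed

section \<open>Lifts of group elements\<close>

lemma \<Gamma>_act:
  assumes g: "pgl_class A \<in> \<Gamma>"
  shows "proj_pt v \<in> \<Omega> \<Longrightarrow> proj_pt (A *v v) \<in> \<Omega>"
    and "proj_pt v \<in> \<Omega> \<Longrightarrow> \<exists>w. proj_pt w \<in> \<Omega> \<and> v = A *v w"
proof -
  have im: "pgl_act (pgl_class A) ` \<Omega> = \<Omega>" using g sub(2) by (auto simp: PGL_of_def)
  show "proj_pt (A *v v) \<in> \<Omega>" if "proj_pt v \<in> \<Omega>" using im that by (metis imageI pgl_act_proj_pt)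
  show "\<exists>w. proj_pt w \<in> \<Omega> \<and> v = A *v w" if v: "proj_pt v \<in> \<Omega>"
  proof -
    obtain p where p: "p \<in> \<Omega>" "proj_pt v = pgl_act (pgl_class A) p" using im v by blast
    obtain w where w: "p = proj_pt w" using \<Omega>_RP[OF p(1)] by blast
    have "v \<in> proj_pt (A *v w)" using p(2) proj_pt_self[of v] by (simp add: w pgl_act_proj_pt)
    then obtain c where c: "c \<noteq> 0" "v = A *v (c *\<^sub>R w)" by (auto simp: mem_proj_pt matrix_vector_mult_scaleR)
    then show ?thesis using p(1) w by (intro exI[of _ "c *\<^sub>R w"]) (simp add: proj_pt_scale)
  qed
qed

lemma H_D: assumes "A \<in> H" shows "invertible A" "pgl_class A \<in> \<Gamma>" "v \<in> C \<Longrightarrow> A *v v \<in> C" "\<bar>det A\<bar> = 1"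
  using assms by (auto simp: H_def)

text \<open>A root normalizes the determinant. For the sign, \<phi> does not vanish on the image of
  \<open>C\<close>, so it has constant sign there by convexity, and A or its negative preserves
  \<open>C\<close>.\<close>

lemma lift_exists: assumes g: "g \<in> \<Gamma>" shows "\<exists>A\<in>H. pgl_class A = g"
proof -
  have "g \<in> carrier PGL" using g sub(1) subgroup.subset by blast
  then obtain A0 where A0: "invertible A0" "g = pgl_class A0" by (auto simp: PGL_simps)
  have d0: "det A0 \<noteq> 0" using A0(1) invertible_det_nz by blast
  define c where "c = root CARD('m) (1 / \<bar>det A0\<bar>)"
  have c: "c > 0" "c ^ CARD('m) = 1 / \<bar>det A0\<bar>" using d0 by (simp_all add: c_def)
  define A where "A = c *\<^sub>R A0"
  have A: "pgl_class A = g" "\<bar>det A\<bar> = 1" using c d0 A0(2) by (simp_all add: A_def pgl_class_scale det_scaleR abs_mult)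
  have dir: "(\<forall>v\<in>C. A *v v \<in> C) \<or> (\<forall>v\<in>C. (- 1) *\<^sub>R A *v v \<in> C)"
  proof -
    have nz: "\<phi> \<bullet> (A *v v) \<noteq> 0" and pm: "A *v v \<in> C \<or> - (A *v v) \<in> C" if "v \<in> C" for v
      using \<Gamma>_act(1)[of A v] that A(1) g \<phi>_nz pm_C by (auto simp: C_def)
    have "\<not> (\<phi> \<bullet> (A *v u) < 0 \<and> 0 < \<phi> \<bullet> (A *v w))" if uw: "u \<in> C" "w \<in> C" for u w
    proof
      assume s: "\<phi> \<bullet> (A *v u) < 0 \<and> 0 < \<phi> \<bullet> (A *v w)"
      \<comment> \<open>The positive combination of u and w on whose image \<phi> vanishes.\<close>
      define z where "z = (\<phi> \<bullet> (A *v w)) *\<^sub>R u + (- (\<phi> \<bullet> (A *v u))) *\<^sub>R w"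
      have "z \<in> C" unfolding z_def using uw s by (intro C_add C_scale) auto
      moreover have "\<phi> \<bullet> (A *v z) = 0"
        by (simp add: z_def matrix_vector_mult_diff_distrib matrix_vector_mult_scaleR inner_diff_right)
      ultimately show False using nz by blast
    qed
    then have "(\<forall>v\<in>C. \<phi> \<bullet> (A *v v) > 0) \<or> (\<forall>v\<in>C. \<phi> \<bullet> (A *v v) < 0)" using nz by (meson linorder_neqE_linordered_idom)
    then show ?thesis
    proof
      assume p: "\<forall>v\<in>C. \<phi> \<bullet> (A *v v) > 0"
      then have "\<forall>v\<in>C. A *v v \<in> C" using pm by (fastforce simp: C_def)
      then show ?thesis by blast
    next
      assume p: "\<forall>v\<in>C. \<phi> \<bullet> (A *v v) < 0"
      have "(- 1) *\<^sub>R A *v v \<in> C" if v: "v \<in> C" for v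
      proof -
        have "A *v v \<notin> C" using p v by (force simp: C_def)
        then have "- (A *v v) \<in> C" using pm[OF v] by blast
        then show ?thesis using matrix_vector_scaleR_left[of "- 1" A v] by simp
      qed
      then show ?thesis by blast
    qed
  qed
  have inv: "invertible B" if "\<bar>det B\<bar> = 1" for B :: "real^'m^'m" using that invertible_det_nz[of B] by auto
  have B: "pgl_class ((- 1) *\<^sub>R A) = g" "\<bar>det ((- 1) *\<^sub>R A)\<bar> = 1"
    using A pgl_class_scale[of "- 1" A] det_scaleR[of "- 1" A] by (simp_all add: abs_mult)
  show ?thesis
    using dir
  proof
    assume "\<forall>v\<in>C. A *v v \<in> C"
    then have "A \<in> H" using A g inv by (simp add: H_def)
    then show ?thesis using A(1) by blast
  next
    assume "\<forall>v\<in>C. (- 1) *\<^sub>R A *v v \<in> C"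
    then have "(- 1) *\<^sub>R A \<in> H" unfolding H_def using B g inv[OF B(2)] by blast
    then show ?thesis using B(1) by blast
  qed
qed

text \<open>Two lifts differ by a scalar. It is positive because both map a point of
  \<open>C\<close> into \<open>C\<close>, and its power CARD('m) is 1 by the determinants.\<close>

lemma lift_unique: assumes A: "A \<in> H" and B: "B \<in> H" and e: "pgl_class A = pgl_class B" shows "A = B"
proof -
  have "B \<in> pgl_class A" using e pgl_class_self by blast
  then obtain c where c: "c \<noteq> 0" "B = c *\<^sub>R A" by (auto simp: mem_pgl_class)
  obtain v where v: "v \<in> C" using C_ne by blast
  have "\<phi> \<bullet> (A *v v) > 0" "\<phi> \<bullet> (B *v v) > 0" using H_D(3)[OF A v] H_D(3)[OF B v] by (auto simp: C_def)
  then have "c > 0" by (simp add: c(2) matrix_vector_scaleR_left zero_less_mult_iff)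
  moreover have "c ^ CARD('m) = 1 ^ CARD('m)"
    using H_D(4)[OF A] H_D(4)[OF B] \<open>c > 0\<close> by (simp add: c(2) det_scaleR abs_mult)
  ultimately have "c = 1" by (intro power_eq_imp_eq_base[of c "CARD('m)" 1]) auto
  then show ?thesis by (simp add: c(2))
qed

lemma pgl_class_mult_in: "A \<in> H \<Longrightarrow> B \<in> H \<Longrightarrow> pgl_class (A ** B) \<in> \<Gamma>"
  using subgroup.m_closed[OF sub(1)] H_D(2) by (metis PGL_mult)

sublocale matgrp H
proof
  show one: "mat 1 \<in> H" using subgroup.one_closed[OF sub(1)] by (auto simp: H_def PGL_simps invertible_def)
  show "A ** B \<in> H" if "A \<in> H" "B \<in> H" for A B
    using that H_D[OF that(1)] H_D[OF that(2)] pgl_class_mult_in[OF that]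
    by (auto simp: H_def det_mul abs_mult invertible_mult simp flip: matrix_vector_mul_assoc)
  show i: "A ** matrix_inv A = mat 1" "matrix_inv A ** A = mat 1" if "A \<in> H" for A
    using matrix_inv_both[OF H_D(1)[OF that]] by auto
  show "matrix_inv A \<in> H" if A: "A \<in> H" for A
  proof -
    let ?B = "matrix_inv A"
    have inv: "invertible ?B" using i[OF A] by (auto simp: invertible_def)
    have cA: "pgl_class A \<in> carrier PGL" "pgl_class ?B \<in> carrier PGL" using H_D(1)[OF A] inv by (auto simp: PGL_simps)
    have "pgl_class ?B = inv\<^bsub>PGL\<^esub> (pgl_class A)"
      by (rule group.inv_equality[OF group_PGL, symmetric]) (auto simp: PGL_mult i[OF A] PGL_simps(2) cA)
    then have 1: "pgl_class ?B \<in> \<Gamma>" using subgroup.m_inv_closed[OF sub(1) H_D(2)[OF A]] by simp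
    have "det A * det ?B = 1" using i(1)[OF A] by (metis det_I det_mul)
    then have 2: "\<bar>det ?B\<bar> = 1" using H_D(4)[OF A] by (metis abs_mult abs_one mult_1)
    have 3: "?B *v v \<in> C" if v: "v \<in> C" for v
    proof -
      have "proj_pt v \<in> \<Omega>" using v by (simp add: C_def)
      then obtain w where w: "proj_pt w \<in> \<Omega>" "v = A *v w" using \<Gamma>_act(2)[OF H_D(2)[OF A]] by blast
      have "- w \<notin> C"
      proof
        assume "- w \<in> C"
        then have "A *v (- w) \<in> C" by (rule H_D(3)[OF A])
        then have "- v \<in> C" by (simp add: w(2) linear_neg[OF matrix_vector_mul_linear])
        then show False using v by (simp add: C_def)
      qed
      then have "w \<in> C" using pm_C[OF w(1)] by blast
      moreover have "?B *v v = w" by (simp add: w(2) matrix_vector_mul_assoc i[OF A])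
      ultimately show ?thesis by simp
    qed
    show ?thesis unfolding H_def using inv 1 2 3 by blast
  qed
qed

lemma inv_class: "A \<in> H \<Longrightarrow> inv\<^bsub>PGL\<^esub> (pgl_class A) = pgl_class (matrix_inv A)"
  by (rule group.inv_equality[OF group_PGL])
    (use H_D(1) inv_in in \<open>auto simp: PGL_mult inv_left PGL_simps\<close>)

lemma group_\<Gamma>: "group (PGL\<lparr>carrier := \<Gamma>\<rparr>)"
  by (rule subgroup.subgroup_is_group[OF sub(1) group_PGL])

lemma no_normal_abelian_H: "no_normal_abelian H"
  unfolding no_normal_abelian_def
proof (intro allI impI, elim conjE)
  fix N assume N: "N \<subseteq> H" "mat 1 \<in> N" "\<forall>a\<in>N. \<forall>b\<in>N. a ** b \<in> N" "\<forall>a\<in>N. matrix_inv a \<in> N"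
    "\<forall>g\<in>H. \<forall>a\<in>N. g ** a ** matrix_inv g \<in> N" "\<forall>a\<in>N. \<forall>b\<in>N. a ** b = b ** a"
  let ?G = "PGL\<lparr>carrier := \<Gamma>\<rparr>"
  have inv: "inv\<^bsub>?G\<^esub> (pgl_class A) = pgl_class (matrix_inv A)" if "A \<in> H" for A
    using group.m_inv_consistent[OF group_PGL sub(1) H_D(2)[OF that]] inv_class[OF that] by simp
  have "pgl_class ` N \<lhd> ?G"
    unfolding group.normal_inv_iff[OF group_\<Gamma>]
  proof (intro conjI ballI)
    show "subgroup (pgl_class ` N) ?G"
    proof (rule group.subgroupI[OF group_\<Gamma>])
      show "pgl_class ` N \<subseteq> carrier ?G" using N(1) H_D(2) by auto
      show "pgl_class ` N \<noteq> {}" using N(2) by blast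
      show "inv\<^bsub>?G\<^esub> a \<in> pgl_class ` N" if "a \<in> pgl_class ` N" for a
        using that N(1,4) inv by auto
      show "a \<otimes>\<^bsub>?G\<^esub> b \<in> pgl_class ` N" if "a \<in> pgl_class ` N" "b \<in> pgl_class ` N" for a b
        using that N(3) by (auto simp: PGL_mult)
    qed
    fix x a assume x: "x \<in> carrier ?G" and a: "a \<in> pgl_class ` N"
    obtain A where A: "A \<in> H" "x = pgl_class A" using lift_exists x by auto
    obtain B where B: "B \<in> N" "a = pgl_class B" using a by blast
    have "x \<otimes>\<^bsub>?G\<^esub> a \<otimes>\<^bsub>?G\<^esub> inv\<^bsub>?G\<^esub> x = pgl_class (A ** B ** matrix_inv A)"
      using inv[OF A(1)] by (simp add: A(2) B(2) PGL_mult)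
    then show "x \<otimes>\<^bsub>?G\<^esub> a \<otimes>\<^bsub>?G\<^esub> inv\<^bsub>?G\<^esub> x \<in> pgl_class ` N" using N(5) A(1) B(1) by auto
  qed
  moreover have "\<forall>x\<in>pgl_class ` N. \<forall>y\<in>pgl_class ` N. x \<otimes>\<^bsub>PGL\<^esub> y = y \<otimes>\<^bsub>PGL\<^esub> x"
    using N(6) by (auto simp: PGL_mult)
  ultimately have "pgl_class ` N = {\<one>\<^bsub>PGL\<^esub>}" by (rule noab)
  then have "pgl_class a = pgl_class (mat 1)" if "a \<in> N" for a using that by (auto simp: PGL_simps)
  then show "N = {mat 1}" using N(1,2) lift_unique one_in by blast
qed

definition "generating = (SOME S. finite S \<and> S \<subseteq> \<Gamma> \<and> generate PGL S = \<Gamma>)"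

lemma generating: "finite generating" "generating \<subseteq> \<Gamma>" "generate PGL generating = \<Gamma>"
proof -
  have "\<exists>S. finite S \<and> S \<subseteq> \<Gamma> \<and> generate PGL S = \<Gamma>" using fg by (simp add: finitely_generated_sub_def)
  from someI_ex[OF this] show "finite generating" "generating \<subseteq> \<Gamma>" "generate PGL generating = \<Gamma>"
    unfolding generating_def by blast+
qed

sublocale cone_group H C "{A \<in> H. pgl_class A \<in> generating}"
proof
  show "block H (mat 1) (\<lambda>h. h) C"
    unfolding block_def using open_C C_ne ncone_C H_D(3) by auto
  show "\<exists>\<epsilon>>0. \<forall>h\<in>H. norm (h - mat 1) < \<epsilon> \<longrightarrow> h = mat 1"
  proof -
    have "pgl_class (mat 1) \<in> \<Gamma>" using H_D(2)[OF one_in] .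
    then obtain U where U: "pgl_open U" "U \<inter> \<Gamma> = {pgl_class (mat 1)}" using disc unfolding pgl_discrete_def by blast
    have "open {A. invertible A \<and> pgl_class A \<in> U}" using U(1) by (simp add: pgl_open_def)
    moreover have "mat 1 \<in> {A. invertible A \<and> pgl_class A \<in> U}" using U(2) H_D(1)[OF one_in] by auto
    ultimately obtain e where e: "e > 0" "ball (mat 1) e \<subseteq> {A. invertible A \<and> pgl_class A \<in> U}"
      by (rule openE)
    have "h = mat 1" if h: "h \<in> H" "norm (h - mat 1) < e" for h
    proof -
      have "h \<in> ball (mat 1) e" using h(2) by (simp add: dist_norm norm_minus_commute)
      then have "pgl_class h \<in> U \<inter> \<Gamma>" using e(2) H_D(2)[OF h(1)] by blast
      then show ?thesis using U(2) lift_unique[OF h(1) one_in] by auto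
    qed
    then show ?thesis using e(1) by blast
  qed
  show "\<bar>det h\<bar> = 1" if "h \<in> H" for h using H_D(4)[OF that] .
  show "h = mat 1" if h: "h \<in> H" "k > 0" "mpow h k = mat 1" for h k
  proof -
    have "pgl_class h [^]\<^bsub>PGL\<^esub> k = \<one>\<^bsub>PGL\<^esub>" by (simp add: PGL_pow h(3) PGL_simps)
    then have "pgl_class h = \<one>\<^bsub>PGL\<^esub>" using tf h(2) H_D(2)[OF h(1)] unfolding torsion_free_sub_def by blast
    then show ?thesis using lift_unique[OF h(1) one_in] by (simp add: PGL_simps)
  qed
  show "no_normal_abelian H" by (rule no_normal_abelian_H)
  show "finite {A \<in> H. pgl_class A \<in> generating}"
  proof (rule finite_imageD)
    show "finite (pgl_class ` {A \<in> H. pgl_class A \<in> generating})"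
      by (rule finite_subset[OF _ generating(1)]) auto
    show "inj_on pgl_class {A \<in> H. pgl_class A \<in> generating}" by (rule inj_onI) (auto intro: lift_unique)
  qed
  show "{A \<in> H. pgl_class A \<in> generating} \<subseteq> H" by blast
  fix P h assume h: "h \<in> H" and P: "P (mat 1)" "\<And>s. s \<in> {A \<in> H. pgl_class A \<in> generating} \<Longrightarrow> P s"
    "\<And>s. s \<in> {A \<in> H. pgl_class A \<in> generating} \<Longrightarrow> P (matrix_inv s)"
    "\<And>a b. a \<in> H \<Longrightarrow> b \<in> H \<Longrightarrow> P a \<Longrightarrow> P b \<Longrightarrow> P (a ** b)"
  \<comment> \<open>Generation is known for classes, so the induction produces some lift with
    property \<open>P\<close>; uniqueness of lifts identifies it with \<open>h\<close>.\<close>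
  have "\<exists>h\<in>H. pgl_class h = g \<and> P h" if "g \<in> generate PGL generating" for g
    using that
  proof (induction rule: generate.induct)
    case one
    show ?case using one_in P(1) by (auto simp: PGL_simps)
  next
    case (incl s)
    then obtain A where A: "A \<in> H" "pgl_class A = s" using lift_exists generating(2) by blast
    then have "P A" using incl P(2) by simp
    then show ?case using A by blast
  next
    case (inv s)
    then obtain A where A: "A \<in> H" "pgl_class A = s" using lift_exists generating(2) by blast
    then have "P (matrix_inv A)" using inv P(3) by simp
    then show ?case using A inv_in[OF A(1)] inv_class[OF A(1)] by auto
  next
    case (eng g1 g2)
    then obtain A B where "A \<in> H" "pgl_class A = g1" "P A" "B \<in> H" "pgl_class B = g2" "P B" by blast
    then show ?case using P(4) mult_in PGL_mult by blast
  qed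
  then obtain h' where "h' \<in> H" "pgl_class h' = pgl_class h" "P h'" using generating(3) H_D(2)[OF h] by blast
  then show "P h" using lift_unique[OF _ h] by blast
qed

text \<open>Saturations of small balls by the group are invariant open sets covering \<Omega>. A
  finite subcover leaves finitely many closed balls inside \<open>C\<close> whose translates fill
  the cone up to scalars, and these are positive since both points lie in \<open>C\<close>.\<close>

lemma cocompact_lift:
  assumes cq: "compact_quotient \<Omega> \<Gamma>"
  obtains Q where "compact Q" "Q \<subseteq> C" "\<And>y. y \<in> C \<Longrightarrow> \<exists>h\<in>H. \<exists>a>0. \<exists>q\<in>Q. y = a *\<^sub>R (h *v q)"
proof -
  have "\<forall>y\<in>C. \<exists>r>0. cball y r \<subseteq> C" using open_C open_contains_cball by blast
  then obtain r where r: "\<And>y. y \<in> C \<Longrightarrow> r y > 0 \<and> cball y (r y) \<subseteq> C" by metis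
  have rb: "z \<in> C" if "y \<in> C" "z \<in> ball y (r y)" for y z using r[OF that(1)] that(2) ball_subset_cball by blast
  define U where "U y = {proj_pt (h *v z) | h z. h \<in> H \<and> z \<in> ball y (r y)}" for y
  have U: "U y \<subseteq> \<Omega>" "proj_open (U y)" "\<forall>g\<in>\<Gamma>. pgl_act g ` U y = U y" if y: "y \<in> C" for y
  proof -
    show sub\<Omega>: "U y \<subseteq> \<Omega>"
    proof
      fix p assume "p \<in> U y"
      then obtain h z where hz: "h \<in> H" "z \<in> ball y (r y)" "p = proj_pt (h *v z)" by (auto simp: U_def)
      then have "h *v z \<in> C" using H_D(3)[OF hz(1)] rb[OF y] by blast
      then show "p \<in> \<Omega>" by (simp add: hz(3) C_def)
    qed
    have "\<Union>(U y) = (\<Union>h\<in>H. \<Union>c\<in>-{0}. (\<lambda>x. (1 / c) *\<^sub>R (matrix_inv h *v x)) -` ball y (r y))"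
    proof (intro Set.set_eqI iffI)
      fix x assume "x \<in> \<Union>(U y)"
      then obtain h z c where hz: "h \<in> H" "z \<in> ball y (r y)" "c \<noteq> 0" "x = c *\<^sub>R (h *v z)" by (auto simp: U_def mem_proj_pt)
      then have "(1 / c) *\<^sub>R (matrix_inv h *v x) = z" by (simp add: matrix_vector_mult_scaleR inv_act)
      then show "x \<in> (\<Union>h\<in>H. \<Union>c\<in>-{0}. (\<lambda>x. (1 / c) *\<^sub>R (matrix_inv h *v x)) -` ball y (r y))"
        using hz(1,2,3) by (intro UN_I[of h] UN_I[of c]) auto
    next
      fix x assume "x \<in> (\<Union>h\<in>H. \<Union>c\<in>-{0}. (\<lambda>x. (1 / c) *\<^sub>R (matrix_inv h *v x)) -` ball y (r y))"
      then obtain h c where hc: "h \<in> H" "c \<noteq> 0" "(1 / c) *\<^sub>R (matrix_inv h *v x) \<in> ball y (r y)" by blast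
      define z where "z = (1 / c) *\<^sub>R (matrix_inv h *v x)"
      have "x = c *\<^sub>R (h *v z)" using hc by (simp add: z_def matrix_vector_mult_scaleR inv_act)
      then have "x \<in> proj_pt (h *v z)" using hc(2) by (auto simp: mem_proj_pt)
      moreover have "proj_pt (h *v z) \<in> U y" using hc(1,3) by (auto simp: U_def z_def)
      ultimately show "x \<in> \<Union>(U y)" by blast
    qed
    moreover have "open (\<Union>h\<in>H. \<Union>c\<in>-{0}. (\<lambda>x. (1 / c) *\<^sub>R (matrix_inv h *v x)) -` ball y (r y))"
      by (intro open_UN ballI open_vimage open_ball continuous_intros linear_continuous_on matrix_vector_mul_bounded_linear)
    ultimately have "open (\<Union>(U y))" by simp
    then show "proj_open (U y)" using sub\<Omega> dom(1) by (auto simp: proj_open_def)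
    show "\<forall>g\<in>\<Gamma>. pgl_act g ` U y = U y"
    proof
      fix g assume "g \<in> \<Gamma>"
      then obtain k where k: "k \<in> H" "g = pgl_class k" using lift_exists by blast
      have act: "pgl_act g (proj_pt (h *v z)) = proj_pt ((k ** h) *v z)" for h z
        by (simp add: k(2) pgl_act_proj_pt matrix_vector_mul_assoc)
      show "pgl_act g ` U y = U y"
      proof (intro equalityI subsetI)
        fix p assume "p \<in> pgl_act g ` U y"
        then obtain h z where "h \<in> H" "z \<in> ball y (r y)" "p = proj_pt ((k ** h) *v z)" by (auto simp: U_def act)
        then show "p \<in> U y" using mult_in[OF k(1)] unfolding U_def by blast
      next
        fix p assume "p \<in> U y"
        then obtain h z where hz: "h \<in> H" "z \<in> ball y (r y)" "p = proj_pt (h *v z)" by (auto simp: U_def)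
        have "p = pgl_act g (proj_pt ((matrix_inv k ** h) *v z))"
          by (simp add: act hz(3) matrix_mul_assoc inv_right k(1))
        moreover have "proj_pt ((matrix_inv k ** h) *v z) \<in> U y"
          using mult_in[OF inv_in[OF k(1)] hz(1)] hz(2) unfolding U_def by blast
        ultimately show "p \<in> pgl_act g ` U y" by blast
      qed
    qed
  qed
  have "\<Omega> \<subseteq> \<Union>(U ` C)"
  proof
    fix p assume "p \<in> \<Omega>"
    then obtain w where "p = proj_pt w" "proj_pt w \<in> \<Omega>" using \<Omega>_RP by blast
    then obtain v where v: "v \<in> C" "p = proj_pt v" using pm_C[of w] proj_pt_scale[of "- 1" w] by auto
    then have "p \<in> U v" unfolding U_def using one_in r[OF v(1)] by (auto intro!: exI[of _ "mat 1"] exI[of _ v])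
    then show "p \<in> \<Union>(U ` C)" using v(1) by blast
  qed
  then obtain \<V> where V: "finite \<V>" "\<V> \<subseteq> U ` C" "\<Omega> \<subseteq> \<Union>\<V>"
    using cq[unfolded compact_quotient_def, rule_format, of "U ` C"] U by (metis (no_types, lifting) imageE)
  obtain Y where Y: "Y \<subseteq> C" "finite Y" "\<V> = U ` Y" using finite_subset_image[OF V(1,2)] by blast
  define Q where "Q = (\<Union>y\<in>Y. cball y (r y))"
  show thesis
  proof (rule that)
    show "compact Q" using Y(2) by (auto simp: Q_def)
    show "Q \<subseteq> C" using Y(1) r by (auto simp: Q_def)
    fix v assume v: "v \<in> C"
    then have "proj_pt v \<in> \<Omega>" by (simp add: C_def)
    then obtain y where y: "y \<in> Y" "proj_pt v \<in> U y" using V(3) Y(3) by blast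
    then obtain h z where hz: "h \<in> H" "z \<in> ball y (r y)" "proj_pt v = proj_pt (h *v z)" by (auto simp: U_def)
    then have "v \<in> proj_pt (h *v z)" using proj_pt_self by blast
    then obtain c where c: "c \<noteq> 0" "v = c *\<^sub>R (h *v z)" by (auto simp: mem_proj_pt)
    have "h *v z \<in> C" using H_D(3)[OF hz(1)] rb hz(2) y(1) Y(1) by blast
    then have "c > 0" using v by (auto simp: C_def c(2) zero_less_mult_iff)
    moreover have "z \<in> Q" using hz(2) y(1) ball_subset_cball by (auto simp: Q_def intro!: bexI[of _ y])
    ultimately show "\<exists>h\<in>H. \<exists>a>0. \<exists>q\<in>Q. v = a *\<^sub>R (h *v q)" using hz(1) c(2) by blast
  qed
qed

text \<open>The lattice coordinates other than \<open>i0\<close> and \<open>i1\<close> are numbered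
  by \<open>\<iota>\<close> and fed through the isomorphism onto \<open>G\<close>. The finite set
  from \<open>lattice_cofinite\<close> then represents every right coset.\<close>

lemma infinite_index_contra:
  assumes n: "CARD('m) \<ge> 2" and m: "model H P1 P2 s1 s2 K1 K2"
    and G: "subgroup G (PGL\<lparr>carrier := \<Gamma>\<rparr>)" "PGL\<lparr>carrier := G\<rparr> \<cong> Zpow_group (CARD('m) - 2)"
    and inf: "infinite (rcosets\<^bsub>PGL\<lparr>carrier := \<Gamma>\<rparr>\<^esub> G)"
  shows False
proof -
  interpret m: model H P1 P2 s1 s2 K1 K2 by (rule m)
  let ?Z = "Zpow_group (CARD('m) - 2)"
  have gG: "group (PGL\<lparr>carrier := G\<rparr>)"
    using subgroup.subgroup_is_group[OF G(1) group_\<Gamma>] by simp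
  obtain \<psi> where \<psi>: "\<psi> \<in> iso ?Z (PGL\<lparr>carrier := G\<rparr>)"
    using group.iso_sym[OF gG G(2)] by (auto simp: is_iso_def)
  have G\<Gamma>: "G \<subseteq> \<Gamma>" using subgroup.subset[OF G(1)] by simp
  have \<psi>G: "\<psi> v \<in> G" if "v \<in> carrier ?Z" for v using \<psi> that by (auto simp: iso_def hom_def)
  have \<psi>mult: "\<psi> (\<lambda>i. v i + w i) = \<psi> v \<otimes>\<^bsub>PGL\<^esub> \<psi> w" if "v \<in> carrier ?Z" "w \<in> carrier ?Z" for v w
    using \<psi> that by (auto simp: iso_def hom_def Zpow_group_def)
  have \<psi>inj: "v = w" if "v \<in> carrier ?Z" "w \<in> carrier ?Z" "\<psi> v = \<psi> w" for v w
    using \<psi> that by (auto simp: iso_def bij_betw_def inj_on_def)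
  obtain i0 i1 :: 'm where i01: "i0 \<noteq> i1"
    using n by (metis card_2_iff' card_le_Suc0_iff_eq finite_class.finite_UNIV not_less_eq_eq numeral_2_eq_2 UNIV_I)
  have "card (UNIV - {i0, i1}) = CARD('m) - 2" using i01 by (simp add: card_Diff_subset)
  then obtain \<iota> where \<iota>: "bij_betw \<iota> {..<CARD('m) - 2} (UNIV - {i0, i1})"
    using ex_bij_betw_nat_finite[of "UNIV - {i0, i1}"] by (auto simp: atLeast0LessThan)
  \<comment> \<open>Floors are exact on the lattice and serve to make the map total; the value 0
    from index CARD('m) - 2 on is what membership in \<open>Zpow_group\<close> demands.\<close>
  define vec where "vec g = (\<lambda>j. if j < CARD('m) - 2 then \<lfloor>g $ \<iota> j\<rfloor> else 0)" for g :: "real^'m"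
  have vecZ: "vec g \<in> carrier ?Z" for g by (auto simp: vec_def Zpow_group_def)
  have vec_add: "vec (g + h) = (\<lambda>i. vec g i + vec h i)" if "g \<in> lattice" "h \<in> lattice" for g h
    using that by (auto simp: vec_def lattice_def fun_eq_iff floor_add2)
  define \<gamma> where "\<gamma> g = (SOME A. A \<in> H \<and> pgl_class A = \<psi> (vec g))" for g
  have \<gamma>: "\<gamma> g \<in> H" "pgl_class (\<gamma> g) = \<psi> (vec g)" for g
  proof -
    have "\<exists>A. A \<in> H \<and> pgl_class A = \<psi> (vec g)" using lift_exists \<psi>G[OF vecZ] G\<Gamma> by blast
    from someI_ex[OF this] show "\<gamma> g \<in> H" "pgl_class (\<gamma> g) = \<psi> (vec g)" unfolding \<gamma>_def by auto
  qed
  have \<gamma>add: "\<gamma> (g + h) = \<gamma> g ** \<gamma> h" if "g \<in> lattice" "h \<in> lattice" for g h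
  proof (rule lift_unique[OF \<gamma>(1) mult_in[OF \<gamma>(1) \<gamma>(1)]])
    show "pgl_class (\<gamma> (g + h)) = pgl_class (\<gamma> g ** \<gamma> h)"
      by (simp add: \<gamma>(2) vec_add[OF that] \<psi>mult vecZ flip: PGL_mult)
  qed
  have \<gamma>0: "\<gamma> 0 = mat 1"
  proof -
    have "\<gamma> 0 ** \<gamma> 0 = \<gamma> 0" using \<gamma>add[of 0 0] by simp
    then have "matrix_inv (\<gamma> 0) ** (\<gamma> 0 ** \<gamma> 0) = matrix_inv (\<gamma> 0) ** \<gamma> 0" by simp
    then show ?thesis by (simp add: matrix_mul_assoc inv_left \<gamma>(1))
  qed
  have inj: "g = h" if g: "g \<in> lattice" and h: "h \<in> lattice" and e: "\<gamma> g = \<gamma> h" "g $ i0 = h $ i0" "g $ i1 = h $ i1" for g h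
  proof -
    have "vec g = vec h" using \<psi>inj[OF vecZ vecZ] \<gamma>(2) e(1) by metis
    have "g $ i = h $ i" for i
    proof (cases "i = i0 \<or> i = i1")
      case False
      then obtain j where j: "j < CARD('m) - 2" "i = \<iota> j" using \<iota> by (auto simp: bij_betw_def image_iff)
      have "vec g j = vec h j" using \<open>vec g = vec h\<close> by simp
      then have "\<lfloor>g $ i\<rfloor> = \<lfloor>h $ i\<rfloor>" using j by (simp add: vec_def)
      moreover have "g $ i \<in> \<int>" "h $ i \<in> \<int>" using g h by (auto simp: lattice_def)
      ultimately show ?thesis by (metis of_int_floor)
    qed (use e in auto)
    then show ?thesis by (simp add: vec_eq_iff)
  qed
  obtain T where T: "finite T" "\<And>h. h \<in> H \<Longrightarrow> \<exists>g\<in>lattice. \<exists>f\<in>T. h = \<gamma> g ** f"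
    by (rule m.lattice_cofinite[OF n \<gamma>(1) \<gamma>0 \<gamma>add inj]) blast+
  let ?G = "PGL\<lparr>carrier := \<Gamma>\<rparr>"
  have "rcosets\<^bsub>?G\<^esub> G \<subseteq> (\<lambda>f. G #>\<^bsub>?G\<^esub> pgl_class f) ` T"
  proof
    fix X assume "X \<in> rcosets\<^bsub>?G\<^esub> G"
    then obtain a where a: "a \<in> \<Gamma>" "X = G #>\<^bsub>?G\<^esub> a" by (auto simp: RCOSETS_def)
    obtain h where h: "h \<in> H" "pgl_class h = a" using lift_exists a(1) by blast
    obtain g f where gf: "f \<in> T" "h = \<gamma> g ** f" using T(2)[OF h(1)] by blast
    have "f = matrix_inv (\<gamma> g) ** h" by (simp add: gf(2) matrix_mul_assoc inv_left \<gamma>(1))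
    then have fH: "f \<in> H" using mult_in inv_in \<gamma>(1) h(1) by blast
    have xG: "pgl_class (\<gamma> g) \<in> G" using \<gamma>(2) \<psi>G[OF vecZ] by simp
    have "a = pgl_class (\<gamma> g) \<otimes>\<^bsub>?G\<^esub> pgl_class f" using h(2) gf(2) by (simp add: PGL_mult)
    then have "X = (G #>\<^bsub>?G\<^esub> pgl_class (\<gamma> g)) #>\<^bsub>?G\<^esub> pgl_class f"
      using group.coset_mult_assoc[OF group_\<Gamma>, of G "pgl_class (\<gamma> g)" "pgl_class f"] G\<Gamma> xG H_D(2)[OF fH] a(2) by auto
    also have "G #>\<^bsub>?G\<^esub> pgl_class (\<gamma> g) = G"
      by (rule group.coset_join2[OF group_\<Gamma> _ G(1) xG]) (use xG G\<Gamma> in auto)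
    finally show "X \<in> (\<lambda>f. G #>\<^bsub>?G\<^esub> pgl_class f) ` T" using gf(1) by blast
  qed
  then show False using inf T(1) finite_surj by blast
qed

end

text \<open>Here CARD('m) is n + 1, so the rank CARD('m) - 2 is n - 1. A projective subspace is
  given by its linear subspace, with {0} standing for the empty one; invariance of its points under
  classes becomes linear invariance under the lifts in \<open>H\<close>.\<close>

theorem theorem0p2:
  fixes \<Omega> :: "(real^'m) set set" and \<Gamma> :: "(real^'m^'m) set set"
  assumes n: "CARD('m) \<ge> 2"
    and pc: "properly_convex \<Omega>"
    and dom: "proj_open \<Omega>" "\<Omega> \<noteq> {}"
    and sub: "subgroup \<Gamma> PGL" "\<Gamma> \<subseteq> PGL_of \<Omega>"
    and fg: "finitely_generated_sub PGL \<Gamma>"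
    and disc: "pgl_discrete \<Gamma>"
    and tf: "torsion_free_sub PGL \<Gamma>"
    and noab: "\<And>N. N \<lhd> (PGL\<lparr>carrier := \<Gamma>\<rparr>) \<Longrightarrow> (\<forall>x\<in>N. \<forall>y\<in>N. x \<otimes>\<^bsub>PGL\<^esub> y = y \<otimes>\<^bsub>PGL\<^esub> x)
                 \<Longrightarrow> N = {\<one>\<^bsub>PGL\<^esub>}"
    and alt: "compact_quotient \<Omega> \<Gamma> \<or>
              (\<exists>G. subgroup G (PGL\<lparr>carrier := \<Gamma>\<rparr>)
                   \<and> PGL\<lparr>carrier := G\<rparr> \<cong> Zpow_group (CARD('m) - 2)
                   \<and> infinite (rcosets\<^bsub>PGL\<lparr>carrier := \<Gamma>\<rparr>\<^esub> G))"
  shows "\<not> (\<exists>V. subspace V \<and> V \<noteq> {0} \<and> V \<noteq> UNIV \<and>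
              (\<forall>g\<in>\<Gamma>. pgl_act g ` proj_subspace V = proj_subspace V))"
proof
  assume "\<exists>V. subspace V \<and> V \<noteq> {0} \<and> V \<noteq> UNIV \<and> (\<forall>g\<in>\<Gamma>. pgl_act g ` proj_subspace V = proj_subspace V)"
  then obtain V where V: "subspace V" "V \<noteq> {0}" "V \<noteq> UNIV"
    and inv: "\<And>g. g \<in> \<Gamma> \<Longrightarrow> pgl_act g ` proj_subspace V = proj_subspace V" by blast
  interpret projective_action \<Omega> \<Gamma> by (rule projective_action.intro) (fact pc dom sub fg disc tf noab)+
  have "h *v v \<in> V" if h: "h \<in> H" and v: "v \<in> V" for h v
  proof (cases "v = 0")
    case False
    then have "proj_pt v \<in> proj_subspace V" using v by (auto simp: proj_subspace_def)
    then have "proj_pt (h *v v) \<in> proj_subspace V" using inv[OF H_D(2)[OF h]] by (metis imageI pgl_act_proj_pt)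
    then obtain w where "w \<in> V" "proj_pt (h *v v) = proj_pt w" by (auto simp: proj_subspace_def)
    then have "h *v v \<in> proj_pt w" using proj_pt_self by blast
    then show ?thesis using \<open>w \<in> V\<close> V(1) by (auto simp: mem_proj_pt subspace_scale)
  qed (use V(1) subspace_0 in simp)
  then obtain P1 P2 s1 s2 K1 K2 where m: "model H P1 P2 s1 s2 K1 K2" using model_exists[OF V] by blast
  interpret m: model H P1 P2 s1 s2 K1 K2 by (rule m)
  from alt show False
  proof
    assume "compact_quotient \<Omega> \<Gamma>"
    then obtain Q where "compact Q" "Q \<subseteq> C" "\<And>y. y \<in> C \<Longrightarrow> \<exists>h\<in>H. \<exists>a>0. \<exists>q\<in>Q. y = a *\<^sub>R (h *v q)"
      using cocompact_lift by metis
    then show False by (rule m.not_cocompact[OF bC discrete_C])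
  next
    assume "\<exists>G. subgroup G (PGL\<lparr>carrier := \<Gamma>\<rparr>) \<and> PGL\<lparr>carrier := G\<rparr> \<cong> Zpow_group (CARD('m) - 2)
                   \<and> infinite (rcosets\<^bsub>PGL\<lparr>carrier := \<Gamma>\<rparr>\<^esub> G)"
    then show False using infinite_index_contra[OF n m] by blast
  qed
qed

end
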